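(* Fix $d\ge2$. The maximum value of the metric entropy $h_{\mu^{*}}(\sigma^{*})$ over all $\Psi^{*}\in\mathcal{T}\mathcal{U}\mathcal{S}$ with their dual geometric Gibbs type measures $\mu^{*}$ is $\log d$, and the infimum of $h_{\mu^{*}}(\sigma^{*})$ over all $\Psi^{*}\in\mathcal{T}\mathcal{U}\mathcal{S}$ with their dual geometric Gibbs type measures $\mu^{*}$ is $0$.
   Context: $T$ is the unit circle. A circle endomorphism is an orientation-preserving covering map $f:T\to T$ of degree $d\ge2$ with $f(1)=1$; its lift is the homeomorphism $F:\mathbb{R}\to\mathbb{R}$ with $F(0)=0$, $F(x+1)=F(x)+d$ and $e^{2\pi i F(x)}=f(e^{2\pi i x})$. $f$ is uniformly symmetric if there is a bounded function $\varepsilon(t)>0$, $t>0$, with $\varepsilon(t)\to0$ as $t\to0^{+}$ and $$\frac{1}{1+\varepsilon(t)}\le\frac{|F^{-n}(x+t)-F^{-n}(x)|}{|F^{-n}(x)-F^{-n}(x-t)|}\le 1+\varepsilon(t)\quad\text{for all }x\in\mathbb{R},\ t>0,\ n>0.$$ $\mathcal{U}\mathcal{S}$ is the set of uniformly symmetric circle endomorphisms of degree $d$. $\Sigma^{*}$ is the space of left-infinite sequences $w^{*}=\cdots j_{n-1}\cdots j_1j_0$ over $\{0,\dots,d-1\}$ with the product topology; $[w_n^{*}]$ with $w_n^{*}=j_{n-1}\cdots j_0$ is the right cylinder of sequences ending in $j_{n-1}\cdots j_0$; the right shift is $\sigma^{*}(\cdots j_1j_0)=\cdots j_2j_1$. Dual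 derivative: for a word $w_n=i_0\cdots i_{n-1}$ let $I_{w_n}=F^{-n}([m,m+1])\subset[0,1]$, $m=i_{n-1}+i_{n-2}d+\cdots+i_0d^{n-1}$. Then $D^{*}(f)(w^{*})=\lim_{n\to\infty}|I_{v_{n-1}}|/|I_{w_n}|$, with $w_n=j_{n-1}\cdots j_1j_0$, $v_{n-1}=j_{n-1}\cdots j_1$ read left to right as words; for $f\in\mathcal{U}\mathcal{S}$ the limit exists and is a positive continuous function. Here $\mathcal{T}\mathcal{U}\mathcal{S}$ is identified with the set of functions $\{D^{*}(f): f\in\mathcal{U}\mathcal{S}\}$ on $\Sigma^{*}$. A non-atomic probability measure $\mu^{*}$ with support the whole $\Sigma^{*}$ is a dual geometric Gibbs type measure for $\Psi^{*}$ (i.e. for the potential $-\log\Psi^{*}$) if $$\lim_{n\to\infty}\frac{\mu^{*}(\sigma^{*}([w_n^{*}]))}{\mu^{*}([w_n^{*}])}=\Psi^{*}(w^{*})\quad\text{for all }w^{*}=\cdots w_n^{*}\in\Sigma^{*}.$$ $h_{\mu^{*}}(\sigma^{*})$ is the measure-theoretic (metric) entropy of $\sigma^{*}$ with respect to $\mu^{*}$. *)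

theory Defs
  imports "HOL-Probability.Probability"
begin

abbreviation unit_circle :: "complex set" where
  "unit_circle \<equiv> sphere 0 1"

text \<open>
  A circle map is a function on \<^typ>\<open>complex\<close> of which only the restriction to the unit circle
  matters. Strict monotonicity of the lift says that the map preserves orientation, and
  the equation for \<open>F (x + 1)\<close> says that its degree is \<open>d\<close>.
\<close>

definition is_circle_lift :: "nat \<Rightarrow> (complex \<Rightarrow> complex) \<Rightarrow> (real \<Rightarrow> real) \<Rightarrow> bool" where
  "is_circle_lift d f F \<longleftrightarrow>
     homeomorphism UNIV UNIV F (inv F) \<and> strict_mono F \<and> F 0 = 0 \<and>
     (\<forall>x. F (x + 1) = F x + real d) \<and>
     (\<forall>x. cis (2 * pi * F x) = f (cis (2 * pi * x)))"

definition circle_endomorphism :: "nat \<Rightarrow> (complex \<Rightarrow> complex) \<Rightarrow> bool" where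
  "circle_endomorphism d f \<longleftrightarrow>
     2 \<le> d \<and> covering_space unit_circle f unit_circle \<and> f 1 = 1 \<and> (\<exists>F. is_circle_lift d f F)"

text \<open>The lift is unique: two continuous lifts differ by a constant integer, and both vanish at 0.\<close>

definition circle_lift :: "nat \<Rightarrow> (complex \<Rightarrow> complex) \<Rightarrow> real \<Rightarrow> real" where
  "circle_lift d f = (THE F. is_circle_lift d f F)"

definition lift_inv_iter :: "nat \<Rightarrow> (complex \<Rightarrow> complex) \<Rightarrow> nat \<Rightarrow> real \<Rightarrow> real" where
  "lift_inv_iter d f n = inv (circle_lift d f) ^^ n"

definition uniformly_symmetric :: "nat \<Rightarrow> (complex \<Rightarrow> complex) \<Rightarrow> bool" where
  "uniformly_symmetric d f \<longleftrightarrow>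
     circle_endomorphism d f \<and>
     (\<exists>\<epsilon> :: real \<Rightarrow> real.
        (\<forall>t>0. \<epsilon> t > 0) \<and> bounded (\<epsilon> ` {0<..}) \<and> (\<epsilon> \<longlongrightarrow> 0) (at_right 0) \<and>
        (\<forall>x t n. t > 0 \<longrightarrow> n > 0 \<longrightarrow>
           (let G = lift_inv_iter d f n; q = \<bar>G (x + t) - G x\<bar> / \<bar>G x - G (x - t)\<bar>
            in 1 / (1 + \<epsilon> t) \<le> q \<and> q \<le> 1 + \<epsilon> t)))"

text \<open>
  A left-infinite sequence \<open>\<cdots> j\<^sub>2 j\<^sub>1 j\<^sub>0\<close> is the function \<open>k \<mapsto> j\<^sub>k\<close>. The function type carries
  the product topology of the discrete topology on \<^typ>\<open>nat\<close>, so subspace and Borel structure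
  on \<open>dual_space d\<close> are the ones of the product topology.
\<close>

definition dual_space :: "nat \<Rightarrow> (nat \<Rightarrow> nat) set" where
  "dual_space d = {w. \<forall>k. w k < d}"

definition dual_shift :: "(nat \<Rightarrow> nat) \<Rightarrow> nat \<Rightarrow> nat" where
  "dual_shift w = (\<lambda>k. w (Suc k))"

text \<open>The word \<open>j\<^bsub>n-1\<^esub> \<cdots> j\<^sub>1 j\<^sub>0\<close>, as a list read from left to right.\<close>

definition right_word :: "(nat \<Rightarrow> nat) \<Rightarrow> nat \<Rightarrow> nat list" where
  "right_word w n = map w (rev [0..<n])"

definition right_cylinder :: "nat \<Rightarrow> nat list \<Rightarrow> (nat \<Rightarrow> nat) set" where
  "right_cylinder d ws = {u \<in> dual_space d. right_word u (length ws) = ws}"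

definition word_value :: "nat \<Rightarrow> nat list \<Rightarrow> nat" where
  "word_value d ws = (\<Sum>k<length ws. ws ! k * d ^ (length ws - 1 - k))"

definition word_interval :: "nat \<Rightarrow> (complex \<Rightarrow> complex) \<Rightarrow> nat list \<Rightarrow> real set" where
  "word_interval d f ws =
     lift_inv_iter d f (length ws) ` {real (word_value d ws) .. real (word_value d ws) + 1}"

text \<open>
  Dropping the last letter of \<open>j\<^bsub>n-1\<^esub> \<cdots> j\<^sub>1 j\<^sub>0\<close> gives \<open>j\<^bsub>n-1\<^esub> \<cdots> j\<^sub>1\<close>, hence \<^const>\<open>butlast\<close>.
  The restriction makes a dual derivative a function on the dual space only.
\<close>

definition dual_derivative :: "nat \<Rightarrow> (complex \<Rightarrow> complex) \<Rightarrow> (nat \<Rightarrow> nat) \<Rightarrow> real" where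
  "dual_derivative d f = restrict
     (\<lambda>w. lim (\<lambda>n. measure lborel (word_interval d f (butlast (right_word w n))) /
                   measure lborel (word_interval d f (right_word w n))))
     (dual_space d)"

definition TUS :: "nat \<Rightarrow> ((nat \<Rightarrow> nat) \<Rightarrow> real) set" where
  "TUS d = {dual_derivative d f | f. uniformly_symmetric d f}"

definition non_atomic :: "'a measure \<Rightarrow> bool" where
  "non_atomic M \<longleftrightarrow>
     \<not> (\<exists>A\<in>sets M. emeasure M A > 0 \<and>
          (\<forall>B\<in>sets M. B \<subseteq> A \<longrightarrow> emeasure M B = 0 \<or> emeasure M (A - B) = 0))"

definition measure_support :: "'a::topological_space measure \<Rightarrow> 'a set" where
  "measure_support M =
     {x \<in> space M. \<forall>U. openin (top_of_set (space M)) U \<longrightarrow> x \<in> U \<longrightarrow> emeasure M U > 0}"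

definition dual_gibbs ::
    "nat \<Rightarrow> ((nat \<Rightarrow> nat) \<Rightarrow> real) \<Rightarrow> (nat \<Rightarrow> nat) measure \<Rightarrow> bool" where
  "dual_gibbs d \<Psi> \<mu> \<longleftrightarrow>
     sets \<mu> = sets (restrict_space borel (dual_space d)) \<and>
     prob_space \<mu> \<and> non_atomic \<mu> \<and> measure_support \<mu> = dual_space d \<and>
     (\<forall>w \<in> dual_space d.
        (\<lambda>n. measure \<mu> (dual_shift ` right_cylinder d (right_word w n)) /
             measure \<mu> (right_cylinder d (right_word w n))) \<longlonglongrightarrow> \<Psi> w)"

definition finite_measurable_partition :: "'a measure \<Rightarrow> 'a set set \<Rightarrow> bool" where
  "finite_measurable_partition M P \<longleftrightarrow> finite P \<and> P \<subseteq> sets M \<and> partition_on (space M) P"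

text \<open>Since \<open>ln 0 = 0\<close>, null sets contribute 0.\<close>

definition partition_entropy :: "'a measure \<Rightarrow> 'a set set \<Rightarrow> real" where
  "partition_entropy M P = - (\<Sum>A\<in>P. measure M A * ln (measure M A))"

text \<open>The common refinement of the partitions \<open>T\<^sup>-\<^sup>i P\<close> for \<open>i < n\<close>.\<close>

definition iterated_join :: "'a measure \<Rightarrow> ('a \<Rightarrow> 'a) \<Rightarrow> 'a set set \<Rightarrow> nat \<Rightarrow> 'a set set" where
  "iterated_join M T P n =
     {{x \<in> space M. \<forall>i<n. (T ^^ i) x \<in> c i} | c. \<forall>i<n. c i \<in> P} - {{}}"

text \<open>
  The limit exists, by subadditivity, when \<open>T\<close> preserves \<open>M\<close>. This is the case for
  \<^const>\<open>dual_shift\<close> and every dual geometric Gibbs type measure of an element of some \<open>TUS d\<close>,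
  because the reciprocals of \<open>\<Psi>\<close> over the \<open>d\<close> preimages of a point sum to 1.
\<close>

definition partition_entropy_rate :: "'a measure \<Rightarrow> ('a \<Rightarrow> 'a) \<Rightarrow> 'a set set \<Rightarrow> real" where
  "partition_entropy_rate M T P =
     lim (\<lambda>n. partition_entropy M (iterated_join M T P n) / real n)"

definition metric_entropy :: "'a measure \<Rightarrow> ('a \<Rightarrow> 'a) \<Rightarrow> ereal" where
  "metric_entropy M T =
     (SUP P \<in> {P. finite_measurable_partition M P}. ereal (partition_entropy_rate M T P))"

definition gibbs_entropies :: "nat \<Rightarrow> ereal set" where
  "gibbs_entropies d =
     {metric_entropy \<mu> dual_shift | \<Psi> \<mu>. \<Psi> \<in> TUS d \<and> dual_gibbs d \<Psi> \<mu>}"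

end

theory Submission
  imports Defs "HOL-Real_Asymp.Real_Asymp"
begin

text \<open>
  A dual geometric Gibbs type measure is shift invariant: on the cylinder of length \<open>n\<close> around \<open>w\<close>,
  the quotient of the measure of its preimage by its measure tends to the sum of \<open>1 / \<Psi>\<close> over the
  preimages of \<open>w\<close>, which is 1, for every \<open>w\<close>; a finitely additive function whose quotient by a
  positive one tends to 1 at every point is equal to it. As the zeroth coordinate generates, the
  entropy is at most the entropy of the partition into the \<open>d\<close> cylinders of length 1, hence at
  most \<open>ln d\<close>.

  For examples, let \<open>G\<close> be a primitive of a positive \<open>d\<close>-periodic function \<open>\<psi>\<close> with
  \<open>\<psi> x + \<psi> (x + 1) + \<dots> + \<psi> (x + d - 1) = 1\<close>. It is the inverse lift of an expanding
  circle map that preserves Lebesgue measure, uniformly symmetric by bounded distortion, and the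
  lengths of the intervals \<open>I\<^sub>w\<close> are the cylinder weights of a Gibbs measure. Constant \<open>\<psi>\<close> gives
  the uniform measure, of entropy \<open>ln d\<close>. If \<open>\<psi>\<close> is concentrated on the interval from 0 to 1,
  then one cylinder of length 1 has measure close to 1, and the entropy is close to 0.
\<close>

section \<open>Shannon entropy of itineraries\<close>

text \<open>The Gibbs condition controls measures of cylinders only pointwise and in the limit, so
  invariance is hidden in it; yet the limit in the definition of an entropy rate comes from
  subadditivity, which rests on invariance. Hence invariance precedes every entropy bound. The
  normalisation behind it is geometric: the \<open>d\<close> intervals obtained by appending a
  letter to a word fill the interval of that word. For the examples the opposite end of the word
  counts. Sequences are infinite to the left, so a right cylinder splits according to a letter put
  in front of its word. Interval lengths are additive under that splitting when the map preserves
  Lebesgue measure, which is the origin of the condition on the sum of \<open>\<psi>\<close>.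
  Measures of cylinders are then lengths, and the quotients in the Gibbs condition are the ones in
  the dual derivative. The bound by the entropy of the zeroth coordinate also serves the infimum: it
  suffices that one cylinder of length 1 has almost full measure.\<close>

definition shannon :: "'a measure \<Rightarrow> ('a \<Rightarrow> 'b) \<Rightarrow> real" where
  "shannon M X =
     - (\<Sum>y\<in>X ` space M. measure M (X -` {y} \<inter> space M) * ln (measure M (X -` {y} \<inter> space M)))"

text \<open>The join of the pulled-back partitions becomes one list-valued random variable, so that
  entropies of joins can be handled as entropies of functions and of pairs.\<close>

definition itinerary :: "('a \<Rightarrow> 'a) \<Rightarrow> ('a \<Rightarrow> 'b) \<Rightarrow> nat \<Rightarrow> 'a \<Rightarrow> 'b list" where
  "itinerary T X n x = map (\<lambda>i. X ((T ^^ i) x)) [0..<n]"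

text \<open>As \<open>f\<close> may take the value 0, the one-sided limit of \<open>x * ln x\<close>
  is first turned into continuity within \<open>{0..}\<close>; the value at 0 is 0.\<close>

lemma tendsto_mult_ln_0:
  fixes f :: "'a \<Rightarrow> real"
  assumes "(f \<longlongrightarrow> 0) F" "\<And>x. 0 \<le> f x"
  shows "((\<lambda>x. f x * ln (f x)) \<longlongrightarrow> 0) F"
proof -
  have "((\<lambda>x::real. x * ln x) \<longlongrightarrow> 0) (at_right 0)"
    by real_asymp
  then have "continuous (at 0 within {0..}) (\<lambda>x::real. x * ln x)"
    by (simp add: continuous_within at_within_Ici_at_right)
  from continuous_within_tendsto_compose'[OF this _ assms(1)] show ?thesis
    using assms(2) by simp
qed

context prob_space
begin

lemma shannon_entropy:
  assumes "simple_function M X"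
  shows "shannon M X = entropy (exp 1) (count_space (X ` space M)) X"
proof -
  interpret information_space M "exp 1" by standard simp
  show ?thesis
    unfolding shannon_def entropy_simple_distributed[OF simple_distributedI[OF assms measure_nonneg refl]]
    by (simp add: log_def)
qed

lemma shannon_superset:
  assumes "finite V" "X ` space M \<subseteq> V"
  shows "shannon M X =
     - (\<Sum>y\<in>V. measure M (X -` {y} \<inter> space M) * ln (measure M (X -` {y} \<inter> space M)))"
proof -
  have "X -` {y} \<inter> space M = {}" if "y \<in> V - X ` space M" for y
    using that by auto
  then show ?thesis
    unfolding shannon_def using assms by (intro arg_cong[where f=uminus] sum.mono_neutral_left) auto
qed

lemma shannon_nonneg: "0 \<le> shannon M X"
proof -
  have "prob A * ln (prob A) \<le> 0" for A
    by (cases "prob A = 0")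
       (auto intro!: mult_nonneg_nonpos simp: zero_less_measure_iff measure_le_0_iff)
  then show ?thesis
    unfolding shannon_def by (auto intro!: sum_nonpos)
qed

lemma shannon_le_ln_card:
  assumes "simple_function M X"
  shows "shannon M X \<le> ln (card (X ` space M))"
proof -
  interpret information_space M "exp 1" by standard simp
  show ?thesis
    using entropy_le_card[OF simple_distributedI[OF assms measure_nonneg refl]]
    by (simp add: shannon_entropy[OF assms] log_def)
qed

lemma shannon_compose_le:
  assumes "simple_function M X"
  shows "shannon M (\<lambda>x. f (X x)) \<le> shannon M X"
proof -
  interpret information_space M "exp 1" by standard simp
  show ?thesis
    using entropy_data_processing[OF assms, of f] shannon_entropy[OF assms]
      shannon_entropy[OF simple_function_compose[OF assms, of f]]
    by (simp add: comp_def)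
qed

lemma shannon_pair_le:
  assumes "simple_function M X" "simple_function M Y"
  shows "shannon M (\<lambda>x. (X x, Y x)) \<le> shannon M X + shannon M Y"
proof -
  interpret information_space M "exp 1" by standard simp
  show ?thesis
    using entropy_chain_rule[OF assms] conditional_entropy_less_eq_entropy[OF assms(2,1)]
      shannon_entropy[OF simple_function_Pair[OF assms]] shannon_entropy[OF assms(1)]
      shannon_entropy[OF assms(2)]
    by simp
qed

lemma shannon_cong:
  assumes "\<And>x. x \<in> space M \<Longrightarrow> X x = Y x"
  shows "shannon M X = shannon M Y"
proof -
  have "X ` space M = Y ` space M" using assms by auto
  moreover have "X -` {y} \<inter> space M = Y -` {y} \<inter> space M" for y using assms by auto
  ultimately show ?thesis by (simp add: shannon_def)
qed

end

text \<open>Fekete's lemma. Division with remainder, \<open>n = q * k + r\<close>, bounds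
  \<open>a n\<close> by \<open>q * a k\<close> plus a remainder bounded in \<open>n\<close>, so
  every \<open>a k / k\<close> is an upper bound up to a vanishing error, and the limit is the
  infimum of these quotients.\<close>

lemma convergent_subadditive_nonneg:
  fixes a :: "nat \<Rightarrow> real"
  assumes sub: "\<And>m n. a (m + n) \<le> a m + a n" and nn: "\<And>n. 0 \<le> a n"
  shows "convergent (\<lambda>n. a n / n)"
proof -
  define S where "S = (\<lambda>n. a n / n) ` {1..}"
  define L where "L = Inf S"
  have bdd: "bdd_below S" unfolding S_def by (rule bdd_belowI[of _ 0]) (auto simp: nn)
  have lower: "L \<le> a n / n" if "n \<ge> 1" for n
    unfolding L_def using that by (intro cInf_lower bdd) (auto simp: S_def)
  have mult: "a (q * k + r) \<le> q * a k + a r" for q k r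
  proof (induction q)
    case (Suc q)
    have "a (Suc q * k + r) = a (k + (q * k + r))" by (simp add: algebra_simps)
    also have "\<dots> \<le> a k + a (q * k + r)" by (rule sub)
    finally show ?case using Suc by (simp add: algebra_simps)
  qed simp
  have "(\<lambda>n. a n / n) \<longlonglongrightarrow> L"
  proof (rule LIMSEQ_I)
    fix e :: real assume e: "0 < e"
    have "S \<noteq> {}" by (auto simp: S_def)
    then obtain s where "s \<in> S" "s < L + e / 2"
      using cInf_lessD[of S "L + e/2"] e by (auto simp: L_def)
    then obtain k :: nat where k: "k \<ge> 1" "a k / k < L + e / 2" by (auto simp: S_def)
    define C where "C = Max (a ` {..<k})"
    have C: "a r \<le> C" if "r < k" for r unfolding C_def using that by (intro Max_ge) auto
    obtain n0 :: nat where n0: "real n0 > 2 * C / e" using reals_Archimedean2 by blast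
    show "\<exists>no. \<forall>n\<ge>no. norm (a n / real n - L) < e"
    proof (intro exI[of _ "max 1 n0"] allI impI)
      fix n assume n: "n \<ge> max 1 n0"
      then have npos: "real n > 0" by simp
      have "a n \<le> (n div k) * a k + a (n mod k)"
        using mult[of "n div k" k "n mod k"] by simp
      also have "\<dots> \<le> (n div k) * a k + C" using C[of "n mod k"] k by simp
      also have "(n div k) * a k = (n div k * k) * (a k / k)" using k by simp
      also have "\<dots> \<le> n * (a k / k)"
        by (intro mult_right_mono) (auto simp: nn simp flip: of_nat_mult)
      finally have "a n / n \<le> a k / k + C / n" using npos by (simp add: field_simps)
      moreover have "C / n < e / 2"
      proof -
        have "2 * C / e < n" using n0 n by linarith
        then show ?thesis using npos e by (simp add: field_simps)
      qed
      moreover have "L \<le> a n / n" using lower n by simp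
      ultimately show "norm (a n / real n - L) < e" using k
        unfolding real_norm_def by linarith
    qed
  qed
  then show ?thesis by (rule convergentI)
qed

section \<open>Entropy of itineraries under a measure-preserving map\<close>

locale preserving = prob_space +
  fixes T :: "'a \<Rightarrow> 'a"
  assumes T [measurable]: "T \<in> M \<rightarrow>\<^sub>M M"
    and inv: "\<And>A. A \<in> sets M \<Longrightarrow> measure M (T -` A \<inter> space M) = measure M A"
begin

lemma measurable_iterate [measurable]: "T ^^ n \<in> M \<rightarrow>\<^sub>M M"
  by (rule measurable_compose_n[OF T])

lemma iterate_space: "x \<in> space M \<Longrightarrow> (T ^^ n) x \<in> space M"
  by (rule measurable_space[OF measurable_iterate])

lemma measure_iterate:
  assumes A: "A \<in> sets M"
  shows "measure M ((T ^^ n) -` A \<inter> space M) = measure M A"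
proof (induction n)
  case (Suc n)
  have "(T ^^ Suc n) -` A \<inter> space M = T -` ((T ^^ n) -` A \<inter> space M) \<inter> space M"
    using measurable_space[OF T] by (auto simp: funpow_swap1)
  then show ?case
    using inv[OF measurable_sets[OF measurable_iterate A], of n] Suc by metis
qed (use A sets.sets_into_space[OF A] in \<open>simp add: Int_absorb2\<close>)

lemma simple_function_iterate:
  assumes "simple_function M X"
  shows "simple_function M (\<lambda>x. X ((T ^^ n) x))"
proof -
  have "X \<in> M \<rightarrow>\<^sub>M count_space UNIV" and "finite (X ` space M)"
    using assms by (auto simp: simple_function_eq_measurable)
  then have "(\<lambda>x. X ((T ^^ n) x)) \<in> M \<rightarrow>\<^sub>M count_space UNIV" by measurable
  moreover have "finite ((\<lambda>x. X ((T ^^ n) x)) ` space M)"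
    by (rule finite_subset[OF _ \<open>finite (X ` space M)\<close>]) (auto simp: iterate_space)
  ultimately show ?thesis by (simp add: simple_function_eq_measurable)
qed

lemma shannon_iterate:
  assumes X: "simple_function M X"
  shows "shannon M (\<lambda>x. X ((T ^^ n) x)) = shannon M X"
proof -
  have "measure M ((\<lambda>x. X ((T ^^ n) x)) -` {y} \<inter> space M) = measure M (X -` {y} \<inter> space M)" for y
  proof -
    have "(\<lambda>x. X ((T ^^ n) x)) -` {y} \<inter> space M = (T ^^ n) -` (X -` {y} \<inter> space M) \<inter> space M"
      by (auto simp: iterate_space)
    then show ?thesis using measure_iterate[OF simple_functionD(2)[OF X, of "{y}"], of n] by metis
  qed
  moreover have "(\<lambda>x. X ((T ^^ n) x)) ` space M \<subseteq> X ` space M" by (auto simp: iterate_space)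
  ultimately show ?thesis
    using simple_functionD(1)[OF X]
    by (subst shannon_superset[of "X ` space M"]) (auto simp: shannon_def)
qed

lemma itinerary_add:
  "itinerary T X (m + n) x = itinerary T X m x @ itinerary T X n ((T ^^ m) x)"
proof -
  have "(T ^^ i) ((T ^^ m) x) = (T ^^ (i + m)) x" for i by (simp add: funpow_add)
  then show ?thesis by (intro nth_equalityI) (auto simp: itinerary_def nth_append)
qed

lemma simple_function_itinerary:
  assumes X: "simple_function M X"
  shows "simple_function M (itinerary T X n)"
proof (induction n)
  case 0
  then show ?case by (simp add: itinerary_def[abs_def])
next
  case (Suc n)
  have "itinerary T X (Suc n) = (\<lambda>(l, y). l @ [y]) \<circ> (\<lambda>x. (itinerary T X n x, X ((T ^^ n) x)))"
    by (auto simp: itinerary_def)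
  then show ?case
    using simple_function_compose[OF simple_function_Pair[OF Suc simple_function_iterate[OF X]]] by metis
qed

text \<open>Here invariance enters: the last \<open>n\<close> entries form the itinerary of
  \<open>(T ^^ m) x\<close>, which has the same distribution as the itinerary of \<open>x\<close>.
  The rest is subadditivity of the entropy of a pair.\<close>

lemma shannon_itinerary_add:
  assumes X: "simple_function M X"
  shows "shannon M (itinerary T X (m + n)) \<le> shannon M (itinerary T X m) + shannon M (itinerary T X n)"
proof -
  let ?P = "\<lambda>x. (itinerary T X m x, itinerary T X n ((T ^^ m) x))"
  note s = simple_function_itinerary[OF X]
  have P: "simple_function M ?P"
    by (intro simple_function_Pair s simple_function_iterate)
  have "shannon M (itinerary T X (m + n)) = shannon M (\<lambda>x. (\<lambda>(a, b). a @ b) (?P x))"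
    by (simp add: itinerary_add[abs_def])
  also have "\<dots> \<le> shannon M ?P" by (rule shannon_compose_le[OF P])
  also have "\<dots> \<le> shannon M (itinerary T X m) + shannon M (\<lambda>x. itinerary T X n ((T ^^ m) x))"
    by (intro shannon_pair_le s simple_function_iterate)
  finally show ?thesis by (simp add: shannon_iterate[OF s])
qed

lemma shannon_itinerary_le:
  assumes X: "simple_function M X"
  shows "shannon M (itinerary T X n) \<le> n * shannon M X"
proof (induction n)
  case 0
  then show ?case using shannon_le_ln_card[OF simple_function_itinerary[OF X, of 0]] not_empty
    by (auto simp: itinerary_def[abs_def] image_constant_conv)
next
  case (Suc n)
  have "shannon M (itinerary T X (Suc 0)) \<le> shannon M X"
    using shannon_compose_le[OF X, of "\<lambda>y. [y]"] by (simp add: itinerary_def[abs_def])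
  then show ?case using shannon_itinerary_add[OF X, of n 1] Suc by (simp add: algebra_simps)
qed

lemma convergent_itinerary:
  assumes "simple_function M X"
  shows "convergent (\<lambda>n. shannon M (itinerary T X n) / n)"
  by (intro convergent_subadditive_nonneg shannon_itinerary_add[OF assms] shannon_nonneg)

end

text \<open>For a partition this is the singleton of the block that contains \<open>x\<close>.
  Keeping it as a subset of \<open>P\<close> makes it total without choosing a block, with at most
  finitely many values when \<open>P\<close> is finite.\<close>

definition cell :: "'a set set \<Rightarrow> 'a \<Rightarrow> 'a set set" where
  "cell P x = {A \<in> P. x \<in> A}"

lemma cell_eq:
  assumes "partition_on S P" "x \<in> A" "A \<in> P"
  shows "cell P x = {A}"
proof -
  have "B = A" if "B \<in> P" "x \<in> B" for B
    using disjointD[of P B A] that assms by (auto simp: partition_on_def)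
  then show ?thesis using assms(2,3) unfolding cell_def by blast
qed

lemma simple_function_cell:
  assumes "finite_measurable_partition M P"
  shows "simple_function M (cell P)"
proof -
  have P: "finite P" "P \<subseteq> sets M" using assms by (auto simp: finite_measurable_partition_def)
  show ?thesis unfolding simple_function_def
  proof (intro conjI ballI)
    have "cell P ` space M \<subseteq> Pow P" by (auto simp: cell_def)
    then show "finite (cell P ` space M)" using P by (auto intro: finite_subset)
    fix Q
    have 1: "{x \<in> space M. x \<in> A} \<in> sets M" if "A \<in> P" for A
    proof -
      have "{x \<in> space M. x \<in> A} = A" using that P sets.sets_into_space[of A M] by auto
      then show ?thesis using that P by auto
    qed
    have 2: "{x \<in> space M. x \<in> A \<longleftrightarrow> A \<in> Q} \<in> sets M" if "A \<in> P" for A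
      using 1[OF that] sets.sets_Collect_neg[OF 1[OF that]] by (cases "A \<in> Q") auto
    have "{x \<in> space M. \<forall>A\<in>P. x \<in> A \<longleftrightarrow> A \<in> Q} \<in> sets M"
      using P(1) by (cases "P = {}") (auto intro!: sets.sets_Collect_finite_All' 2)
    moreover have "cell P -` {Q} \<inter> space M =
        (if Q \<subseteq> P then {x \<in> space M. \<forall>A\<in>P. x \<in> A \<longleftrightarrow> A \<in> Q} else {})"
    proof -
      have "cell P x = Q \<longleftrightarrow> Q \<subseteq> P \<and> (\<forall>A\<in>P. x \<in> A \<longleftrightarrow> A \<in> Q)" for x
        unfolding cell_def by blast
      then show ?thesis by auto
    qed
    ultimately show "cell P -` {Q} \<inter> space M \<in> sets M" by simp
  qed
qed

text \<open>The nonempty members of the join are the fibres of the itinerary over its range, and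
  distinct values have distinct fibres, so the two sums agree term by term.\<close>

lemma partition_entropy_iterated_join:
  assumes P: "partition_on (space M) P" and T: "T \<in> space M \<rightarrow> space M"
  shows "partition_entropy M (iterated_join M T P n) = shannon M (itinerary T (cell P) n)"
proof -
  let ?X = "itinerary T (cell P) n"
  let ?g = "\<lambda>y. ?X -` {y} \<inter> space M"
  have sp: "(T ^^ i) x \<in> space M" if "x \<in> space M" for i x
    using that T by (induction i) auto
  have cellD: "\<exists>A\<in>P. x \<in> A \<and> cell P x = {A}" if "x \<in> space M" for x
  proof -
    have "x \<in> \<Union>P" using that P by (simp add: partition_on_def)
    then obtain A where "A \<in> P" "x \<in> A" by blast
    then show ?thesis using cell_eq[OF P] by blast
  qed
  have "iterated_join M T P n = ?g ` ?X ` space M"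
  proof (intro equalityI subsetI)
    fix B assume "B \<in> iterated_join M T P n"
    then obtain c x where c: "\<And>i. i < n \<Longrightarrow> c i \<in> P" and B: "B = {x \<in> space M. \<forall>i<n. (T ^^ i) x \<in> c i}"
      and x: "x \<in> B" by (auto simp: iterated_join_def)
    have "y \<in> ?g (?X x)" if "y \<in> B" for y
    proof -
      have "cell P ((T ^^ i) y) = cell P ((T ^^ i) x)" if "i < n" for i
        using \<open>y \<in> B\<close> x c[OF that] that cell_eq[OF P _ c[OF that]] by (simp add: B)
      then show ?thesis using \<open>y \<in> B\<close> by (simp add: B itinerary_def)
    qed
    moreover have "y \<in> B" if "y \<in> ?g (?X x)" for y
    proof -
      have "(T ^^ i) y \<in> c i" if "i < n" for i
      proof -
        have "cell P ((T ^^ i) y) = cell P ((T ^^ i) x)"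
          using \<open>y \<in> ?g (?X x)\<close> that by (auto simp: itinerary_def)
        also have "\<dots> = {c i}" using x c that by (auto simp: B intro!: cell_eq[OF P])
        finally show ?thesis by (auto simp: cell_def)
      qed
      then show ?thesis using that by (auto simp: B)
    qed
    ultimately have "B = ?g (?X x)" by blast
    then show "B \<in> ?g ` ?X ` space M" using x by (auto simp: B)
  next
    fix B assume "B \<in> ?g ` ?X ` space M"
    then obtain x where x: "x \<in> space M" "B = ?g (?X x)" by auto
    have "\<forall>i. \<exists>A\<in>P. (T ^^ i) x \<in> A \<and> cell P ((T ^^ i) x) = {A}"
      using cellD[OF sp[OF x(1)]] by blast
    then obtain c where c: "\<And>i. c i \<in> P" "\<And>i. cell P ((T ^^ i) x) = {c i}" by metis
    have "cell P ((T ^^ i) y) = {c i} \<longleftrightarrow> (T ^^ i) y \<in> c i" if "y \<in> space M" for i y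
      using cell_eq[OF P _ c(1)] by (auto simp: cell_def)
    then have "B = {x \<in> space M. \<forall>i<n. (T ^^ i) x \<in> c i}"
      using x by (auto simp: itinerary_def c)
    moreover have "B \<noteq> {}" using x by auto
    ultimately show "B \<in> iterated_join M T P n" using c by (auto simp: iterated_join_def)
  qed
  moreover have "inj_on ?g (?X ` space M)" by (auto simp: inj_on_def)
  ultimately show ?thesis
    unfolding partition_entropy_def shannon_def by (simp add: sum.reindex)
qed

section \<open>Entropy of shift-invariant measures\<close>

lemma sets_borel_sequences:
  "sets (borel :: (nat \<Rightarrow> nat) measure) = sigma_sets UNIV {{w. w i \<in> A} | i A. True}"
proof -
  have "sets (borel :: (nat \<Rightarrow> nat) measure) = sets (PiM UNIV (\<lambda>_. borel :: nat measure))"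
    by (rule sets_PiM_equal_borel[symmetric])
  then show ?thesis
    by (simp add: sets_PiM_single sets_borel_eq_count_space)
qed

text \<open>This is \<open>right_word\<close> read backwards. It is the order in which the shift
  reveals the letters, and a longer prefix extends a shorter one at its end, so \<open>take\<close>
  shortens it.\<close>

definition prefix :: "nat \<Rightarrow> (nat \<Rightarrow> nat) \<Rightarrow> nat list" where
  "prefix k w = map w [0..<k]"

lemma take_prefix: "j \<le> k \<Longrightarrow> take j (prefix k w) = prefix j w"
  by (simp add: prefix_def take_map)

lemma nth_prefix [simp]: "i < k \<Longrightarrow> prefix k w ! i = w i"
  by (simp add: prefix_def)

lemma length_prefix [simp]: "length (prefix k w) = k"
  by (simp add: prefix_def)

lemma prefix_eq_iff: "prefix k u = prefix k w \<longleftrightarrow> (\<forall>i<k. u i = w i)"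
  by (auto simp: prefix_def)

locale seq_measure = prob_space M for M :: "(nat \<Rightarrow> nat) measure" and d :: nat +
  assumes sets_M: "sets M = sets (restrict_space borel (dual_space d))"
begin

lemma space_M: "space M = dual_space d"
  using sets_eq_imp_space_eq[OF sets_M] by (simp add: space_restrict_space)

lemma coordinate_sets:
  assumes "A \<in> sets borel"
  shows "A \<inter> space M \<in> sets M"
  using assms by (auto simp: sets_M space_M sets_restrict_space)

lemma measurable_prefix [measurable]: "prefix k \<in> M \<rightarrow>\<^sub>M count_space UNIV"
proof -
  have [measurable]: "(\<lambda>w. w i) \<in> M \<rightarrow>\<^sub>M count_space UNIV" for i
  proof (rule measurableI)
    fix A :: "nat set"
    have "{w. w i \<in> A} \<in> sets borel"
      unfolding sets_borel_sequences by (rule sigma_sets.Basic) auto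
    moreover have "(\<lambda>w. w i) -` A \<inter> space M = {w. w i \<in> A} \<inter> space M" by auto
    ultimately show "(\<lambda>w. w i) -` A \<inter> space M \<in> sets M" using coordinate_sets by simp
  qed simp
  show ?thesis
  proof (rule measurable_count_space_eq2_countable[THEN iffD2], intro conjI ballI)
    fix l :: "nat list"
    have "prefix k -` {l} \<inter> space M = {w \<in> space M. length l = k \<and> (\<forall>i<k. w i = l ! i)}"
      by (auto simp: prefix_def intro!: nth_equalityI)
    also have "\<dots> \<in> sets M" by measurable
    finally show "prefix k -` {l} \<inter> space M \<in> sets M" .
  qed auto
qed

lemma simple_function_prefix: "simple_function M (prefix k)"
proof -
  have "prefix k ` space M \<subseteq> {l. set l \<subseteq> {..<d} \<and> length l = k}"
    by (auto simp: space_M dual_space_def prefix_def)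
  moreover have "finite {l. set l \<subseteq> {..<d} \<and> length l = k}"
    by (rule finite_lists_length_eq) simp
  ultimately have "finite (prefix k ` space M)" by (rule finite_subset)
  then show ?thesis by (simp add: simple_function_eq_measurable)
qed

text \<open>The sets that can be approximated in measure by finite-prefix sets form a sigma-algebra:
  a complement keeps the error, and a countable union is cut to finitely many members, half of the
  error going to the cut and half to the members.\<close>

lemma ex_prefix_approx:
  assumes "A \<in> sets M" "0 < e"
  shows "\<exists>k S. measure M {w \<in> space M. (w \<in> A) \<noteq> (prefix k w \<in> S)} < e"
proof -
  have sb: "{w \<in> space M. w \<in> B} \<in> sets M" if "B \<in> sets borel" for B
    using coordinate_sets[OF that] by (simp add: Int_def conj_commute)
  have "\<exists>k S. measure M {w \<in> space M. (w \<in> B) \<noteq> (prefix k w \<in> S)} < e"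
    if "B \<in> sigma_sets UNIV {{w. w i \<in> A} | i A. True}" "0 < e" for B e
    using that
  proof (induction arbitrary: e rule: sigma_sets.induct)
    case (Basic a)
    then obtain i A where a: "a = {w. w i \<in> A}" by auto
    have "{w \<in> space M. (w \<in> a) \<noteq> (prefix (Suc i) w \<in> {l. l ! i \<in> A})} = {}"
      by (auto simp: a)
    then have "measure M {w \<in> space M. (w \<in> a) \<noteq> (prefix (Suc i) w \<in> {l. l ! i \<in> A})} < e"
      using Basic.prems by (simp only: measure_empty)
    then show ?case by (intro exI)
  next
    case Empty
    have "{w \<in> space M. (w \<in> {}) \<noteq> (prefix 0 w \<in> {})} = {}" by simp
    then have "measure M {w \<in> space M. (w \<in> {}) \<noteq> (prefix 0 w \<in> {})} < e"
      using Empty.prems by (simp only: measure_empty)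
    then show ?case by (intro exI)
  next
    case (Compl a)
    obtain k S where "measure M {w \<in> space M. (w \<in> a) \<noteq> (prefix k w \<in> S)} < e"
      using Compl.IH[OF Compl.prems] by blast
    moreover have "{w \<in> space M. (w \<in> a) \<noteq> (prefix k w \<in> S)} =
        {w \<in> space M. (w \<in> UNIV - a) \<noteq> (prefix k w \<in> - S)}" by auto
    ultimately have "measure M {w \<in> space M. (w \<in> UNIV - a) \<noteq> (prefix k w \<in> - S)} < e" by simp
    then show ?case by (intro exI)
  next
    case (Union a)
    have a: "a i \<in> sets borel" for i using Union.hyps by (simp add: sets_borel_sequences)
    note [measurable] = sb[OF a]
    define U where "U n = {w \<in> space M. w \<in> (\<Union>i<n. a i)}" for n
    have [measurable]: "U n \<in> sets M" for n unfolding U_def by measurable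
    have Un: "(\<Union>n. U n) = {w \<in> space M. w \<in> (\<Union>i. a i)}" unfolding U_def by blast
    have "(\<lambda>n. measure M (U n)) \<longlonglongrightarrow> measure M (\<Union>n. U n)"
      by (rule finite_Lim_measure_incseq) (auto simp: U_def incseq_def)
    then obtain n where "\<bar>measure M (U n) - measure M (\<Union>n. U n)\<bar> < e / 2"
      using Union.prems by (metis LIMSEQ_D half_gt_zero order_refl real_norm_def)
    then have n: "measure M ((\<Union>n. U n) - U n) < e / 2"
      by (subst finite_measure_Diff) (auto simp: abs_if split: if_splits)
    \<comment> \<open>The \<open>n\<close> errors then add up to at most \<open>e / 2\<close>;
      \<open>Suc n\<close> keeps the bound meaningful for \<open>n = 0\<close>.\<close>
    have "\<forall>i. \<exists>k S. measure M {w \<in> space M. (w \<in> a i) \<noteq> (prefix k w \<in> S)} < e / (2 * Suc n)"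
      using Union.prems by (intro allI Union.IH) simp
    from choice[OF this] obtain k where
      "\<forall>i. \<exists>S. measure M {w \<in> space M. (w \<in> a i) \<noteq> (prefix (k i) w \<in> S)} < e / (2 * Suc n)" ..
    from choice[OF this] obtain S where kS:
      "\<forall>i. measure M {w \<in> space M. (w \<in> a i) \<noteq> (prefix (k i) w \<in> S i)} < e / (2 * Suc n)" ..
    define E where "E i = {w \<in> space M. (w \<in> a i) \<noteq> (prefix (k i) w \<in> S i)}" for i
    have [measurable]: "E i \<in> sets M" for i unfolding E_def by measurable
    define K where "K = Max (k ` {..<n})"
    have K: "k i \<le> K" if "i < n" for i unfolding K_def using that by (intro Max_ge) auto
    define R where "R = {l. \<exists>i<n. take (k i) l \<in> S i}"
    have R: "prefix K w \<in> R \<longleftrightarrow> (\<exists>i<n. prefix (k i) w \<in> S i)" for w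
      using take_prefix[OF K] by (auto simp: R_def)
    have "measure M {w \<in> space M. (w \<in> (\<Union>i. a i)) \<noteq> (prefix K w \<in> R)}
        \<le> measure M (((\<Union>n. U n) - U n) \<union> (\<Union>i<n. E i))"
      unfolding R by (rule finite_measure_mono) (auto simp: U_def E_def)
    also have "\<dots> \<le> measure M ((\<Union>n. U n) - U n) + measure M (\<Union>i<n. E i)"
      by (rule measure_Un_le) auto
    also have "measure M (\<Union>i<n. E i) \<le> (\<Sum>i<n. measure M (E i))"
      by (rule measure_UNION_le) auto
    also have "\<dots> \<le> (\<Sum>i<n. e / (2 * Suc n))"
      using kS by (intro sum_mono) (auto simp: E_def less_imp_le)
    also have "\<dots> \<le> e / 2"
      using Union.prems by (simp add: field_simps)
    finally have "measure M {w \<in> space M. (w \<in> (\<Union>i. a i)) \<noteq> (prefix K w \<in> R)} < e"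
      using n by simp
    then show ?case by (intro exI)
  qed
  moreover obtain B where "B \<in> sets borel" "A = B \<inter> space M"
    using assms by (auto simp: sets_M space_M sets_restrict_space)
  ultimately have "\<exists>k S. measure M {w \<in> space M. (w \<in> B) \<noteq> (prefix k w \<in> S)} < e"
    using assms(2) by (simp add: sets_borel_sequences)
  then obtain k S where "measure M {w \<in> space M. (w \<in> B) \<noteq> (prefix k w \<in> S)} < e" by (elim exE)
  moreover have "{w \<in> space M. (w \<in> B) \<noteq> (prefix k w \<in> S)} = {w \<in> space M. (w \<in> A) \<noteq> (prefix k w \<in> S)}"
    using \<open>A = B \<inter> space M\<close> by auto
  ultimately have "measure M {w \<in> space M. (w \<in> A) \<noteq> (prefix k w \<in> S)} < e" by simp
  then show ?thesis by (intro exI)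
qed

end

text \<open>Every other probability is squeezed by \<open>1 - p v n\<close>. This serves for the
  error variable of an approximated partition and again for the zeroth digit of a concentrated
  measure.\<close>

lemma tendsto_entropy_concentrated:
  fixes p :: "'a \<Rightarrow> nat \<Rightarrow> real"
  assumes "finite V" "v \<in> V" and p: "\<And>n. (\<Sum>x\<in>V. p x n) = 1" "\<And>x n. 0 \<le> p x n"
    and lim: "p v \<longlonglongrightarrow> 1"
  shows "(\<lambda>n. - (\<Sum>x\<in>V. p x n * ln (p x n))) \<longlonglongrightarrow> 0"
proof -
  have "(\<lambda>n. p x n * ln (p x n)) \<longlonglongrightarrow> 0" if "x \<in> V" for x
  proof (cases "x = v")
    case True
    have "(\<lambda>n. p v n * ln (p v n)) \<longlonglongrightarrow> 1 * ln 1"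
      by (intro tendsto_mult tendsto_ln lim) simp
    then show ?thesis by (simp add: True)
  next
    case False
    have "p x n \<le> 1 - p v n" for n
    proof -
      have "(\<Sum>y\<in>{x, v}. p y n) \<le> (\<Sum>y\<in>V. p y n)"
        using assms that by (intro sum_mono2) auto
      then show ?thesis using False p by simp
    qed
    moreover have "(\<lambda>n. 1 - p v n) \<longlonglongrightarrow> 0" using tendsto_diff[OF tendsto_const lim, of 1] by simp
    ultimately have "p x \<longlonglongrightarrow> 0"
      by (intro tendsto_sandwich[of "\<lambda>_. 0" "p x" _ "\<lambda>n. 1 - p v n"]) (auto simp: p)
    then show ?thesis by (rule tendsto_mult_ln_0) (rule p)
  qed
  then have "(\<lambda>n. - (\<Sum>x\<in>V. p x n * ln (p x n))) \<longlonglongrightarrow> - (\<Sum>x\<in>V. 0)"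
    by (intro tendsto_minus tendsto_sum) auto
  then show ?thesis by simp
qed

section \<open>The zeroth coordinate as a generator\<close>

lemma dual_shift_funpow: "(dual_shift ^^ i) w k = w (i + k)"
  by (induction i arbitrary: k) (auto simp: dual_shift_def)

lemma itinerary_coordinate: "itinerary dual_shift (\<lambda>w. w 0) n = prefix n"
  by (auto simp: itinerary_def prefix_def dual_shift_funpow)

locale shift_preserving = seq_measure M d + preserving M dual_shift
  for M :: "(nat \<Rightarrow> nat) measure" and d :: nat
begin

abbreviation "coordinate_entropy \<equiv> shannon M (\<lambda>w. w 0)"

lemma simple_function_coordinate: "simple_function M (\<lambda>w. w 0)"
proof -
  have "(\<lambda>w. w 0) = (\<lambda>l. l ! 0) \<circ> prefix 1" by (auto simp: prefix_def)
  then show ?thesis using simple_function_compose[OF simple_function_prefix] by metis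
qed

text \<open>
  Cylinder sets \<open>S A\<close> approximating the cells \<open>A\<close> of the partition determine the cell except on
  a small set; \<open>E\<close> records the cell there, hence has small entropy.
\<close>

lemma partition_entropy_rate_le:
  assumes P: "finite_measurable_partition M P"
  shows "partition_entropy_rate M dual_shift P \<le> coordinate_entropy"
proof -
  have fin: "finite P" and PM: "P \<subseteq> sets M" and part: "partition_on (space M) P"
    using P by (auto simp: finite_measurable_partition_def)
  note cell = simple_function_cell[OF P]
  let ?h = "\<lambda>n. shannon M (itinerary dual_shift (cell P) n)"
  have rate: "partition_entropy_rate M dual_shift P = lim (\<lambda>n. ?h n / n)"
    unfolding partition_entropy_rate_def
    using measurable_space[OF T] by (subst partition_entropy_iterated_join[OF part]) auto
  have lim: "(\<lambda>n. ?h n / n) \<longlonglongrightarrow> lim (\<lambda>n. ?h n / n)"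
    using convergent_itinerary[OF cell] by (simp add: convergent_LIMSEQ_iff)
  have "\<forall>m. \<exists>k S. \<forall>A\<in>P. measure M {w \<in> space M. (w \<in> A) \<noteq> (prefix k w \<in> S A)} < inverse (Suc m)"
  proof
    fix m
    have "\<forall>A\<in>P. \<exists>k S. measure M {w \<in> space M. (w \<in> A) \<noteq> (prefix k w \<in> S)} < inverse (Suc m)"
      using PM by (intro ballI ex_prefix_approx) auto
    from bchoice[OF this] obtain k where
      "\<forall>A\<in>P. \<exists>S. measure M {w \<in> space M. (w \<in> A) \<noteq> (prefix (k A) w \<in> S)} < inverse (Suc m)" ..
    from bchoice[OF this] obtain S where kS:
      "\<forall>A\<in>P. measure M {w \<in> space M. (w \<in> A) \<noteq> (prefix (k A) w \<in> S A)} < inverse (Suc m)" ..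
    define K where "K = Max (k ` P)"
    have "k A \<le> K" if "A \<in> P" for A unfolding K_def using that fin by (intro Max_ge) auto
    then have "prefix K w \<in> {l. take (k A) l \<in> S A} \<longleftrightarrow> prefix (k A) w \<in> S A" if "A \<in> P" for A w
      using that by (simp add: take_prefix)
    then show "\<exists>k S. \<forall>A\<in>P. measure M {w \<in> space M. (w \<in> A) \<noteq> (prefix k w \<in> S A)} < inverse (Suc m)"
      using kS
      by (intro exI[of _ K] exI[of _ "\<lambda>A. {l. take (k A) l \<in> S A}"]) simp
  qed
  from choice[OF this] obtain k where "\<forall>m. \<exists>S. \<forall>A\<in>P.
      measure M {w \<in> space M. (w \<in> A) \<noteq> (prefix (k m) w \<in> S A)} < inverse (Suc m)" ..
  from choice[OF this] obtain S where kS: "\<forall>m. \<forall>A\<in>P.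
      measure M {w \<in> space M. (w \<in> A) \<noteq> (prefix (k m) w \<in> S m A)} < inverse (Suc m)" ..
  \<comment> \<open>The cell as guessed from the digits \<open>l\<close>. The approximating sets may
    overlap or leave gaps, so it need not be a singleton, but it is the true cell as soon as
    membership in every block is judged correctly.\<close>
  define B where "B m l = {A \<in> P. l \<in> S m A}" for m l
  define E where "E m w = (if B m (prefix (k m) w) = cell P w then None else Some (cell P w))" for m w
  have simple_E: "simple_function M (E m)" for m
  proof -
    have "E m = (\<lambda>(l, c). if B m l = c then None else Some c) \<circ> (\<lambda>w. (prefix (k m) w, cell P w))"
      by (auto simp: E_def)
    then show ?thesis
      by (simp only: simple_function_compose[OF simple_function_Pair[OF simple_function_prefix cell]])
  qed
  have le: "lim (\<lambda>n. ?h n / n) \<le> coordinate_entropy + shannon M (E m)" for m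
  proof (rule LIMSEQ_le[OF lim])
    let ?c = "real (k m) * coordinate_entropy"
    have "(\<lambda>n. ?c / real n) \<longlonglongrightarrow> 0" by (rule lim_const_over_n)
    from tendsto_add[OF tendsto_const this, of "coordinate_entropy + shannon M (E m)"]
    show "(\<lambda>n. coordinate_entropy + shannon M (E m) + ?c / real n) \<longlonglongrightarrow> coordinate_entropy + shannon M (E m)"
      by simp
    have "?h n \<le> (n + k m) * coordinate_entropy + n * shannon M (E m)" for n
    proof -
      let ?Y = "\<lambda>w. (prefix (n + k m) w, itinerary dual_shift (E m) n w)"
      \<comment> \<open>Rebuilds the itinerary from digits and error record: at time
        \<open>i\<close> the digits from \<open>i\<close> to \<open>i + k m - 1\<close> give the
        guess, and a recorded cell replaces it where it is wrong. Times below \<open>n\<close> thus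
        use at most \<open>n + k m\<close> digits.\<close>
      define f where "f = (\<lambda>(l, es :: (nat \<Rightarrow> nat) set set option list). map (\<lambda>i. case es ! i of None \<Rightarrow> B m (take (k m) (drop i l)) | Some c \<Rightarrow> c) [0..<n])"
      note sY = simple_function_Pair[OF simple_function_prefix simple_function_itinerary[OF simple_E]]
      have "itinerary dual_shift (cell P) n w = f (?Y w)" for w
      proof -
        have "take (k m) (drop i (prefix (n + k m) w)) = prefix (k m) ((dual_shift ^^ i) w)" if "i < n" for i
          using that by (auto simp: dual_shift_funpow intro!: nth_equalityI)
        then show ?thesis by (auto simp: f_def itinerary_def E_def)
      qed
      then have "?h n = shannon M (\<lambda>w. f (?Y w))" by (intro shannon_cong)
      also have "\<dots> \<le> shannon M ?Y" by (rule shannon_compose_le[OF sY])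
      also have "\<dots> \<le> shannon M (prefix (n + k m)) + shannon M (itinerary dual_shift (E m) n)"
        by (intro shannon_pair_le simple_function_prefix simple_function_itinerary simple_E)
      also have "shannon M (prefix (n + k m)) \<le> (n + k m) * coordinate_entropy"
        using shannon_itinerary_le[OF simple_function_coordinate, of "n + k m"]
        by (simp add: itinerary_coordinate)
      also have "shannon M (itinerary dual_shift (E m) n) \<le> n * shannon M (E m)"
        by (rule shannon_itinerary_le[OF simple_E])
      finally show ?thesis by simp
    qed
    then have "?h n / n \<le> coordinate_entropy + shannon M (E m) + ?c / real n" if "n > 0" for n
      using that by (simp add: field_simps)
    then show "\<exists>N. \<forall>n\<ge>N. ?h n / n \<le> coordinate_entropy + shannon M (E m) + ?c / real n"
      by (intro exI[of _ 1]) auto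
  qed
  have "(\<lambda>m. shannon M (E m)) \<longlonglongrightarrow> 0"
  proof -
    \<comment> \<open>One finite set of values that serves all \<open>m\<close>, since the range of
      \<open>E m\<close> varies with \<open>m\<close>.\<close>
    define V where "V = insert None (Some ` cell P ` space M)"
    have V: "finite V" "E m ` space M \<subseteq> V" for m
      using simple_functionD(1)[OF cell] by (auto simp: V_def E_def)
    define p where "p x m = measure M (E m -` {x} \<inter> space M)" for x m
    have "(\<lambda>m. - (\<Sum>x\<in>V. p x m * ln (p x m))) \<longlonglongrightarrow> 0"
    proof (rule tendsto_entropy_concentrated)
      show "finite V" "None \<in> V" using V by (auto simp: V_def)
      show "0 \<le> p x m" for x m by (simp add: p_def)
      show "(\<Sum>x\<in>V. p x m) = 1" for m
      proof -
        have "(\<Sum>x\<in>V. p x m) = measure M (\<Union>x\<in>V. E m -` {x} \<inter> space M)"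
          unfolding p_def using V simple_functionD(2)[OF simple_E]
          by (intro finite_measure_finite_Union[symmetric]) (auto simp: disjoint_family_on_def)
        also have "(\<Union>x\<in>V. E m -` {x} \<inter> space M) = space M" using V(2)[of m] by auto
        finally show ?thesis by (simp add: prob_space)
      qed
      have lower: "1 - card P * inverse (Suc m) \<le> p None m" for m
      proof -
        let ?D = "\<lambda>A. {w \<in> space M. (w \<in> A) \<noteq> (prefix (k m) w \<in> S m A)}"
        have D: "?D A \<in> sets M" if "A \<in> P" for A
        proof -
          have A: "A \<in> sets M" using that PM by auto
          have "?D A = (A \<union> (prefix (k m) -` S m A \<inter> space M)) - (A \<inter> (prefix (k m) -` S m A \<inter> space M))"
            using sets.sets_into_space[OF A] by auto
          then show ?thesis using A measurable_sets[OF measurable_prefix, of "S m A"] by simp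
        qed
        have None: "E m -` {None} \<inter> space M \<in> sets M" by (rule simple_functionD(2)[OF simple_E])
        \<comment> \<open>A wrong guess of the cell means wrong membership in at least one
          block.\<close>
        have "space M - (E m -` {None} \<inter> space M) \<subseteq> (\<Union>A\<in>P. ?D A)"
          by (auto simp: E_def B_def cell_def split: if_splits)
        then have "measure M (space M - (E m -` {None} \<inter> space M)) \<le> measure M (\<Union>A\<in>P. ?D A)"
          using D fin by (intro finite_measure_mono sets.finite_UN) auto
        also have "\<dots> \<le> (\<Sum>A\<in>P. measure M (?D A))" using D fin by (intro measure_UNION_le) auto
        also have "\<dots> \<le> (\<Sum>A\<in>P. inverse (Suc m))" using kS by (intro sum_mono less_imp_le) auto
        finally show ?thesis using prob_compl[OF None] by (simp add: p_def)
      qed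
      have "(\<lambda>m. 1 - card P * inverse (real (Suc m))) \<longlonglongrightarrow> 1 - real (card P) * 0"
        by (intro tendsto_intros LIMSEQ_inverse_real_of_nat)
      then show "p None \<longlonglongrightarrow> 1"
        using lower by (intro tendsto_sandwich[of _ "p None" _ "\<lambda>_. 1"]) (auto simp: p_def)
    qed
    moreover have "shannon M (E m) = - (\<Sum>x\<in>V. p x m * ln (p x m))" for m
      unfolding p_def by (rule shannon_superset[OF V])
    ultimately show ?thesis by simp
  qed
  then have "(\<lambda>m. coordinate_entropy + shannon M (E m)) \<longlonglongrightarrow> coordinate_entropy + 0"
    by (intro tendsto_intros)
  then show ?thesis unfolding rate using le by (intro LIMSEQ_le_const) auto
qed

lemma metric_entropy_le: "metric_entropy M dual_shift \<le> ereal coordinate_entropy"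
  unfolding metric_entropy_def by (rule SUP_least) (use partition_entropy_rate_le in simp)

lemma coordinate_entropy_le: "coordinate_entropy \<le> ln d"
proof -
  have *: "(\<lambda>w. w 0) ` space M \<subseteq> {..<d}" by (auto simp: space_M dual_space_def)
  have "0 < card ((\<lambda>w. w 0) ` space M)"
    using not_empty simple_functionD(1)[OF simple_function_coordinate] by (simp add: card_gt_0_iff)
  moreover have "card ((\<lambda>w. w 0) ` space M) \<le> d" using card_mono[OF _ *] by simp
  ultimately have "ln (card ((\<lambda>w. w 0) ` space M)) \<le> ln d" by simp
  then show ?thesis using shannon_le_ln_card[OF simple_function_coordinate] by linarith
qed

lemma partition_entropy_rate_cells:
  assumes "finite_measurable_partition M P"
  shows "ereal (lim (\<lambda>n. shannon M (itinerary dual_shift (cell P) n) / n)) \<le> metric_entropy M dual_shift"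
proof -
  have "partition_entropy_rate M dual_shift P = lim (\<lambda>n. shannon M (itinerary dual_shift (cell P) n) / n)"
    unfolding partition_entropy_rate_def using assms measurable_space[OF T]
    by (subst partition_entropy_iterated_join) (auto simp: finite_measurable_partition_def)
  then show ?thesis
    unfolding metric_entropy_def using assms by (metis SUP_upper mem_Collect_eq)
qed

text \<open>The trivial partition is admissible, and its rate is a limit of nonnegative
  numbers.\<close>

lemma metric_entropy_nonneg: "0 \<le> metric_entropy M dual_shift"
proof -
  have P: "finite_measurable_partition M {space M}"
    using not_empty by (auto simp: finite_measurable_partition_def partition_on_def)
  have "0 \<le> lim (\<lambda>n. shannon M (itinerary dual_shift (cell {space M}) n) / n)"
    using convergent_itinerary[OF simple_function_cell[OF P]]
    by (intro LIMSEQ_le_const[OF convergent_LIMSEQ_iff[THEN iffD1]])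
       (auto simp: shannon_nonneg intro!: exI[of _ 0])
  then show ?thesis using partition_entropy_rate_cells[OF P] by (metis ereal_less_eq(5) order_trans)
qed

text \<open>For the partition into the cylinders of length 1, each fibre of an itinerary of length
  \<open>n\<close> is a cylinder of measure \<open>1 / d ^ n\<close>, so the entropy of the join is
  exactly \<open>n * ln d\<close>.\<close>

lemma metric_entropy_ge_uniform:
  assumes d: "0 < d" and uniform: "\<And>w n. w \<in> space M \<Longrightarrow> measure M (prefix n -` {prefix n w} \<inter> space M) = 1 / d ^ n"
  shows "ereal (ln d) \<le> metric_entropy M dual_shift"
proof -
  let ?A = "\<lambda>j. {w \<in> space M. w 0 = j}"
  define P where "P = ?A ` {..<d}"
  have A: "?A j \<in> sets M" for j
    using simple_functionD(2)[OF simple_function_coordinate, of "{j}"]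
    by (simp add: vimage_def Int_def conj_commute)
  have ne: "?A j \<noteq> {}" if "j < d" for j
    using that d by (auto simp: space_M dual_space_def intro!: exI[of _ "\<lambda>_. j"])
  have P: "finite_measurable_partition M P"
    unfolding finite_measurable_partition_def P_def partition_on_def
    using A ne by (auto simp: disjoint_def space_M dual_space_def)
  have cell: "cell P w = {?A (w 0)}" if "w \<in> space M" for w
    using that P by (intro cell_eq) (auto simp: finite_measurable_partition_def P_def space_M dual_space_def)
  have inj: "inj_on ?A {..<d}"
  proof (rule inj_onI)
    fix i j assume *: "i \<in> {..<d}" "j \<in> {..<d}" "?A i = ?A j"
    then obtain w where "w \<in> ?A i" using ne by blast
    then show "i = j" using * by auto
  qed
  have "shannon M (itinerary dual_shift (cell P) n) = n * ln d" for n
  proof -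
    let ?f = "itinerary dual_shift (cell P) n"
    have eq: "?f u = ?f w \<longleftrightarrow> prefix n u = prefix n w" if "u \<in> space M" "w \<in> space M" for u w
    proof -
      have "cell P ((dual_shift ^^ i) u) = cell P ((dual_shift ^^ i) w) \<longleftrightarrow> u i = w i" for i
        using that inj by (auto simp: cell iterate_space dual_shift_funpow inj_on_eq_iff space_M dual_space_def)
      then show ?thesis by (auto simp: itinerary_def prefix_eq_iff)
    qed
    have m: "measure M (?f -` {y} \<inter> space M) = 1 / d ^ n" if "y \<in> ?f ` space M" for y
    proof -
      obtain w where w: "w \<in> space M" "y = ?f w" using \<open>y \<in> ?f ` space M\<close> by auto
      have "?f -` {y} \<inter> space M = prefix n -` {prefix n w} \<inter> space M"
        using eq[OF _ w(1)] w(2) by auto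
      then show ?thesis using uniform[OF w(1)] by simp
    qed
    note sf = simple_function_itinerary[OF simple_function_cell[OF P], of n]
    have "(\<Sum>y\<in>?f ` space M. measure M (?f -` {y} \<inter> space M)) = measure M (\<Union>y\<in>?f ` space M. ?f -` {y} \<inter> space M)"
      using simple_functionD[OF sf]
      by (intro finite_measure_finite_Union[symmetric]) (auto simp: disjoint_family_on_def)
    also have "(\<Union>y\<in>?f ` space M. ?f -` {y} \<inter> space M) = space M" by auto
    finally have one: "(\<Sum>y\<in>?f ` space M. measure M (?f -` {y} \<inter> space M)) = 1" by (simp add: prob_space)
    have "shannon M ?f = - (\<Sum>y\<in>?f ` space M. measure M (?f -` {y} \<inter> space M) * ln (1 / d ^ n))"
      unfolding shannon_def by (simp add: m)
    also have "\<dots> = n * ln d"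
      unfolding sum_distrib_right[symmetric] one using d by (simp add: ln_div ln_realpow)
    finally show ?thesis .
  qed
  \<comment> \<open>Division by zero gives 0 at \<open>n = 0\<close>; from \<open>n = 1\<close> on
    the sequence is constant.\<close>
  then have "(\<lambda>n. shannon M (itinerary dual_shift (cell P) n) / n) = (\<lambda>n. if n = 0 then 0 else ln d)" by auto
  moreover have "(\<lambda>n. if n = 0 then 0 else ln d) \<longlonglongrightarrow> ln d"
    by (rule tendsto_eventually) (auto simp: eventually_sequentially intro!: exI[of _ 1])
  ultimately show ?thesis using partition_entropy_rate_cells[OF P] by (simp add: limI)
qed

end

section \<open>The dual derivative of a uniformly symmetric map\<close>

lemma cis_2pi_eq_iff: "cis (2 * pi * a) = cis (2 * pi * b) \<longleftrightarrow> (\<exists>k::int. a = b + k)"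
proof
  assume "cis (2 * pi * a) = cis (2 * pi * b)"
  then have "cis (2 * pi * (a - b)) = 1"
    by (simp add: right_diff_distrib flip: cis_divide)
  then have "cos (2 * pi * (a - b)) = 1" by (simp add: complex_eq_iff)
  then obtain k :: int where "2 * pi * (a - b) = k * (2 * pi)" by (auto simp: cos_one_2pi_int)
  then have "a = b + k" by auto
  then show "\<exists>k::int. a = b + k" ..
next
  assume "\<exists>k::int. a = b + k"
  then obtain k :: int where "a = b + k" ..
  then show "cis (2 * pi * a) = cis (2 * pi * b)"
    by (simp add: distrib_left flip: cis_mult)
qed

lemma is_circle_lift_unique:
  assumes F: "is_circle_lift d f F" and F': "is_circle_lift d f F'"
  shows "F = F'"
proof -
  define h where "h x = F x - F' x" for x
  have cont: "continuous_on UNIV h" unfolding h_def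
    using F F' by (auto simp: is_circle_lift_def homeomorphism_def intro: continuous_on_diff)
  have int: "\<exists>k::int. h x = k" for x
  proof -
    have "cis (2 * pi * F x) = cis (2 * pi * F' x)"
      using F F' by (simp add: is_circle_lift_def)
    then show ?thesis by (auto simp: cis_2pi_eq_iff h_def)
  qed
  have "h constant_on UNIV"
  proof (rule continuous_discrete_range_constant[OF _ cont])
    fix x :: real
    have "1 \<le> norm (h y - h x)" if "h y \<noteq> h x" for y
    proof -
      obtain k l :: int where kl: "h y = k" "h x = l" using int by metis
      then have "1 \<le> \<bar>k - l\<bar>" using that by simp
      then have "1 \<le> \<bar>real_of_int (k - l)\<bar>" by linarith
      then show ?thesis by (simp add: kl)
    qed
    then show "\<exists>e>0. \<forall>y. y \<in> UNIV \<and> h y \<noteq> h x \<longrightarrow> e \<le> norm (h y - h x)"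
      by (intro exI[of _ 1]) auto
  qed simp
  moreover have "h 0 = 0" using F F' by (simp add: h_def is_circle_lift_def)
  ultimately have "h x = 0" for x by (metis constant_on_def UNIV_I)
  then show ?thesis by (auto simp: h_def)
qed

lemma circle_lift_eq: "is_circle_lift d f F \<Longrightarrow> circle_lift d f = F"
  unfolding circle_lift_def by (rule the_equality) (auto dest: is_circle_lift_unique)

text \<open>The integer that locates the interval of a word. The letter \<open>w 0\<close>, last in
  the word, is the least significant digit: \<open>dual_shift\<close> removes it and passes to the
  parent interval, while letters further left are more significant.\<close>

definition digits_value :: "nat \<Rightarrow> (nat \<Rightarrow> nat) \<Rightarrow> nat \<Rightarrow> nat" where
  "digits_value d w n = (\<Sum>i<n. w i * d ^ i)"

lemma digits_value_Suc_shift: "digits_value d w (Suc n) = w 0 + d * digits_value d (dual_shift w) n"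
  unfolding digits_value_def sum.lessThan_Suc_shift
  by (simp add: dual_shift_def sum_distrib_left mult_ac)

lemma digits_value_add:
  "digits_value d w (n + k) = digits_value d w n + d ^ n * digits_value d (\<lambda>i. w (n + i)) k"
  by (induction k) (auto simp: digits_value_def algebra_simps power_add)

lemma length_right_word [simp]: "length (right_word w n) = n"
  by (simp add: right_word_def)

lemma word_value_right_word: "word_value d (right_word w n) = digits_value d w n"
proof -
  have "word_value d (right_word w n) = (\<Sum>k<n. w (n - Suc k) * d ^ (n - Suc k))"
    unfolding word_value_def
    by (intro sum.cong) (auto simp: right_word_def rev_nth)
  also have "\<dots> = digits_value d w n"
    unfolding digits_value_def by (rule sum.nat_diff_reindex[of "\<lambda>i. w i * d ^ i"])
  finally show ?thesis .
qed

lemma butlast_right_word: "butlast (right_word w (Suc n)) = right_word (dual_shift w) n"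
proof -
  have "right_word w (Suc n) = right_word (dual_shift w) n @ [w 0]"
    unfolding right_word_def upt_rec[of 0 "Suc n"] map_Suc_upt[symmetric]
    by (simp add: rev_map dual_shift_def comp_def)
  then show ?thesis by simp
qed

section \<open>Inverse lifts and the lengths of word intervals\<close>

locale lift_inverse =
  fixes d :: nat and G :: "real \<Rightarrow> real"
  assumes d: "2 \<le> d" and cont: "continuous_on UNIV G" and mono: "strict_mono G"
    and shift: "\<And>x. G (x + real d) = G x + 1" and zero: "G 0 = 0"
begin

definition cell_length :: "nat \<Rightarrow> real \<Rightarrow> real" where
  "cell_length n x = (G ^^ n) (x + 1) - (G ^^ n) x"

lemma strict_mono_funpow: "strict_mono (G ^^ n)"
  by (induction n) (auto simp: strict_mono_def intro: strict_monoD[OF mono])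

lemma funpow_less_iff: "(G ^^ n) x < (G ^^ n) y \<longleftrightarrow> x < y"
  using strict_mono_funpow by (rule strict_mono_less)

lemma funpow_le_iff: "(G ^^ n) x \<le> (G ^^ n) y \<longleftrightarrow> x \<le> y"
  using strict_mono_funpow by (rule strict_mono_less_eq)

lemma continuous_on_funpow: "continuous_on UNIV (G ^^ n)"
proof (induction n)
  case (Suc n)
  then show ?case using continuous_on_compose[OF Suc continuous_on_subset[OF cont]] by simp
qed (simp add: id_def)

lemma shift_nat: "G (x + real d * real q) = G x + q"
proof (induction q)
  case (Suc q)
  have "x + real d * real (Suc q) = (x + real d * real q) + d" by (simp add: algebra_simps)
  then show ?case using Suc shift[of "x + real d * real q"] by (simp add: algebra_simps)
qed simp

lemma funpow_shift: "(G ^^ n) (x + real d ^ n * real q) = (G ^^ n) x + q"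
proof (induction n arbitrary: x)
  case (Suc n)
  have "x + real d ^ Suc n * q = x + real d * real (d ^ n * q)" by (simp add: mult.assoc)
  then have "(G ^^ Suc n) (x + real d ^ Suc n * q) = (G ^^ n) (G x + real (d ^ n * q))"
    by (simp only: funpow_Suc_right comp_def shift_nat)
  then show ?case using Suc by (simp add: funpow_swap1)
qed simp

text \<open>Since \<open>G (d * q) = q\<close>, an end point of one generation of intervals is an
  end point of the next, which nests children in their parent.\<close>

lemma funpow_Suc_mult: "(G ^^ Suc n) (real d * real q) = (G ^^ n) (real q)"
  using shift_nat[of 0 q] by (simp add: funpow_swap1 zero)

lemma cell_length_pos: "0 < cell_length n x"
  by (simp add: cell_length_def funpow_less_iff)

lemma image_funpow: "(G ^^ n) ` {x..y} = {(G ^^ n) x..(G ^^ n) y}"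
proof (intro equalityI subsetI)
  fix z assume z: "z \<in> {(G ^^ n) x..(G ^^ n) y}"
  then have "x \<le> y" using funpow_le_iff by (meson atLeastAtMost_iff order_trans)
  then obtain u where "x \<le> u" "u \<le> y" "(G ^^ n) u = z"
    using IVT'[of "G ^^ n" x z y] z continuous_on_subset[OF continuous_on_funpow] by auto
  then show "z \<in> (G ^^ n) ` {x..y}" by auto
qed (auto simp: funpow_le_iff)

text \<open>Appending a letter: the unit intervals at \<open>j + d * m\<close> tile the interval
  from \<open>d * m\<close> to \<open>d * m + d\<close>, which \<open>G\<close> maps onto the one
  from \<open>m\<close> to \<open>m + 1\<close>.\<close>

lemma sum_cell_length_children:
  "(\<Sum>j<d. cell_length (Suc n) (real (j + d * m))) = cell_length n (real m)"
proof -
  have "(\<Sum>j<d. cell_length (Suc n) (real (j + d * m))) =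
      (\<Sum>j<d. (G ^^ Suc n) (real (Suc j + d * m)) - (G ^^ Suc n) (real (j + d * m)))"
    by (simp add: cell_length_def add_ac)
  also have "\<dots> = (G ^^ Suc n) (real (d + d * m)) - (G ^^ Suc n) (real (0 + d * m))"
    by (rule sum_lessThan_telescope)
  also have "\<dots> = cell_length n (real m)"
    using funpow_Suc_mult[of n m] funpow_Suc_mult[of n "Suc m"]
    by (simp add: cell_length_def algebra_simps del: funpow.simps)
  finally show ?thesis .
qed

lemma measure_word_interval:
  assumes "circle_lift d f = F" "inv F = G"
  shows "measure lborel (word_interval d f (right_word w n)) =
    cell_length n (real (digits_value d w n))"
  using assms cell_length_pos[of n "real (digits_value d w n)"]
  by (simp add: word_interval_def lift_inv_iter_def image_funpow word_value_right_word
      cell_length_def less_imp_le)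

end

lemma lift_inverse_inv:
  assumes "is_circle_lift d f F" "2 \<le> d"
  shows "lift_inverse d (inv F)"
proof
  have hom: "homeomorphism UNIV UNIV F (inv F)" and mono: "strict_mono F" and zero: "F 0 = 0"
    and shift: "\<And>x. F (x + 1) = F x + d" using assms by (auto simp: is_circle_lift_def)
  have F1: "inv F (F x) = x" and F2: "F (inv F x) = x" for x
    using hom by (auto simp: homeomorphism_def)
  show "continuous_on UNIV (inv F)" using hom by (simp add: homeomorphism_def)
  show "strict_mono (inv F)"
  proof (rule strict_monoI)
    fix x y :: real assume "x < y"
    then have "F (inv F x) < F (inv F y)" by (simp add: F2)
    then show "inv F x < inv F y" using strict_mono_less[OF mono] by blast
  qed
  show "inv F (x + real d) = inv F x + 1" for x
    using shift[of "inv F x"] F1 F2 by metis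
  show "inv F 0 = 0" using F1[of 0] zero by simp
qed (rule assms)

section \<open>Iterates of the inverse lift are nearly affine at small scales\<close>

lemma geometric_comparison:
  fixes \<Delta> :: "nat \<Rightarrow> real"
  assumes "\<And>i. \<Delta> (Suc i) \<le> q * \<Delta> i" "\<And>i. \<Delta> i \<le> q * \<Delta> (Suc i)" "\<And>i. 0 \<le> \<Delta> i" "1 \<le> q"
    and "i < N" "j < N"
  shows "\<Delta> i \<le> q ^ N * \<Delta> j"
proof -
  have up: "\<Delta> (i + k) \<le> q ^ k * \<Delta> i" for i k
  proof (induction k)
    case (Suc k)
    have "\<Delta> (i + Suc k) \<le> q * \<Delta> (i + k)" using assms(1) by simp
    also have "\<dots> \<le> q * (q ^ k * \<Delta> i)" using Suc assms(4) by (intro mult_left_mono) auto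
    finally show ?case by (simp add: mult_ac)
  qed simp
  have down: "\<Delta> i \<le> q ^ k * \<Delta> (i + k)" for i k
  proof (induction k)
    case (Suc k)
    have "q ^ k * \<Delta> (i + k) \<le> q ^ k * (q * \<Delta> (Suc (i + k)))"
      using assms by (intro mult_left_mono) auto
    then show ?case using Suc by (simp add: mult_ac)
  qed simp
  have N: "q ^ k * \<Delta> j \<le> q ^ N * \<Delta> j" if "k \<le> N" for k
    using that assms by (intro mult_right_mono power_increasing) auto
  show ?thesis
  proof (cases "i \<le> j")
    case True
    then show ?thesis using down[of i "j - i"] N[of "j - i"] assms(6) by (simp add: less_imp_diff_less less_imp_le)
  next
    case False
    then show ?thesis using up[of j "i - j"] N[of "i - j"] assms(5) by (simp add: less_imp_diff_less less_imp_le)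
  qed
qed

text \<open>If \<open>N\<close> numbers agree up to the factor \<open>Q\<close>, any
  \<open>m\<close> leading ones carry the share \<open>m / N\<close> of the total up to the same
  factor. Both inequalities sum the pairwise comparison over a rectangle of index pairs.\<close>

lemma partial_sum_comparison:
  fixes \<Delta> :: "nat \<Rightarrow> real"
  assumes "\<And>i j. i < N \<Longrightarrow> j < N \<Longrightarrow> \<Delta> i \<le> Q * \<Delta> j" "m \<le> N"
  shows "N * (\<Sum>l<m. \<Delta> l) \<le> Q * m * (\<Sum>j<N. \<Delta> j)"
    and "m * (\<Sum>j<N. \<Delta> j) \<le> Q * N * (\<Sum>l<m. \<Delta> l)"
proof -
  have "N * (\<Sum>l<m. \<Delta> l) = (\<Sum>l<m. \<Sum>j<N. \<Delta> l)" by (simp add: sum_distrib_left)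
  also have "\<dots> \<le> (\<Sum>l<m. \<Sum>j<N. Q * \<Delta> j)" using assms by (intro sum_mono) auto
  finally show "N * (\<Sum>l<m. \<Delta> l) \<le> Q * m * (\<Sum>j<N. \<Delta> j)"
    by (simp add: sum_distrib_left mult_ac)
  have "m * (\<Sum>j<N. \<Delta> j) = (\<Sum>j<N. \<Sum>l<m. \<Delta> j)" by (simp add: sum_distrib_left)
  also have "\<dots> \<le> (\<Sum>j<N. \<Sum>l<m. Q * \<Delta> l)" using assms by (intro sum_mono) auto
  finally show "m * (\<Sum>j<N. \<Delta> j) \<le> Q * N * (\<Sum>l<m. \<Delta> l)"
    by (simp add: sum_distrib_left mult_ac)
qed

text \<open>The quotient bound of uniform symmetry with absolute values and division cleared. It
  includes \<open>n = 0\<close>, where the two increments are equal.\<close>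

locale symmetric_lift_inverse = lift_inverse +
  fixes \<epsilon> :: "real \<Rightarrow> real"
  assumes \<epsilon>_pos: "\<And>t. 0 < t \<Longrightarrow> 0 < \<epsilon> t" and \<epsilon>_lim: "(\<epsilon> \<longlongrightarrow> 0) (at_right 0)"
    and sym: "\<And>n x t. 0 < t \<Longrightarrow>
        (G ^^ n) (x + t) - (G ^^ n) x \<le> (1 + \<epsilon> t) * ((G ^^ n) x - (G ^^ n) (x - t))"
      "\<And>n x t. 0 < t \<Longrightarrow>
        (G ^^ n) x - (G ^^ n) (x - t) \<le> (1 + \<epsilon> t) * ((G ^^ n) (x + t) - (G ^^ n) x)"
begin

lemma equal_pieces_comparison:
  assumes "0 < s" "i < N" "j < N"
  shows "(G ^^ n) (a + real (Suc i) * s) - (G ^^ n) (a + real i * s)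
     \<le> (1 + \<epsilon> s) ^ N * ((G ^^ n) (a + real (Suc j) * s) - (G ^^ n) (a + real j * s))"
proof (rule geometric_comparison[of "\<lambda>i. (G ^^ n) (a + real (Suc i) * s) - (G ^^ n) (a + real i * s)", OF _ _ _ _ assms(2,3)])
  fix i
  show "(G ^^ n) (a + real (Suc (Suc i)) * s) - (G ^^ n) (a + real (Suc i) * s)
      \<le> (1 + \<epsilon> s) * ((G ^^ n) (a + real (Suc i) * s) - (G ^^ n) (a + real i * s))"
    using sym(1)[OF assms(1), of n "a + real (Suc i) * s"] by (simp add: algebra_simps)
  show "(G ^^ n) (a + real (Suc i) * s) - (G ^^ n) (a + real i * s)
      \<le> (1 + \<epsilon> s) * ((G ^^ n) (a + real (Suc (Suc i)) * s) - (G ^^ n) (a + real (Suc i) * s))"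
    using sym(2)[OF assms(1), of n "a + real (Suc i) * s"] by (simp add: algebra_simps)
  show "0 \<le> (G ^^ n) (a + real (Suc i) * s) - (G ^^ n) (a + real i * s)"
    using assms by (simp add: funpow_le_iff)
  show "1 \<le> 1 + \<epsilon> s" using \<epsilon>_pos[OF assms(1)] by simp
qed

text \<open>Cut the interval into \<open>N\<close> equal pieces; their images agree up to the factor
  \<open>Q\<close>. Comparing \<open>x\<close> with the neighbouring grid points costs
  \<open>Q - 1\<close> for the distortion and \<open>Q / N\<close> for the mesh. The bound is
  uniform in \<open>n\<close>, and small once \<open>N\<close> is large and the pieces are so short
  that \<open>Q\<close> is close to 1.\<close>

lemma relative_position:
  assumes ab: "a < b" and x: "a \<le> x" "x \<le> b" and N: "0 < N"
  defines "Q \<equiv> (1 + \<epsilon> ((b - a) / real N)) ^ N"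
  shows "\<bar>((G ^^ n) x - (G ^^ n) a) - (x - a) / (b - a) * ((G ^^ n) b - (G ^^ n) a)\<bar>
     \<le> (Q - 1 + Q / N) * ((G ^^ n) b - (G ^^ n) a)"
proof -
  define s where "s = (b - a) / real N"
  define D where "D = (G ^^ n) b - (G ^^ n) a"
  define \<theta> where "\<theta> = (x - a) / (b - a)"
  define \<Delta> where "\<Delta> l = (G ^^ n) (a + real (Suc l) * s) - (G ^^ n) (a + real l * s)" for l
  have s: "0 < s" using ab N by (simp add: s_def)
  have Q: "1 \<le> Q" unfolding Q_def using \<epsilon>_pos[OF s] by (intro one_le_power) (simp add: s_def)
  have D: "0 < D" using ab by (simp add: D_def funpow_less_iff)
  have \<theta>: "0 \<le> \<theta>" "\<theta> \<le> 1" using x ab by (auto simp: \<theta>_def)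
  have cmp: "\<Delta> i \<le> Q * \<Delta> j" if "i < N" "j < N" for i j
    using equal_pieces_comparison[OF s that, of n a] by (simp add: \<Delta>_def Q_def s_def)
  have sum: "(\<Sum>l<m. \<Delta> l) = (G ^^ n) (a + real m * s) - (G ^^ n) a" for m
    unfolding \<Delta>_def by (subst sum_lessThan_telescope) simp
  have sumN: "(\<Sum>l<N. \<Delta> l) = D"
    unfolding sum[of N] D_def using N by (simp add: s_def)
  have xs: "x = a + \<theta> * N * s" using ab N by (simp add: \<theta>_def s_def)
  \<comment> \<open>The index of the last grid point not beyond \<open>x\<close>. It equals
    \<open>N\<close> only for \<open>x = b\<close>, a case treated apart in the upper bound because
    it has no next grid point.\<close>
  define i where "i = nat \<lfloor>\<theta> * N\<rfloor>"
  have i: "real i \<le> \<theta> * N" "\<theta> * N < real i + 1"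
    using \<theta> by (auto simp: i_def)
  have iN: "i \<le> N"
  proof -
    have "\<theta> * N \<le> N" using \<theta> N by (simp add: mult_left_le_one_le)
    then show ?thesis using i(1) by linarith
  qed
  have upper: "(G ^^ n) x - (G ^^ n) a - \<theta> * D \<le> (Q - 1 + Q / N) * D"
  proof (cases "i = N")
    case True
    then have "1 \<le> \<theta>" using i(1) N by simp
    then have "\<theta> = 1" using \<theta> by simp
    then have "x = b" using ab by (simp add: \<theta>_def field_simps)
    then show ?thesis using \<open>\<theta> = 1\<close> Q D N by (simp add: D_def)
  next
    case False
    then have "N * (\<Sum>l<Suc i. \<Delta> l) \<le> Q * real (Suc i) * (\<Sum>j<N. \<Delta> j)"
      using iN by (intro partial_sum_comparison(1) cmp) auto
    then have "N * ((G ^^ n) (a + real (Suc i) * s) - (G ^^ n) a) \<le> Q * real (Suc i) * D"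
      unfolding sumN sum[of "Suc i"] .
    moreover have "(G ^^ n) x \<le> (G ^^ n) (a + real (Suc i) * s)"
      unfolding funpow_le_iff xs using i s by simp
    ultimately have "N * ((G ^^ n) x - (G ^^ n) a) \<le> Q * real (Suc i) * D"
      using N by (smt (verit) mult_left_mono of_nat_0_le_iff)
    also have "\<dots> \<le> Q * (\<theta> * N + 1) * D"
      using i Q D by (intro mult_right_mono mult_left_mono) auto
    finally have "(G ^^ n) x - (G ^^ n) a \<le> Q * (\<theta> + 1 / N) * D"
      using N by (simp add: field_simps)
    moreover have "(Q - 1) * \<theta> * D \<le> (Q - 1) * 1 * D"
      using Q D \<theta> by (intro mult_right_mono mult_left_mono) auto
    ultimately show ?thesis by (simp add: algebra_simps)
  qed
  have lower: "\<theta> * D - ((G ^^ n) x - (G ^^ n) a) \<le> (Q - 1 + Q / N) * D"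
  proof -
    have "i * (\<Sum>j<N. \<Delta> j) \<le> Q * real N * (\<Sum>l<i. \<Delta> l)"
      using iN by (intro partial_sum_comparison(2) cmp) auto
    then have "i * D \<le> Q * real N * ((G ^^ n) (a + real i * s) - (G ^^ n) a)"
      unfolding sumN sum[of i] .
    also have "\<dots> \<le> Q * real N * ((G ^^ n) x - (G ^^ n) a)"
    proof -
      have "(G ^^ n) (a + real i * s) \<le> (G ^^ n) x"
        unfolding funpow_le_iff xs using i s by simp
      then show ?thesis using Q by (intro mult_left_mono) auto
    qed
    finally have *: "i * D \<le> Q * real N * ((G ^^ n) x - (G ^^ n) a)" .
    have "(\<theta> * N - 1) * D \<le> i * D" using i D by (intro mult_right_mono) auto
    with * have "(\<theta> * N - 1) * D \<le> Q * N * ((G ^^ n) x - (G ^^ n) a)" by linarith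
    then have **: "(\<theta> - 1 / N) * D \<le> Q * ((G ^^ n) x - (G ^^ n) a)" using N by (simp add: field_simps)
    have "(\<theta> - 1 / N) * D / Q \<le> (G ^^ n) x - (G ^^ n) a"
      using ** Q by (simp add: divide_le_eq mult.commute)
    \<comment> \<open>The deficit splits into terms with \<open>1 - 1 / Q\<close> and
      \<open>1 / (N * Q)\<close>; enlarging these to \<open>Q - 1\<close> and \<open>Q / N\<close>
      gives the same error as from above.\<close>
    moreover have "\<theta> * D - (\<theta> - 1 / N) * D / Q = \<theta> * D * (1 - 1 / Q) + D * (1 / (N * Q))"
      using Q N by (simp add: field_simps)
    moreover have "\<theta> * D * (1 - 1 / Q) \<le> 1 * D * (Q - 1)"
    proof (intro mult_mono)
      have "0 \<le> (Q - 1) * (Q - 1)" by simp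
      then show "1 - 1 / Q \<le> Q - 1" using Q by (simp add: field_simps)
    qed (use Q D \<theta> in \<open>auto simp: field_simps\<close>)
    moreover have "D * (1 / (N * Q)) \<le> D * (Q / N)"
    proof (intro mult_left_mono)
      have "1 * 1 \<le> Q * Q" using Q by (intro mult_mono) auto
      then show "1 / (N * Q) \<le> Q / N" using Q N by (simp add: field_simps)
    qed (use D in simp)
    ultimately show ?thesis by (simp add: algebra_simps)
  qed
  show ?thesis using upper lower unfolding D_def[symmetric] \<theta>_def[symmetric] by linarith
qed

text \<open>Siblings are images of \<open>d\<close> consecutive intervals of length 1, so neighbours
  are compared at \<open>t = 1\<close>, fewer than \<open>d\<close> times in a row.\<close>

definition distortion :: real where
  "distortion = (1 + \<epsilon> 1) ^ d"

lemma distortion_ge_1: "1 \<le> distortion"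
  using \<epsilon>_pos[of 1] by (auto simp: distortion_def intro: one_le_power)

lemma cell_length_child_ge:
  assumes "j < d"
  shows "cell_length n (real m) \<le> d * distortion * cell_length (Suc n) (real (j + d * m))"
proof -
  have "cell_length (Suc n) (real (i + d * m)) \<le> distortion * cell_length (Suc n) (real (j + d * m))"
    if "i < d" for i
    using equal_pieces_comparison[of 1 i d j "Suc n" "real (d * m)"] that assms
    by (simp add: cell_length_def distortion_def add_ac del: funpow.simps)
  then have "(\<Sum>i<d. cell_length (Suc n) (real (i + d * m))) \<le>
      (\<Sum>i<d. distortion * cell_length (Suc n) (real (j + d * m)))"
    by (intro sum_mono) auto
  then show ?thesis unfolding sum_cell_length_children by simp
qed

text \<open>As \<open>d\<close> is at least 2, each child has a sibling, which takes at least the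
  share \<open>1 / (d * distortion)\<close> of the parent.\<close>

definition contraction :: real where
  "contraction = 1 - 1 / (d * distortion)"

lemma contraction: "0 \<le> contraction" "contraction < 1"
proof -
  have "1 * 1 \<le> real d * distortion" using distortion_ge_1 d by (intro mult_mono) auto
  then show "0 \<le> contraction" "contraction < 1" by (auto simp: contraction_def field_simps)
qed

lemma cell_length_child_le:
  assumes "j < d"
  shows "cell_length (Suc n) (real (j + d * m)) \<le> contraction * cell_length n (real m)"
proof -
  define i where "i = (if j = 0 then 1 else 0 :: nat)"
  have i: "i < d" "i \<noteq> j" using d by (auto simp: i_def)
  have "(\<Sum>k\<in>{i, j}. cell_length (Suc n) (real (k + d * m))) \<le> (\<Sum>k<d. cell_length (Suc n) (real (k + d * m)))"
    using assms i cell_length_pos by (intro sum_mono2) (auto simp: less_imp_le)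
  then have "cell_length (Suc n) (real (j + d * m)) \<le> cell_length n (real m) - cell_length (Suc n) (real (i + d * m))"
    using i unfolding sum_cell_length_children by simp
  moreover have "cell_length n (real m) / (d * distortion) \<le> cell_length (Suc n) (real (i + d * m))"
    using cell_length_child_ge[OF i(1), of n m] distortion_ge_1 d
    by (simp add: divide_le_eq mult.commute)
  ultimately show ?thesis by (simp add: contraction_def left_diff_distrib)
qed

lemma cell_length_le:
  "w \<in> dual_space d \<Longrightarrow> cell_length n (real (digits_value d w n)) \<le> contraction ^ n"
proof (induction n arbitrary: w)
  case 0
  then show ?case by (simp add: cell_length_def)
next
  case (Suc n)
  have w: "w 0 < d" "dual_shift w \<in> dual_space d" using Suc.prems by (auto simp: dual_space_def dual_shift_def)
  have "cell_length (Suc n) (real (digits_value d w (Suc n))) \<le>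
      contraction * cell_length n (real (digits_value d (dual_shift w) n))"
    unfolding digits_value_Suc_shift by (rule cell_length_child_le[OF w(1)])
  also have "\<dots> \<le> contraction * contraction ^ n"
    using contraction Suc.IH[OF w(2)] by (intro mult_left_mono) auto
  finally show ?case by simp
qed

text \<open>The reciprocal of the quotient in the dual derivative, at word length
  \<open>n + 1\<close>. In this form the values over the \<open>d\<close> siblings sum to 1 for
  every \<open>n\<close>.\<close>

definition child_ratio :: "(nat \<Rightarrow> nat) \<Rightarrow> nat \<Rightarrow> real" where
  "child_ratio w n = cell_length (Suc n) (real (digits_value d w (Suc n))) /
     cell_length n (real (digits_value d (dual_shift w) n))"

lemma child_ratio_ge:
  assumes "w \<in> dual_space d"
  shows "1 / (d * distortion) \<le> child_ratio w n"
proof -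
  have "w 0 < d" using assms by (auto simp: dual_space_def)
  from cell_length_child_ge[OF this, of n "digits_value d (dual_shift w) n"] show ?thesis
    using cell_length_pos d distortion_ge_1 unfolding child_ratio_def digits_value_Suc_shift
    by (simp add: field_simps)
qed

text \<open>
  Adding further digits on the left applies an iterate of \<open>G\<close> to a translate of the same pair
  of nested intervals.
\<close>

lemma child_ratio_diff_le:
  fixes n N :: nat
  assumes w: "w \<in> dual_space d" and N: "0 < N"
  defines "Q \<equiv> (1 + \<epsilon> (cell_length n (real (digits_value d (dual_shift w) n)) / N)) ^ N"
  shows "\<bar>child_ratio w (n + k) - child_ratio w n\<bar> \<le> 2 * (Q - 1 + Q / N)"
proof -
  let ?m' = "digits_value d (dual_shift w) n" and ?m = "digits_value d w (Suc n)"
  \<comment> \<open>The \<open>k\<close> further letters as a number. In the values of child and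
    parent it is multiplied by \<open>d ^ Suc n\<close> and \<open>d ^ n\<close>; after that many
    iterates of \<open>G\<close> both become a translation by the same \<open>V\<close>.\<close>
  define V where "V = digits_value d (\<lambda>i. w (Suc n + i)) k"
  define a b where "a = (G ^^ n) (real ?m') + V" and "b = (G ^^ n) (real ?m' + 1) + V"
  define x y where "x = (G ^^ Suc n) (real ?m) + V" and "y = (G ^^ Suc n) (real ?m + 1) + V"
  have w0: "w 0 < d" using w by (auto simp: dual_space_def)
  have m: "?m = w 0 + d * ?m'" by (rule digits_value_Suc_shift)
  have a_eq: "a = (G ^^ Suc n) (real (d * ?m')) + V"
    using funpow_Suc_mult[of n ?m'] by (simp add: a_def)
  have b_eq: "b = (G ^^ Suc n) (real (d * ?m') + d) + V"
    using funpow_Suc_mult[of n "Suc ?m'"] by (simp add: b_def algebra_simps)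
  have ab: "a < b" by (simp add: a_def b_def funpow_less_iff)
  have "real (w 0) + 1 \<le> d" using w0 by linarith
  then have xy: "a \<le> x" "x \<le> b" "a \<le> y" "y \<le> b" "x < y"
    unfolding a_eq b_eq x_def y_def m using w0
    by (auto simp: funpow_le_iff funpow_less_iff simp del: funpow.simps)
  have ba: "b - a = cell_length n (real ?m')" by (simp add: a_def b_def cell_length_def)
  have yx: "y - x = cell_length (Suc n) (real ?m)"
    by (simp add: x_def y_def cell_length_def del: funpow.simps)
  have num: "cell_length (Suc (n + k)) (real (digits_value d w (Suc (n + k)))) = (G ^^ k) y - (G ^^ k) x"
  proof -
    have "digits_value d w (Suc (n + k)) = ?m + d ^ Suc n * V"
      using digits_value_add[of d w "Suc n" k] by (simp add: V_def)
    moreover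
    have *: "(G ^^ Suc (n + k)) (z + real d ^ Suc n * real V) = (G ^^ k) ((G ^^ Suc n) z + V)" for z
    proof -
      have "(G ^^ Suc (n + k)) u = (G ^^ k) ((G ^^ Suc n) u)" for u
        using funpow_add[of k "Suc n" G] by (simp add: add.commute)
      then show ?thesis by (simp only: funpow_shift)
    qed
    ultimately show ?thesis using *[of "real ?m"] *[of "real ?m + 1"]
      by (simp add: cell_length_def x_def y_def algebra_simps del: funpow.simps)
  qed
  have den: "cell_length (n + k) (real (digits_value d (dual_shift w) (n + k))) = (G ^^ k) b - (G ^^ k) a"
  proof -
    have "digits_value d (dual_shift w) (n + k) = ?m' + d ^ n * V"
      using digits_value_add[of d "dual_shift w" n k] by (simp add: V_def dual_shift_def)
    moreover
    have *: "(G ^^ (n + k)) (z + real d ^ n * real V) = (G ^^ k) ((G ^^ n) z + V)" for z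
    proof -
      have "(G ^^ (n + k)) u = (G ^^ k) ((G ^^ n) u)" for u
        using funpow_add[of k n G] by (simp add: add.commute)
      then show ?thesis by (simp only: funpow_shift)
    qed
    ultimately show ?thesis using *[of "real ?m'"] *[of "real ?m' + 1"]
      by (simp add: cell_length_def a_def b_def algebra_simps)
  qed
  define D where "D = (G ^^ k) b - (G ^^ k) a"
  have D: "0 < D" using ab by (simp add: D_def funpow_less_iff)
  note pos = relative_position[OF ab _ _ N, of _ k, unfolded ba, folded Q_def, folded ba D_def]
  have "(y - x) / (b - a) * D = (y - a) / (b - a) * D - (x - a) / (b - a) * D"
    by (simp add: diff_divide_distrib left_diff_distrib)
  moreover have "\<bar>Y - X - r\<bar> \<le> 2 * e" if "\<bar>X - A - p\<bar> \<le> e" "\<bar>Y - A - q\<bar> \<le> e" "r = q - p"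
    for X Y A p q r e :: real using that by linarith
  ultimately have "\<bar>((G ^^ k) y - (G ^^ k) x) - (y - x) / (b - a) * D\<bar> \<le> 2 * ((Q - 1 + Q / N) * D)"
    using pos[OF xy(1,2)] pos[OF xy(3,4)] by blast
  moreover have "\<bar>u / D - t\<bar> * D = \<bar>u - t * D\<bar>" for u t
  proof -
    have "u - t * D = (u / D - t) * D" using D by (simp add: left_diff_distrib)
    then show ?thesis using D by (simp add: abs_mult)
  qed
  ultimately have "\<bar>((G ^^ k) y - (G ^^ k) x) / D - (y - x) / (b - a)\<bar> * D \<le> 2 * (Q - 1 + Q / N) * D"
    by (simp only: mult.assoc)
  then show ?thesis using D
    unfolding child_ratio_def num den D_def[symmetric] yx[symmetric] ba[symmetric] by simp
qed

lemma child_ratio_convergent: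
  assumes w: "w \<in> dual_space d"
  shows "convergent (child_ratio w)"
proof -
  have shift: "dual_shift w \<in> dual_space d" using w by (auto simp: dual_space_def dual_shift_def)
  let ?l = "\<lambda>n. cell_length n (real (digits_value d (dual_shift w) n))"
  have l: "?l \<longlonglongrightarrow> 0"
    using cell_length_le[OF shift] cell_length_pos contraction
    by (intro tendsto_sandwich[of "\<lambda>_. 0" ?l _ "\<lambda>n. contraction ^ n"])
       (auto intro!: always_eventually LIMSEQ_realpow_zero less_imp_le)
  have "Cauchy (child_ratio w)"
  proof (rule CauchyI')
    fix e :: real assume e: "0 < e"
    \<comment> \<open>\<open>N\<close> is fixed before the generation \<open>n\<close>. With
      \<open>N\<close> fixed, \<open>Q n\<close> tends to 1 because the intervals shrink, and the
      bound tends to \<open>2 / N < e / 2\<close>.\<close>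
    obtain N :: nat where N: "4 / e < N" using reals_Archimedean2 by blast
    then have N0: "0 < real N" using e by (meson divide_pos_pos less_trans zero_less_numeral)
    define Q where "Q n = (1 + \<epsilon> (?l n / N)) ^ N" for n
    have "(\<lambda>n. ?l n / N) \<longlonglongrightarrow> 0" using l N0 tendsto_divide_zero by blast
    then have "filterlim (\<lambda>n. ?l n / N) (at_right 0) sequentially"
      using cell_length_pos N0
      by (auto simp: filterlim_at less_imp_neq[OF cell_length_pos, symmetric] intro!: always_eventually)
    then have "(\<lambda>n. \<epsilon> (?l n / N)) \<longlonglongrightarrow> 0" by (rule filterlim_compose[OF \<epsilon>_lim])
    then have "(\<lambda>n. 2 * (Q n - 1 + Q n / N)) \<longlonglongrightarrow> 2 * ((1 + 0) ^ N - 1 + (1 + 0) ^ N / N)"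
      unfolding Q_def using N0 by (intro tendsto_intros) auto
    moreover have "2 * ((1 + 0) ^ N - 1 + (1 + 0) ^ N / N) < e"
      using N e N0 by (simp add: field_simps)
    ultimately have "eventually (\<lambda>n. 2 * (Q n - 1 + Q n / N) < e) sequentially"
      by (rule order_tendstoD)
    then obtain n0 where n0: "\<And>n. n \<ge> n0 \<Longrightarrow> 2 * (Q n - 1 + Q n / N) < e"
      by (auto simp: eventually_sequentially)
    show "\<exists>M. \<forall>m\<ge>M. \<forall>n>m. dist (child_ratio w m) (child_ratio w n) < e"
    proof (intro exI[of _ n0] allI impI)
      fix m n assume mn: "n0 \<le> m" "m < n"
      have "\<bar>child_ratio w (m + (n - m)) - child_ratio w m\<bar> \<le> 2 * (Q m - 1 + Q m / N)"
        unfolding Q_def using N0 by (intro child_ratio_diff_le[OF w]) simp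
      then show "dist (child_ratio w m) (child_ratio w n) < e"
        using n0[OF mn(1)] mn by (simp add: dist_real_def)
    qed
  qed
  then show ?thesis by (rule Cauchy_convergent)
qed

lemma lim_child_ratio_pos:
  assumes "w \<in> dual_space d"
  shows "0 < lim (child_ratio w)"
proof -
  have "1 / (d * distortion) \<le> lim (child_ratio w)"
    using child_ratio_convergent[OF assms] child_ratio_ge[OF assms]
    by (intro LIMSEQ_le_const) (auto simp: convergent_LIMSEQ_iff)
  moreover have "0 < 1 / (d * distortion)" using d distortion_ge_1 by simp
  ultimately show ?thesis by linarith
qed

text \<open>Siblings fill their parent in every generation, and the identity passes to the limit.
  This is the normalisation of the potential on which invariance rests.\<close>

lemma sum_lim_child_ratio:
  assumes "w \<in> dual_space d"
  shows "(\<Sum>j<d. lim (child_ratio (case_nat j w))) = 1"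
proof -
  have jw: "case_nat j w \<in> dual_space d" if "j < d" for j
    using that assms by (auto simp: dual_space_def split: nat.split)
  have sh: "dual_shift (case_nat j w) = w" for j by (auto simp: dual_shift_def)
  have "(\<lambda>n. \<Sum>j<d. child_ratio (case_nat j w) n) \<longlonglongrightarrow> (\<Sum>j<d. lim (child_ratio (case_nat j w)))"
    using child_ratio_convergent[OF jw] by (intro tendsto_sum) (simp add: convergent_LIMSEQ_iff)
  moreover have "(\<Sum>j<d. child_ratio (case_nat j w) n) = 1" for n
    using cell_length_pos[of n "real (digits_value d w n)"]
    by (simp add: child_ratio_def digits_value_Suc_shift sh sum_cell_length_children
        flip: sum_divide_distrib del: of_nat_add of_nat_mult)
  ultimately show ?thesis by (simp add: LIMSEQ_const_iff)
qed

lemma dual_derivative_limit: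
  assumes "circle_lift d f = F" "inv F = G" and w: "w \<in> dual_space d"
  shows "(\<lambda>n. measure lborel (word_interval d f (butlast (right_word w n))) /
      measure lborel (word_interval d f (right_word w n))) \<longlonglongrightarrow> dual_derivative d f w"
    and "dual_derivative d f w = inverse (lim (child_ratio w))"
proof -
  let ?r = "\<lambda>n. measure lborel (word_interval d f (butlast (right_word w n))) /
      measure lborel (word_interval d f (right_word w n))"
  have r: "?r (Suc n) = inverse (child_ratio w n)" for n
    unfolding butlast_right_word measure_word_interval[OF assms(1,2)]
    by (simp add: child_ratio_def)
  have "(\<lambda>n. inverse (child_ratio w n)) \<longlonglongrightarrow> inverse (lim (child_ratio w))"
    using child_ratio_convergent[OF w] lim_child_ratio_pos[OF w]
    by (intro tendsto_inverse) (auto simp: convergent_LIMSEQ_iff)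
  then have "(\<lambda>n. ?r (Suc n)) \<longlonglongrightarrow> inverse (lim (child_ratio w))" unfolding r .
  then have *: "?r \<longlonglongrightarrow> inverse (lim (child_ratio w))" by (rule LIMSEQ_imp_Suc)
  then show eq: "dual_derivative d f w = inverse (lim (child_ratio w))"
    using w by (simp add: dual_derivative_def limI)
  show "?r \<longlonglongrightarrow> dual_derivative d f w" unfolding eq by (rule *)
qed

end

lemma symmetric_lift_inverse_of_uniformly_symmetric:
  assumes "uniformly_symmetric d f"
  obtains F \<epsilon> where "circle_lift d f = F" "symmetric_lift_inverse d (inv F) \<epsilon>"
proof -
  obtain F where F: "is_circle_lift d f F" and d: "2 \<le> d"
    using assms by (auto simp: uniformly_symmetric_def circle_endomorphism_def)
  note eq = circle_lift_eq[OF F]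
  interpret lift_inverse d "inv F" by (rule lift_inverse_inv[OF F d])
  obtain \<epsilon> :: "real \<Rightarrow> real" where \<epsilon>: "\<And>t. t > 0 \<Longrightarrow> \<epsilon> t > 0" "(\<epsilon> \<longlongrightarrow> 0) (at_right 0)"
    and q: "\<And>x t n. t > 0 \<Longrightarrow> n > 0 \<Longrightarrow>
      1 / (1 + \<epsilon> t) \<le> \<bar>(inv F ^^ n) (x + t) - (inv F ^^ n) x\<bar> / \<bar>(inv F ^^ n) x - (inv F ^^ n) (x - t)\<bar> \<and>
      \<bar>(inv F ^^ n) (x + t) - (inv F ^^ n) x\<bar> / \<bar>(inv F ^^ n) x - (inv F ^^ n) (x - t)\<bar> \<le> 1 + \<epsilon> t"
    using assms by (clarsimp simp: uniformly_symmetric_def lift_inv_iter_def eq Let_def) blast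
  have both: "(inv F ^^ n) (x + t) - (inv F ^^ n) x \<le> (1 + \<epsilon> t) * ((inv F ^^ n) x - (inv F ^^ n) (x - t)) \<and>
      (inv F ^^ n) x - (inv F ^^ n) (x - t) \<le> (1 + \<epsilon> t) * ((inv F ^^ n) (x + t) - (inv F ^^ n) x)"
    if t: "0 < t" for n x t
  proof (cases "n = 0")
    case True
    then show ?thesis using \<epsilon>(1)[OF t] t by (simp add: algebra_simps)
  next
    case False
    define A B where "A = (inv F ^^ n) (x + t) - (inv F ^^ n) x" and "B = (inv F ^^ n) x - (inv F ^^ n) (x - t)"
    have AB: "0 < A" "0 < B" using t by (auto simp: A_def B_def funpow_less_iff)
    have "1 / (1 + \<epsilon> t) \<le> A / B" "A / B \<le> 1 + \<epsilon> t"
      using q[OF t, of n x] False AB by (auto simp: A_def[symmetric] B_def[symmetric])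
    then have "A \<le> (1 + \<epsilon> t) * B \<and> B \<le> (1 + \<epsilon> t) * A"
      using AB \<epsilon>(1)[OF t] by (simp add: field_simps)
    then show ?thesis by (simp add: A_def B_def)
  qed
  have "symmetric_lift_inverse d (inv F) \<epsilon>"
    by unfold_locales (use both \<epsilon> in auto)
  then show ?thesis using that eq by blast
qed

section \<open>Gibbs measures are invariant\<close>

text \<open>A right cylinder indexed by a point and a length. Refinement fixes one more letter at
  the far end, as in \<open>w(n := j)\<close>, whereas preimages under the shift insert a letter at
  index 0, as in \<open>case_nat j w\<close>.\<close>

definition cylinder :: "nat \<Rightarrow> (nat \<Rightarrow> nat) \<Rightarrow> nat \<Rightarrow> (nat \<Rightarrow> nat) set" where
  "cylinder d w n = {u \<in> dual_space d. \<forall>k<n. u k = w k}"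

lemma right_word_eq_iff: "right_word u n = right_word w n \<longleftrightarrow> (\<forall>k<n. u k = w k)"
  by (auto simp: right_word_def)

lemma right_cylinder_right_word: "right_cylinder d (right_word w n) = cylinder d w n"
  by (simp add: right_cylinder_def cylinder_def right_word_eq_iff)

lemma case_nat_in_dual_space: "j < d \<Longrightarrow> w \<in> dual_space d \<Longrightarrow> case_nat j w \<in> dual_space d"
  by (auto simp: dual_space_def split: nat.split)

lemma dual_shift_in_dual_space: "w \<in> dual_space d \<Longrightarrow> dual_shift w \<in> dual_space d"
  by (auto simp: dual_space_def dual_shift_def)

lemma dual_shift_case_nat [simp]: "dual_shift (case_nat j w) = w"
  by (auto simp: dual_shift_def)

lemma dual_shift_image_cylinder:
  assumes "w \<in> dual_space d"
  shows "dual_shift ` cylinder d w (Suc n) = cylinder d (dual_shift w) n"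
proof (intro equalityI subsetI)
  fix u assume u: "u \<in> cylinder d (dual_shift w) n"
  have "w 0 < d" using assms by (simp add: dual_space_def)
  with u have "case_nat (w 0) u \<in> cylinder d w (Suc n)"
    by (auto simp: cylinder_def case_nat_in_dual_space dual_shift_def less_Suc_eq_0_disj)
  then show "u \<in> dual_shift ` cylinder d w (Suc n)"
    by (metis dual_shift_case_nat imageI)
next
  fix u assume "u \<in> dual_shift ` cylinder d w (Suc n)"
  then obtain v where "v \<in> dual_space d" "\<forall>k<Suc n. v k = w k" "u = dual_shift v"
    by (auto simp: cylinder_def)
  then show "u \<in> cylinder d (dual_shift w) n"
    by (auto simp: cylinder_def dual_shift_in_dual_space) (auto simp: dual_shift_def)
qed

lemma dual_shift_vimage_cylinder:
  "dual_shift -` cylinder d w n \<inter> dual_space d = (\<Union>j<d. cylinder d (case_nat j w) (Suc n))"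
proof (intro equalityI subsetI)
  fix u assume "u \<in> dual_shift -` cylinder d w n \<inter> dual_space d"
  then have "u 0 < d" "u \<in> cylinder d (case_nat (u 0) w) (Suc n)"
    by (auto simp: cylinder_def dual_space_def dual_shift_def less_Suc_eq_0_disj)
  then show "u \<in> (\<Union>j<d. cylinder d (case_nat j w) (Suc n))" by blast
next
  fix u assume "u \<in> (\<Union>j<d. cylinder d (case_nat j w) (Suc n))"
  then obtain j where "u \<in> dual_space d" "\<forall>k<Suc n. u k = case_nat j w k"
    by (auto simp: cylinder_def)
  then show "u \<in> dual_shift -` cylinder d w n \<inter> dual_space d"
    by (auto simp: cylinder_def dual_shift_in_dual_space) (auto simp: dual_shift_def)
qed

lemma cylinder_children:
  "cylinder d w n = (\<Union>j<d. cylinder d (w(n := j)) (Suc n))"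
  by (auto simp: cylinder_def dual_space_def less_Suc_eq)

lemma disjoint_cylinders_shift: "disjoint_family_on (\<lambda>j. cylinder d (case_nat j w) (Suc n)) J"
proof -
  have "u 0 = j" if "u \<in> cylinder d (case_nat j w) (Suc n)" for u j
    using that by (auto simp: cylinder_def)
  then show ?thesis unfolding disjoint_family_on_def by blast
qed

lemma disjoint_cylinders_children: "disjoint_family_on (\<lambda>j. cylinder d (w(n := j)) (Suc n)) J"
proof -
  have "u n = j" if "u \<in> cylinder d (w(n := j)) (Suc n)" for u j
    using that by (auto simp: cylinder_def)
  then show ?thesis unfolding disjoint_family_on_def by blast
qed

lemma openin_cylinder: "openin (top_of_set (dual_space d)) (cylinder d w n)"
proof -
  have "open {u::nat \<Rightarrow> nat. \<forall>k\<in>{..<n}. u k = w k}"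
  proof -
    have "open ((\<lambda>u::nat \<Rightarrow> nat. u k) -` {w k})" for k
      by (rule open_vimage[OF _ continuous_on_product_coordinates]) (rule Topological_Spaces.open_discrete)
    then have "open {u::nat \<Rightarrow> nat. u k = w k}" for k by (simp add: vimage_def)
    moreover have "{u::nat \<Rightarrow> nat. \<forall>k\<in>{..<n}. u k = w k} = (\<Inter>k\<in>{..<n}. {u. u k = w k})" by auto
    ultimately show ?thesis by (simp add: open_INT)
  qed
  moreover have "cylinder d w n = dual_space d \<inter> {u. \<forall>k\<in>{..<n}. u k = w k}"
    by (auto simp: cylinder_def)
  ultimately show ?thesis by (simp only: openin_open_Int)
qed

text \<open>
  If the ratio exceeded some \<open>c > 1\<close> on one cylinder, it would do so on a nested sequence of
  cylinders, hence in the limit at their common point.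
\<close>

lemma cylinder_function_le:
  fixes \<alpha> \<beta> :: "(nat \<Rightarrow> nat) \<Rightarrow> nat \<Rightarrow> real"
  assumes add: "\<And>w n. w \<in> dual_space d \<Longrightarrow> \<alpha> w n = (\<Sum>j<d. \<alpha> (w(n := j)) (Suc n))"
      "\<And>w n. w \<in> dual_space d \<Longrightarrow> \<beta> w n = (\<Sum>j<d. \<beta> (w(n := j)) (Suc n))"
    and local: "\<And>u w n. \<forall>k<n. u k = w k \<Longrightarrow> \<alpha> u n = \<alpha> w n" "\<And>u w n. \<forall>k<n. u k = w k \<Longrightarrow> \<beta> u n = \<beta> w n"
    and pos: "\<And>w n. w \<in> dual_space d \<Longrightarrow> 0 < \<beta> w n"
    and lim: "\<And>w. w \<in> dual_space d \<Longrightarrow> (\<lambda>n. \<alpha> w n / \<beta> w n) \<longlonglongrightarrow> 1"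
    and w: "w \<in> dual_space d"
  shows "\<alpha> w n \<le> \<beta> w n"
proof (rule ccontr)
  assume "\<not> \<alpha> w n \<le> \<beta> w n"
  then have "1 < \<alpha> w n / \<beta> w n" using pos[OF w] by simp
  then obtain c where c: "1 < c" "c < \<alpha> w n / \<beta> w n" using dense by blast
  define P where "P i u \<longleftrightarrow> u \<in> dual_space d \<and> c * \<beta> u (n + i) < \<alpha> u (n + i)" for i u
  have step: "\<exists>v. P (Suc i) v \<and> (\<exists>j. v = u(n + i := j))" if "P i u" for i u
  proof (rule ccontr)
    assume none: "\<nexists>v. P (Suc i) v \<and> (\<exists>j. v = u(n + i := j))"
    have u: "u \<in> dual_space d" using that by (simp add: P_def)
    have "\<alpha> (u(n + i := j)) (Suc (n + i)) \<le> c * \<beta> (u(n + i := j)) (Suc (n + i))" if "j < d" for j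
    proof -
      have "u(n + i := j) \<in> dual_space d" using u that by (auto simp: dual_space_def)
      then show ?thesis using none by (auto simp: P_def not_less)
    qed
    then have "(\<Sum>j<d. \<alpha> (u(n + i := j)) (Suc (n + i))) \<le> (\<Sum>j<d. c * \<beta> (u(n + i := j)) (Suc (n + i)))"
      by (intro sum_mono) auto
    then have "\<alpha> u (n + i) \<le> c * \<beta> u (n + i)"
      by (simp add: add[OF u, of "n + i"] sum_distrib_left)
    then show False using that by (simp add: P_def)
  qed
  have "P 0 w" using c pos[OF w] w by (simp add: P_def field_simps)
  then obtain f where f0: "\<And>i. P i (f i)" and f1: "\<And>i. \<exists>j. f (Suc i) = (f i)(n + i := j)"
    using dependent_nat_choice[of P "\<lambda>i u v. \<exists>j. v = u(n + i := j)"] step by blast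
  have stable: "f (i + m) k = f i k" if "k < n + i" for i m k
  proof (induction m)
    case (Suc m)
    obtain j where "f (Suc (i + m)) = (f (i + m))(n + (i + m) := j)" using f1 by blast
    then show ?case using Suc that by simp
  qed simp
  \<comment> \<open>By stage \<open>Suc k\<close> the coordinate \<open>k\<close> is final, since
    step \<open>i\<close> alters only the coordinate \<open>n + i\<close>.\<close>
  define v where "v k = f (Suc k) k" for k
  have v: "v k = f i k" if "k < n + i" for i k
    unfolding v_def using stable[of k i "Suc k - i"] stable[of k "Suc k" "i - Suc k"] that
    by (cases "i \<le> Suc k") auto
  have vd: "v \<in> dual_space d"
    using f0 by (auto simp: v_def P_def dual_space_def)
  have "c \<le> \<alpha> v (n + i) / \<beta> v (n + i)" for i
  proof -
    have "\<forall>k<n + i. v k = f i k" using v by blast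
    then have "\<alpha> v (n + i) = \<alpha> (f i) (n + i)" "\<beta> v (n + i) = \<beta> (f i) (n + i)"
      using local by blast+
    then show ?thesis using f0[of i] pos[OF vd, of "n + i"] by (simp add: P_def field_simps)
  qed
  then have "\<exists>N. \<forall>m\<ge>N. c \<le> \<alpha> v m / \<beta> v m"
    by (metis le_Suc_ex)
  then have "c \<le> 1" by (rule LIMSEQ_le_const[OF lim[OF vd]])
  then show False using c by simp
qed

section \<open>From cylinders to all measurable sets\<close>

context seq_measure
begin

lemma cylinder_eq_prefix: "cylinder d w n = prefix n -` {prefix n w} \<inter> space M"
  by (auto simp: cylinder_def space_M prefix_eq_iff)

lemma cylinder_sets [measurable]: "cylinder d w n \<in> sets M"
  unfolding cylinder_eq_prefix by (rule measurable_sets[OF measurable_prefix]) simp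

lemma measure_cylinder_children:
  "measure M (cylinder d w n) = (\<Sum>j<d. measure M (cylinder d (w(n := j)) (Suc n)))"
  unfolding cylinder_children[of d w n]
  by (intro finite_measure_finite_Union disjoint_cylinders_children) auto

lemma prefix_sets: "prefix k -` S \<inter> space M \<in> sets M"
  by (rule measurable_sets[OF measurable_prefix]) simp

lemma measurable_dual_shift: "dual_shift \<in> M \<rightarrow>\<^sub>M M"
proof -
  have "dual_shift \<in> M \<rightarrow>\<^sub>M restrict_space borel (dual_space d)"
  proof (rule measurable_restrict_space2)
    show "dual_shift \<in> space M \<rightarrow> dual_space d" by (auto simp: space_M dual_shift_in_dual_space)
    show "dual_shift \<in> M \<rightarrow>\<^sub>M borel"
    proof (rule measurable_sigma_sets[OF sets_borel_sequences])
      fix A assume "A \<in> {{w :: nat \<Rightarrow> nat. w i \<in> A} | i A. True}"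
      then obtain i B where A: "A = {w. w i \<in> B}" by blast
      have "dual_shift -` A \<inter> space M = prefix (Suc (Suc i)) -` {l. l ! Suc i \<in> B} \<inter> space M"
        by (auto simp: A dual_shift_def)
      then show "dual_shift -` A \<inter> space M \<in> sets M" using prefix_sets by (simp only:)
    qed auto
  qed
  then show ?thesis using measurable_cong_sets[OF refl sets_M] by blast
qed

lemma sets_eq_sigma_prefix:
  "sets M = sigma_sets (space M) {prefix k -` S \<inter> space M | k S. True}" (is "_ = sigma_sets _ ?E")
proof
  have "B \<inter> space M \<in> sigma_sets (space M) ?E"
    if "B \<in> sigma_sets UNIV {{w :: nat \<Rightarrow> nat. w i \<in> A} | i A. True}" for B
    using that
  proof induction
    case (Basic a)
    then obtain i A where "a = {w. w i \<in> A}" by blast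
    then have "a \<inter> space M = prefix (Suc i) -` {l. l ! i \<in> A} \<inter> space M" by auto
    then show ?case by (intro sigma_sets.Basic) blast
  next
    case (Compl a)
    have "(UNIV - a) \<inter> space M = space M - a \<inter> space M" by auto
    then show ?case using sigma_sets.Compl[OF Compl.IH] by simp
  next
    case (Union a)
    then show ?case using sigma_sets.Union[of "\<lambda>i. a i \<inter> space M"] by simp
  qed (simp add: sigma_sets.Empty)
  then show "sets M \<subseteq> sigma_sets (space M) ?E"
    unfolding sets_borel_sequences[symmetric]
    by (auto simp: sets_M sets_restrict_space space_M Int_commute)
  show "sigma_sets (space M) ?E \<subseteq> sets M"
    by (intro sets.sigma_sets_subset) (use prefix_sets in blast)
qed

text \<open>Finite-prefix sets are finite disjoint unions of cylinders, are closed under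
  intersection and generate the sigma-algebra, so equality on cylinders extends by the pi-lambda
  theorem.\<close>

lemma shift_preservingI:
  assumes cyl: "\<And>w n. w \<in> dual_space d \<Longrightarrow>
      measure M (dual_shift -` cylinder d w n \<inter> space M) = measure M (cylinder d w n)"
  shows "shift_preserving M d"
proof unfold_locales
  show T: "dual_shift \<in> M \<rightarrow>\<^sub>M M" by (rule measurable_dual_shift)
  let ?E = "{prefix k -` S \<inter> space M | k S. True}"
  have E: "measure M (dual_shift -` (prefix k -` S \<inter> space M) \<inter> space M) = measure M (prefix k -` S \<inter> space M)"
    for k S
  proof -
    define L where "L = S \<inter> prefix k ` space M"
    have fin: "finite L" using simple_functionD(1)[OF simple_function_prefix] by (simp add: L_def)
    have eq: "prefix k -` S \<inter> space M = (\<Union>l\<in>L. prefix k -` {l} \<inter> space M)" by (auto simp: L_def)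
    have l: "measure M (dual_shift -` (prefix k -` {l} \<inter> space M) \<inter> space M) = measure M (prefix k -` {l} \<inter> space M)"
      if "l \<in> L" for l
      using that cyl by (auto simp: L_def space_M cylinder_eq_prefix)
    have "measure M (dual_shift -` (prefix k -` S \<inter> space M) \<inter> space M) =
        measure M (\<Union>l\<in>L. dual_shift -` (prefix k -` {l} \<inter> space M) \<inter> space M)"
      unfolding eq by (rule arg_cong[where f = "measure M"]) blast
    also have "\<dots> = (\<Sum>l\<in>L. measure M (dual_shift -` (prefix k -` {l} \<inter> space M) \<inter> space M))"
      using fin measurable_sets[OF T prefix_sets]
      by (intro finite_measure_finite_Union) (auto simp: disjoint_family_on_def)
    also have "\<dots> = (\<Sum>l\<in>L. measure M (prefix k -` {l} \<inter> space M))" using l by simp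
    also have "\<dots> = measure M (\<Union>l\<in>L. prefix k -` {l} \<inter> space M)"
      using fin prefix_sets
      by (intro finite_measure_finite_Union[symmetric]) (auto simp: disjoint_family_on_def)
    finally show ?thesis by (simp only: eq)
  qed
  have "distr M M dual_shift = M"
  proof (rule measure_eqI_generator_eq[of ?E "space M"])
    show "Int_stable ?E"
    proof (rule Int_stableI)
      fix a b assume "a \<in> ?E" "b \<in> ?E"
      then obtain k S m R where ab: "a = prefix k -` S \<inter> space M" "b = prefix m -` R \<inter> space M" by blast
      have "a \<inter> b = prefix (max k m) -` {l. take k l \<in> S \<and> take m l \<in> R} \<inter> space M"
        by (auto simp: ab take_prefix)
      then show "a \<inter> b \<in> ?E" by blast
    qed
    show "emeasure (distr M M dual_shift) X = emeasure M X" if X_in: "X \<in> ?E" for X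
    proof -
      obtain k S where X: "X = prefix k -` S \<inter> space M" using X_in by blast
      show ?thesis unfolding X emeasure_distr[OF T prefix_sets] emeasure_eq_measure E ..
    qed
    show "range (\<lambda>_. space M) \<subseteq> ?E"
    proof -
      have "space M = prefix 0 -` UNIV \<inter> space M" by simp
      then show ?thesis by blast
    qed
    show "emeasure (distr M M dual_shift) (space M) \<noteq> \<infinity>"
      by (simp add: emeasure_distr[OF T] emeasure_eq_measure)
    show "sets M = sigma_sets (space M) ?E" by (rule sets_eq_sigma_prefix)
    then show "sets (distr M M dual_shift) = sigma_sets (space M) ?E" by (simp only: sets_distr)
  qed auto
  then show "measure M (dual_shift -` A \<inter> space M) = measure M A" if "A \<in> sets M" for A
    using measure_distr[OF T that] by simp
qed

end

lemma dual_gibbs_seq_measure: "dual_gibbs d \<Psi> \<mu> \<Longrightarrow> seq_measure \<mu> d"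
  by (simp add: dual_gibbs_def seq_measure_def seq_measure_axioms_def)

text \<open>Full support is used here: a cylinder is an open neighbourhood of each of its
  points.\<close>

lemma dual_gibbs_cylinder_pos:
  assumes "dual_gibbs d \<Psi> \<mu>" "w \<in> dual_space d"
  shows "0 < measure \<mu> (cylinder d w n)"
proof -
  interpret seq_measure \<mu> d using assms(1) by (rule dual_gibbs_seq_measure)
  have "w \<in> measure_support \<mu>" using assms by (simp add: dual_gibbs_def)
  then have "0 < emeasure \<mu> (cylinder d w n)"
    using openin_cylinder[of d w n] assms(2)
    by (auto simp: measure_support_def space_M cylinder_def)
  then show ?thesis by (simp add: emeasure_eq_measure)
qed

lemma dual_gibbs_shift_preserving:
  assumes f: "uniformly_symmetric d f" and \<mu>: "dual_gibbs d (dual_derivative d f) \<mu>"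
  shows "shift_preserving \<mu> d"
proof -
  interpret seq_measure \<mu> d using \<mu> by (rule dual_gibbs_seq_measure)
  obtain F \<epsilon> where F: "circle_lift d f = F" and sym: "symmetric_lift_inverse d (inv F) \<epsilon>"
    using symmetric_lift_inverse_of_uniformly_symmetric[OF f] .
  interpret symmetric_lift_inverse d "inv F" \<epsilon> by (rule sym)
  define \<alpha> where "\<alpha> w n = (\<Sum>j<d. measure \<mu> (cylinder d (case_nat j w) (Suc n)))" for w n
  define \<beta> where "\<beta> w n = measure \<mu> (cylinder d w n)" for w n
  note pos = dual_gibbs_cylinder_pos[OF \<mu>]
  have vimage: "measure \<mu> (dual_shift -` cylinder d w n \<inter> space \<mu>) = \<alpha> w n" for w n
    unfolding \<alpha>_def space_M dual_shift_vimage_cylinder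
    by (intro finite_measure_finite_Union disjoint_cylinders_shift) auto
  have \<beta>_pos: "0 < \<beta> w n" if "w \<in> dual_space d" for w n
    unfolding \<beta>_def using pos[OF that] .
  have \<alpha>_pos: "0 < \<alpha> w n" if "w \<in> dual_space d" for w n
    unfolding \<alpha>_def using d that by (intro sum_pos pos case_nat_in_dual_space) (auto simp: lessThan_empty_iff)
  have add_\<beta>: "\<beta> w n = (\<Sum>j<d. \<beta> (w(n := j)) (Suc n))" for w n
    unfolding \<beta>_def by (rule measure_cylinder_children)
  have add_\<alpha>: "\<alpha> w n = (\<Sum>j<d. \<alpha> (w(n := j)) (Suc n))" for w n
  proof -
    have "(case_nat i w)(Suc n := j) = case_nat i (w(n := j))" for i j
      by (auto split: nat.split)
    then show ?thesis
      unfolding \<alpha>_def using measure_cylinder_children[of "case_nat _ w" "Suc n"]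
      by (subst sum.swap) simp
  qed
  have cyl_cong: "cylinder d u n = cylinder d w n" if "\<forall>k<n. u k = w k" for u w n
    using that by (auto simp: cylinder_def)
  have local: "\<alpha> u n = \<alpha> w n" "\<beta> u n = \<beta> w n" if "\<forall>k<n. u k = w k" for u w n
  proof -
    have "cylinder d (case_nat j u) (Suc n) = cylinder d (case_nat j w) (Suc n)" for j
      using that by (intro cyl_cong) (auto split: nat.split)
    then show "\<alpha> u n = \<alpha> w n" by (simp add: \<alpha>_def)
    show "\<beta> u n = \<beta> w n" using cyl_cong[OF that] by (simp add: \<beta>_def)
  qed
  have lim: "(\<lambda>n. \<alpha> w n / \<beta> w n) \<longlonglongrightarrow> 1" if w: "w \<in> dual_space d" for w
  proof -
    \<comment> \<open>The Gibbs condition at the preimage \<open>case_nat j w\<close>, inverted and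
      read at length \<open>Suc n\<close>: the shift maps that cylinder onto the one of length
      \<open>n\<close> around \<open>w\<close>.\<close>
    have "(\<lambda>n. measure \<mu> (cylinder d (case_nat j w) (Suc n)) / measure \<mu> (cylinder d w n))
        \<longlonglongrightarrow> lim (child_ratio (case_nat j w))" if j: "j < d" for j
    proof -
      note jw = case_nat_in_dual_space[OF j w]
      have "(\<lambda>n. measure \<mu> (dual_shift ` right_cylinder d (right_word (case_nat j w) n)) /
          measure \<mu> (right_cylinder d (right_word (case_nat j w) n))) \<longlonglongrightarrow> dual_derivative d f (case_nat j w)"
        using \<mu> jw by (simp add: dual_gibbs_def)
      from LIMSEQ_Suc[OF this]
      have "(\<lambda>n. measure \<mu> (cylinder d w n) / measure \<mu> (cylinder d (case_nat j w) (Suc n)))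
          \<longlonglongrightarrow> inverse (lim (child_ratio (case_nat j w)))"
        unfolding right_cylinder_right_word dual_shift_image_cylinder[OF jw] dual_shift_case_nat
          dual_derivative_limit(2)[OF F refl jw] .
      from tendsto_inverse[OF this] show ?thesis
        using lim_child_ratio_pos[OF jw] by simp
    qed
    then have "(\<lambda>n. \<Sum>j<d. measure \<mu> (cylinder d (case_nat j w) (Suc n)) / measure \<mu> (cylinder d w n))
        \<longlonglongrightarrow> (\<Sum>j<d. lim (child_ratio (case_nat j w)))"
      by (intro tendsto_sum) auto
    then show ?thesis
      by (simp add: \<alpha>_def \<beta>_def sum_divide_distrib sum_lim_child_ratio[OF w])
  qed
  have lim': "(\<lambda>n. \<beta> w n / \<alpha> w n) \<longlonglongrightarrow> 1" if "w \<in> dual_space d" for w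
    using tendsto_inverse[OF lim[OF that]] by simp
  have "\<alpha> w n = \<beta> w n" if w: "w \<in> dual_space d" for w n
    using cylinder_function_le[OF add_\<alpha> add_\<beta> local \<beta>_pos lim w, of n]
      cylinder_function_le[OF add_\<beta> add_\<alpha> local(2,1) \<alpha>_pos lim' w, of n] by force
  then show ?thesis using vimage by (intro shift_preservingI) (simp add: \<beta>_def)
qed

lemma gibbs_entropies_bounds:
  assumes "h \<in> gibbs_entropies d"
  shows "0 \<le> h" "h \<le> ereal (ln d)"
proof -
  obtain f \<mu> where f: "uniformly_symmetric d f" "dual_gibbs d (dual_derivative d f) \<mu>"
    and h: "h = metric_entropy \<mu> dual_shift"
    using assms by (auto simp: gibbs_entropies_def TUS_def)
  interpret shift_preserving \<mu> d by (rule dual_gibbs_shift_preserving[OF f])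
  show "0 \<le> h" unfolding h by (rule metric_entropy_nonneg)
  show "h \<le> ereal (ln d)"
    unfolding h using metric_entropy_le coordinate_entropy_le by (metis ereal_less_eq(3) order_trans)
qed

section \<open>Circle endomorphisms from inverse lifts\<close>

lemma cis_Arg_unit_circle: "z \<in> unit_circle \<Longrightarrow> cis (2 * pi * (Arg z / (2 * pi))) = z"
proof -
  assume "z \<in> unit_circle"
  then have "norm z = 1" by simp
  then have "z \<noteq> 0" "sgn z = z" by (auto simp: sgn_div_norm)
  then show ?thesis using cis_Arg[of z] by simp
qed

text \<open>The circle without the point opposite to \<open>cis (2 * pi * a)\<close>. There the
  argument relative to that centre is continuous, which makes \<open>arc_coordinate a\<close> a
  chart.\<close>

definition open_arc :: "real \<Rightarrow> complex set" where
  "open_arc a = {z \<in> unit_circle. z / cis (2 * pi * a) \<notin> \<real>\<^sub>\<le>\<^sub>0}"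

definition arc_coordinate :: "real \<Rightarrow> complex \<Rightarrow> real" where
  "arc_coordinate a z = a + Arg (z / cis (2 * pi * a)) / (2 * pi)"

lemma openin_arc: "openin (top_of_set unit_circle) (open_arc a)"
proof -
  have "continuous_on UNIV (\<lambda>z. z / cis (2 * pi * a))" by (intro continuous_intros) auto
  then have "open ((\<lambda>z. z / cis (2 * pi * a)) -` (- \<real>\<^sub>\<le>\<^sub>0))"
    by (intro open_vimage) (auto intro: closed_nonpos_Reals_complex)
  moreover have "open_arc a = unit_circle \<inter> (\<lambda>z. z / cis (2 * pi * a)) -` (- \<real>\<^sub>\<le>\<^sub>0)"
    by (auto simp: open_arc_def)
  ultimately show ?thesis by (simp only: openin_open_Int)
qed

lemma homeomorphism_arc:
  "homeomorphism {a - 1/2<..<a + 1/2} (open_arc a) (\<lambda>t. cis (2 * pi * t)) (arc_coordinate a)"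
proof
  have div: "cis (2 * pi * t) / cis (2 * pi * a) = cis (2 * pi * (t - a))" for t
    by (simp add: cis_divide right_diff_distrib)
  have range: "2 * pi * (t - a) \<in> {- pi<..<pi}" if "t \<in> {a - 1/2<..<a + 1/2}" for t
  proof -
    have "- 1 < 2 * (t - a)" "2 * (t - a) < 1" using that by auto
    then have "pi * (- 1) < pi * (2 * (t - a))" "pi * (2 * (t - a)) < pi * 1"
      by (intro mult_strict_left_mono; simp)+
    then show ?thesis by (simp add: mult_ac)
  qed
  then have Arg: "Arg (cis (2 * pi * (t - a))) = 2 * pi * (t - a)" if "t \<in> {a - 1/2<..<a + 1/2}" for t
    using that by (intro Arg_cis) fastforce
  show "continuous_on {a - 1/2<..<a + 1/2} (\<lambda>t. cis (2 * pi * t))"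
    by (intro continuous_intros)
  show "continuous_on (open_arc a) (arc_coordinate a)"
    unfolding arc_coordinate_def
    by (intro continuous_intros) (auto simp: open_arc_def)
  show "(\<lambda>t. cis (2 * pi * t)) ` {a - 1/2<..<a + 1/2} \<subseteq> open_arc a"
  proof
    fix z assume "z \<in> (\<lambda>t. cis (2 * pi * t)) ` {a - 1/2<..<a + 1/2}"
    then obtain t where t: "t \<in> {a - 1/2<..<a + 1/2}" "z = cis (2 * pi * t)" by blast
    have "cis (2 * pi * (t - a)) \<notin> \<real>\<^sub>\<le>\<^sub>0"
    proof
      assume *: "cis (2 * pi * (t - a)) \<in> \<real>\<^sub>\<le>\<^sub>0"
      then obtain r where "cis (2 * pi * (t - a)) = complex_of_real r" "r \<le> 0"
        by (auto simp: nonpos_Reals_def)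
      moreover have "norm (cis (2 * pi * (t - a))) = 1" by simp
      ultimately have "cis (2 * pi * (t - a)) = -1" by (auto simp: norm_of_real)
      then have "Arg (cis (2 * pi * (t - a))) = pi" using Arg_cis[of pi] by simp
      then show False using Arg[OF t(1)] range[OF t(1)] by simp
    qed
    then show "z \<in> open_arc a" by (simp add: open_arc_def t div)
  qed
  have coord: "cis (2 * pi * arc_coordinate a z) = z \<and> arc_coordinate a z \<in> {a - 1/2<..<a + 1/2}"
    if z: "z \<in> open_arc a" for z
  proof
    let ?u = "z / cis (2 * pi * a)"
    have u: "norm ?u = 1" "?u \<notin> \<real>\<^sub>\<le>\<^sub>0" using z by (auto simp: open_arc_def norm_divide)
    have "2 * pi * arc_coordinate a z = 2 * pi * a + Arg ?u"
      by (simp add: arc_coordinate_def field_simps)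
    moreover have "cis (Arg ?u) = ?u" using cis_Arg_unit_circle[of ?u] u by simp
    ultimately have "cis (2 * pi * arc_coordinate a z) = cis (2 * pi * a) * ?u"
      by (simp flip: cis_mult)
    then show "cis (2 * pi * arc_coordinate a z) = z" by simp
    have "Arg ?u \<noteq> pi"
    proof
      assume "Arg ?u = pi"
      then have "?u = -1" using \<open>cis (Arg ?u) = ?u\<close> by simp
      then show False using u(2) by simp
    qed
    then have "- pi < Arg ?u" "Arg ?u < pi" using mpi_less_Arg[of ?u] Arg_le_pi[of ?u] by auto
    then have "- 1/2 < Arg ?u / (2 * pi)" "Arg ?u / (2 * pi) < 1/2" by (auto simp: field_simps)
    then show "arc_coordinate a z \<in> {a - 1/2<..<a + 1/2}" by (simp add: arc_coordinate_def)
  qed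
  show "arc_coordinate a ` open_arc a \<subseteq> {a - 1/2<..<a + 1/2}" using coord by blast
  show "cis (2 * pi * arc_coordinate a z) = z" if "z \<in> open_arc a" for z using coord[OF that] by blast
  show "arc_coordinate a (cis (2 * pi * t)) = t" if "t \<in> {a - 1/2<..<a + 1/2}" for t
    by (simp add: arc_coordinate_def div Arg[OF that])
qed

lemma openin_image_interval:
  assumes "b - a \<le> 1"
  shows "openin (top_of_set unit_circle) ((\<lambda>t. cis (2 * pi * t)) ` {a<..<b})"
proof -
  define c where "c = (a + b) / 2"
  have "{a<..<b} \<subseteq> {c - 1/2<..<c + 1/2}" using assms by (auto simp: c_def field_simps)
  then have "openin (top_of_set {c - 1/2<..<c + 1/2}) {a<..<b}"
    by (intro open_subset) auto
  from homeomorphism_imp_open_map[OF homeomorphism_arc this] openin_arc show ?thesis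
    by (rule openin_trans)
qed

section \<open>The covering map determined by an inverse lift\<close>

context lift_inverse
begin

lemma surj_G: "surj G"
proof (unfold surj_def, rule allI)
  fix y :: real
  obtain q :: nat where q: "\<bar>y\<bar> < q" using reals_Archimedean2[of "\<bar>y\<bar>"] by blast
  have "G (real d * q) = q" using shift_nat[of 0 q] by (simp add: zero)
  moreover have "G (- (real d * q)) = - real q" using shift_nat[of "- (real d * q)" q] by (simp add: zero)
  ultimately have "\<exists>x. - (real d * q) \<le> x \<and> x \<le> real d * q \<and> G x = y"
    using q by (intro IVT' continuous_on_subset[OF cont]) auto
  then show "\<exists>x. y = G x" by blast
qed

lemma bij_G: "bij G"
  unfolding bij_def using surj_G strict_mono_imp_inj_on[OF mono] by (rule conjI[rotated])

definition lift :: "real \<Rightarrow> real" where "lift = inv G"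

definition endomorphism :: "complex \<Rightarrow> complex" where
  "endomorphism z = cis (2 * pi * lift (Arg z / (2 * pi)))"

lemma lift_G [simp]: "lift (G x) = x"
  unfolding lift_def by (rule inv_f_f[OF bij_is_inj[OF bij_G]])

lemma G_lift [simp]: "G (lift x) = x"
  unfolding lift_def by (rule surj_f_inv_f[OF surj_G])

lemma inv_lift: "inv lift = G"
  unfolding lift_def by (rule inv_inv_eq[OF bij_G])

lemma strict_mono_lift: "strict_mono lift"
proof (rule strict_monoI)
  fix x y :: real assume "x < y"
  then have "G (lift x) < G (lift y)" by simp
  then show "lift x < lift y" unfolding strict_mono_less[OF mono] .
qed

lemma continuous_on_lift: "continuous_on UNIV lift"
proof (rule continuous_onI_mono)
  have "range lift = UNIV" by (rule surjI[of lift G]) simp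
  then show "open (range lift)" by simp
qed (simp add: strict_mono_less_eq[OF strict_mono_lift])

lemma shift_int: "G (x + real d * of_int k) = G x + of_int k"
proof (cases "0 \<le> k")
  case True
  then show ?thesis using shift_nat[of x "nat k"] by simp
next
  case False
  then show ?thesis using shift_nat[of "x + real d * of_int k" "nat (- k)"] by (simp add: algebra_simps)
qed

lemma lift_shift_int: "lift (x + of_int k) = lift x + real d * of_int k"
  using lift_G[of "lift x + real d * of_int k"] unfolding shift_int G_lift .

text \<open>Replacing the argument by another one changes it by an integer \<open>k\<close> and its
  lift by \<open>d * k\<close>, which \<open>cis\<close> does not see.\<close>

lemma endomorphism_cis: "endomorphism (cis (2 * pi * x)) = cis (2 * pi * lift x)"
proof -
  have "cis (2 * pi * (Arg (cis (2 * pi * x)) / (2 * pi))) = cis (2 * pi * x)"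
    by (rule cis_Arg_unit_circle) simp
  then obtain k :: int where "Arg (cis (2 * pi * x)) / (2 * pi) = x + k"
    by (auto simp only: cis_2pi_eq_iff)
  then have "endomorphism (cis (2 * pi * x)) = cis (2 * pi * (lift x + real_of_int (int d * k)))"
    by (simp add: endomorphism_def lift_shift_int)
  also have "\<dots> = cis (2 * pi * lift x)" unfolding cis_2pi_eq_iff by blast
  finally show ?thesis .
qed

lemma is_circle_lift_lift: "is_circle_lift d endomorphism lift"
  unfolding is_circle_lift_def inv_lift
proof (intro conjI allI)
  show "homeomorphism UNIV UNIV lift G"
    by (rule homeomorphismI) (auto simp: cont continuous_on_lift)
  show "lift 0 = 0" using lift_G[of 0] by (simp add: zero)
  show "lift (x + 1) = lift x + real d" for x using lift_shift_int[of x 1] by simp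
qed (auto simp: strict_mono_lift endomorphism_cis)

lemma endomorphism_arc: "z \<in> open_arc a \<Longrightarrow> endomorphism z = cis (2 * pi * lift (arc_coordinate a z))"
  using endomorphism_cis[of "arc_coordinate a z"] homeomorphism_apply2[OF homeomorphism_arc] by simp

lemma in_arc: "x \<in> unit_circle \<Longrightarrow> x \<in> open_arc (Arg x / (2 * pi))"
proof -
  let ?a = "Arg x / (2 * pi)"
  assume x: "x \<in> unit_circle"
  have "cis (2 * pi * ?a) \<in> (\<lambda>t. cis (2 * pi * t)) ` {?a - 1/2<..<?a + 1/2}"
    by (rule imageI) simp
  then show "x \<in> open_arc ?a"
    unfolding homeomorphism_image1[OF homeomorphism_arc] cis_Arg_unit_circle[OF x] .
qed

text \<open>The formula with \<open>Arg\<close> jumps at -1, so continuity is checked near each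
  point in the chart centred at that point.\<close>

lemma continuous_on_endomorphism: "continuous_on unit_circle endomorphism"
proof (rule continuous_on_eq_continuous_within[THEN iffD2], rule ballI)
  fix x assume x: "x \<in> unit_circle"
  define a where "a = Arg x / (2 * pi)"
  have "continuous_on (open_arc a) (\<lambda>z. cis (2 * pi * lift (arc_coordinate a z)))"
    using homeomorphism_cont2[OF homeomorphism_arc, of a]
    by (intro continuous_intros continuous_on_compose2[OF continuous_on_lift]) auto
  then have "continuous_on (open_arc a) endomorphism"
    by (rule continuous_on_eq) (simp add: endomorphism_arc)
  then have "continuous (at x within open_arc a) endomorphism"
    using in_arc[OF x] by (simp add: a_def continuous_on_eq_continuous_within)
  moreover have "at x within open_arc a = at x within unit_circle"
  proof -
    obtain T where T: "open T" "open_arc a = unit_circle \<inter> T" using openin_arc by (auto simp: openin_open)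
    then have "x \<in> T" using in_arc[OF x] by (auto simp: a_def)
    then show ?thesis using at_within_nhd[of x T "open_arc a" unit_circle] T by auto
  qed
  ultimately show "continuous (at x within unit_circle) endomorphism" by simp
qed

lemma G_step_le: "G (x + 1) - G x \<le> 1"
proof -
  have "G (x + 1) \<le> G (x + real d)" using d unfolding strict_mono_less_eq[OF mono] by simp
  then show ?thesis by (simp add: shift)
qed

text \<open>The arc around \<open>x\<close> is evenly covered by \<open>d\<close> sheets: the images
  under \<open>G\<close> of the translates by \<open>k < d\<close> of its coordinate interval. By
  \<open>G_step_le\<close> each is an interval of length at most 1, so its image in the circle is
  open.\<close>

lemma covering_space_endomorphism: "covering_space unit_circle endomorphism unit_circle"
proof
  let ?e = "\<lambda>t. cis (2 * pi * t)"
  have unit: "?e t \<in> unit_circle" for t by simp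
  show "continuous_on unit_circle endomorphism" by (rule continuous_on_endomorphism)
  have "endomorphism z \<in> unit_circle" for z by (simp add: endomorphism_def)
  moreover have "z \<in> endomorphism ` unit_circle" if "z \<in> unit_circle" for z
  proof -
    have "z = endomorphism (?e (G (Arg z / (2 * pi))))"
      by (simp only: endomorphism_cis lift_G cis_Arg_unit_circle[OF that])
    then show ?thesis using unit by blast
  qed
  ultimately show "endomorphism ` unit_circle = unit_circle" by blast
  fix x assume x: "x \<in> unit_circle"
  define a where "a = Arg x / (2 * pi)"
  let ?J = "{a - 1/2<..<a + 1/2}"
  define u where "u k = ?e ` {G (a - 1/2 + real k)<..<G (a + 1/2 + real k)}" for k
  have interval: "{G (a - 1/2 + real k)<..<G (a + 1/2 + real k)} = (\<lambda>y. G (y + real k)) ` ?J" for k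
  proof (intro equalityI subsetI)
    fix t assume t: "t \<in> {G (a - 1/2 + real k)<..<G (a + 1/2 + real k)}"
    then have "lift (G (a - 1/2 + real k)) < lift t" "lift t < lift (G (a + 1/2 + real k))"
      by (auto simp only: strict_mono_less[OF strict_mono_lift] greaterThanLessThan_iff)
    then have "lift t - k \<in> ?J" by auto
    moreover have "t = G ((lift t - k) + k)" by simp
    ultimately show "t \<in> (\<lambda>y. G (y + real k)) ` ?J" by blast
  qed (auto simp: strict_mono_less[OF mono])
  have u: "u k = (\<lambda>y. ?e (G (y + real k))) ` ?J" for k
    unfolding u_def interval by (simp add: image_image)
  note e1 = homeomorphism_image1[OF homeomorphism_arc, of a]
  have eJ: "?e y \<in> open_arc a" if "y \<in> ?J" for y using e1 that by blast
  have endo_u: "endomorphism (?e (G (y + real k))) = ?e y" for y k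
  proof -
    have "endomorphism (?e (G (y + real k))) = ?e (y + real_of_int (int k))"
      by (simp add: endomorphism_cis)
    also have "\<dots> = ?e y" unfolding cis_2pi_eq_iff by blast
    finally show ?thesis .
  qed
  have "\<Union> (u ` {..<d}) = unit_circle \<inter> endomorphism -` open_arc a"
  proof (intro equalityI subsetI)
    fix z assume "z \<in> \<Union> (u ` {..<d})"
    then obtain k y where "y \<in> ?J" "z = ?e (G (y + real k))" by (auto simp: u)
    then show "z \<in> unit_circle \<inter> endomorphism -` open_arc a" using eJ by (simp add: endo_u)
  next
    fix z assume z: "z \<in> unit_circle \<inter> endomorphism -` open_arc a"
    define t where "t = Arg z / (2 * pi)"
    have zt: "z = ?e t" using cis_Arg_unit_circle z by (simp add: t_def)
    have "?e (lift t) \<in> open_arc a" using z by (simp add: zt endomorphism_cis)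
    then have "?e (lift t) \<in> ?e ` ?J" unfolding e1 .
    then obtain y where y: "y \<in> ?J" "?e (lift t) = ?e y" by blast
    then obtain m :: int where m: "lift t = y + m" by (auto simp only: cis_2pi_eq_iff)
    \<comment> \<open>A translation by \<open>d\<close> before \<open>G\<close> is a translation by
      1 after it, so the sheet depends only on \<open>m\<close> modulo \<open>d\<close>.\<close>
    define k where "k = nat (m mod int d)"
    have k: "int k = m mod int d" "k < d" using d by (auto simp: k_def nat_less_iff)
    have "m = int k + int d * (m div int d)" using k by simp
    then have "real_of_int m = real k + real d * real_of_int (m div int d)"
      by (metis of_int_add of_int_mult of_int_of_nat_eq)
    then have "t = G ((y + real k) + real d * real_of_int (m div int d))"
      using m by (metis add.assoc lift_G G_lift)
    then have "t = G (y + real k) + real_of_int (m div int d)" by (simp only: shift_int)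
    then have "z = ?e (G (y + real k))" unfolding zt cis_2pi_eq_iff by blast
    then have "z \<in> u k" unfolding u using y(1) by blast
    then show "z \<in> \<Union> (u ` {..<d})" using k(2) by blast
  qed
  moreover have "openin (top_of_set unit_circle) (u k)" for k
    unfolding u_def using G_step_le[of "a - 1/2 + real k"] by (intro openin_image_interval) (simp add: algebra_simps)
  moreover have "pairwise disjnt (u ` {..<d})"
  proof -
    have "k = l" if kl: "k < d" "l < d" and z: "z \<in> u k" "z \<in> u l" for k l z
    proof -
      obtain y y' where y: "y \<in> ?J" "y' \<in> ?J" "z = ?e (G (y + real k))" "z = ?e (G (y' + real l))"
        using z by (auto simp: u)
      then obtain m :: int where "G (y + real k) = G (y' + real l) + m" by (metis cis_2pi_eq_iff)
      then have "G (y + real k) = G (y' + real l + real d * m)" by (simp only: shift_int)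
      then have eq: "y + real k = y' + real l + real d * m" using lift_G by metis
      \<comment> \<open>Both coordinates lie in an open interval of length 1, so this integer, their
        difference, vanishes.\<close>
      have "\<bar>real_of_int (int l + int d * m - int k)\<bar> < 1" using y eq by auto
      then have "int l + int d * m - int k = 0" by linarith
      then have "int k mod int d = int l mod int d" by (metis add_diff_cancel_right' diff_eq_diff_eq diff_zero mod_mult_self2 add.commute eq_iff_diff_eq_0)
      then show "k = l" using kl by (simp flip: of_nat_mod)
    qed
    then show ?thesis by (auto simp: pairwise_def disjnt_iff)
  qed
  moreover have "\<exists>q. homeomorphism (u k) (open_arc a) endomorphism q" for k
  proof
    let ?q = "\<lambda>z. ?e (G (arc_coordinate a z + real k))"
    note h1 = homeomorphism_apply1[OF homeomorphism_arc, of _ a] and h2 = homeomorphism_apply2[OF homeomorphism_arc, of _ a]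
    have c: "arc_coordinate a z \<in> ?J" if "z \<in> open_arc a" for z
      using homeomorphism_image2[OF homeomorphism_arc, of a] that by blast
    show "homeomorphism (u k) (open_arc a) endomorphism ?q"
    proof
      have "u k \<subseteq> unit_circle" by (auto simp: u)
      then show "continuous_on (u k) endomorphism" by (rule continuous_on_subset[OF continuous_on_endomorphism])
      show "continuous_on (open_arc a) ?q"
        using homeomorphism_cont2[OF homeomorphism_arc, of a]
        by (intro continuous_intros continuous_on_compose2[OF cont]) auto
      show "endomorphism ` u k \<subseteq> open_arc a" using eJ by (auto simp: u endo_u)
      show "?q ` open_arc a \<subseteq> u k" using c by (auto simp: u)
      show "?q (endomorphism z) = z" if "z \<in> u k" for z
        using that h1 by (auto simp: u endo_u)
      show "endomorphism (?q z) = z" if "z \<in> open_arc a" for z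
        using h2[OF that] by (simp add: endo_u)
    qed
  qed
  moreover have "x \<in> open_arc a" using in_arc[OF x] by (simp add: a_def)
  moreover have "openin (top_of_set unit_circle) (open_arc a)" by (rule openin_arc)
  ultimately show "\<exists>T. x \<in> T \<and> openin (top_of_set unit_circle) T \<and>
      (\<exists>v. \<Union> v = unit_circle \<inter> endomorphism -` T \<and> (\<forall>u\<in>v. openin (top_of_set unit_circle) u) \<and>
        pairwise disjnt v \<and> (\<forall>u\<in>v. \<exists>q. homeomorphism u T endomorphism q))"
    by (intro exI[of _ "open_arc a"] conjI exI[of _ "u ` {..<d}"]) auto
qed

lemma circle_endomorphism_endomorphism: "circle_endomorphism d endomorphism"
  unfolding circle_endomorphism_def
proof (intro conjI exI)
  show "endomorphism 1 = 1" using endomorphism_cis[of 0] lift_G[of 0] by (simp add: zero)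
qed (rule d covering_space_endomorphism is_circle_lift_lift)+

lemma lift_inv_iter_endomorphism: "lift_inv_iter d endomorphism n = G ^^ n"
  by (simp add: lift_inv_iter_def circle_lift_eq[OF is_circle_lift_lift] inv_lift)

lemma uniformly_symmetric_endomorphism:
  assumes \<epsilon>: "\<And>t. 0 < t \<Longrightarrow> 0 < \<epsilon> t" "bounded (\<epsilon> ` {0<..})" "(\<epsilon> \<longlongrightarrow> 0) (at_right 0)"
    and le: "\<And>n x t. 0 < t \<Longrightarrow>
        (G ^^ n) (x + t) - (G ^^ n) x \<le> (1 + \<epsilon> t) * ((G ^^ n) x - (G ^^ n) (x - t))"
      "\<And>n x t. 0 < t \<Longrightarrow>
        (G ^^ n) x - (G ^^ n) (x - t) \<le> (1 + \<epsilon> t) * ((G ^^ n) (x + t) - (G ^^ n) x)"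
  shows "uniformly_symmetric d endomorphism"
  unfolding uniformly_symmetric_def lift_inv_iter_endomorphism Let_def
proof (intro conjI exI[of _ \<epsilon>] allI impI)
  fix x t :: real and n :: nat assume t: "0 < t"
  define A B where "A = (G ^^ n) (x + t) - (G ^^ n) x" and "B = (G ^^ n) x - (G ^^ n) (x - t)"
  have AB: "0 < A" "0 < B" using t by (auto simp: A_def B_def funpow_less_iff)
  have "A \<le> (1 + \<epsilon> t) * B" "B \<le> (1 + \<epsilon> t) * A" using le[OF t] by (auto simp: A_def B_def)
  then have "1 / (1 + \<epsilon> t) \<le> A / B" "A / B \<le> 1 + \<epsilon> t" using AB \<epsilon>(1)[OF t] by (auto simp: field_simps)
  then show "1 / (1 + \<epsilon> t) \<le> \<bar>(G ^^ n) (x + t) - (G ^^ n) x\<bar> / \<bar>(G ^^ n) x - (G ^^ n) (x - t)\<bar>"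
    "\<bar>(G ^^ n) (x + t) - (G ^^ n) x\<bar> / \<bar>(G ^^ n) x - (G ^^ n) (x - t)\<bar> \<le> 1 + \<epsilon> t"
    unfolding A_def[symmetric] B_def[symmetric] using AB by auto
qed (use \<epsilon> circle_endomorphism_endomorphism in auto)

end

section \<open>Bounded distortion\<close>

text \<open>The last assumption is the Lipschitz condition with constant \<open>L\<close> for
  \<open>ln\<close> of \<open>\<psi>\<close>, in the multiplicative form that suits products along
  an orbit.\<close>

locale expanding_lift_inverse = lift_inverse +
  fixes \<psi> :: "real \<Rightarrow> real" and rate L :: real
  assumes deriv: "\<And>x. (G has_real_derivative \<psi> x) (at x)"
    and \<psi>_pos: "\<And>x. 0 < \<psi> x" and \<psi>_le: "\<And>x. \<psi> x \<le> rate" and rate_less_1: "rate < 1" and L: "0 < L"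
    and \<psi>_ratio: "\<And>x y. \<psi> x \<le> \<psi> y * exp (L * \<bar>x - y\<bar>)"
begin

lemma rate_pos: "0 < rate"
  using \<psi>_pos[of 0] \<psi>_le[of 0] by linarith

lemma funpow_lipschitz: "\<bar>(G ^^ n) x - (G ^^ n) y\<bar> \<le> rate ^ n * \<bar>x - y\<bar>"
proof (induction n)
  case (Suc n)
  have lip: "\<bar>G u - G v\<bar> \<le> rate * \<bar>u - v\<bar>" for u v
  proof -
    have "norm (G u - G v) \<le> rate * norm (u - v)"
    proof (rule field_differentiable_bound[OF convex_UNIV])
      show "(G has_field_derivative \<psi> z) (at z within UNIV)" for z using deriv[of z] by simp
      show "norm (\<psi> z) \<le> rate" for z using \<psi>_pos[of z] \<psi>_le[of z] by simp
    qed auto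
    then show ?thesis by simp
  qed
  have "\<bar>(G ^^ Suc n) x - (G ^^ Suc n) y\<bar> \<le> rate * \<bar>(G ^^ n) x - (G ^^ n) y\<bar>"
    using lip by simp
  also have "\<dots> \<le> rate * (rate ^ n * \<bar>x - y\<bar>)" using Suc rate_pos by (intro mult_left_mono) auto
  finally show ?case by simp
qed simp

definition funpow_deriv :: "nat \<Rightarrow> real \<Rightarrow> real" where
  "funpow_deriv n x = (\<Prod>k<n. \<psi> ((G ^^ k) x))"

lemma has_derivative_funpow: "((G ^^ n) has_real_derivative funpow_deriv n x) (at x)"
proof (induction n)
  case (Suc n)
  have "((\<lambda>x. G ((G ^^ n) x)) has_real_derivative \<psi> ((G ^^ n) x) * funpow_deriv n x) (at x)"
    by (rule DERIV_chain2[OF deriv Suc])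
  then show ?case by (simp add: funpow_deriv_def comp_def mult.commute)
qed (simp add: funpow_deriv_def id_def)

lemma funpow_deriv_pos: "0 < funpow_deriv n x"
  unfolding funpow_deriv_def by (intro prod_pos) (simp add: \<psi>_pos)

definition distortion_rate :: real where
  "distortion_rate = L / (1 - rate)"

lemma distortion_rate_pos: "0 < distortion_rate"
  using L rate_less_1 by (simp add: distortion_rate_def)

text \<open>After \<open>k\<close> steps two points are at most \<open>rate ^ k\<close> times their
  initial distance apart, so the logarithmic distortions form a geometric series. Its full sum gives
  the constant \<open>L / (1 - rate)\<close>, independent of \<open>n\<close>.\<close>

lemma funpow_deriv_ratio: "funpow_deriv n x \<le> funpow_deriv n y * exp (distortion_rate * \<bar>x - y\<bar>)"
proof -
  have "funpow_deriv n x \<le> funpow_deriv n y * exp (L * (\<Sum>k<n. rate ^ k) * \<bar>x - y\<bar>)"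
  proof (induction n)
    case (Suc n)
    have "\<psi> ((G ^^ n) x) \<le> \<psi> ((G ^^ n) y) * exp (L * (rate ^ n * \<bar>x - y\<bar>))"
    proof -
      have "exp (L * \<bar>(G ^^ n) x - (G ^^ n) y\<bar>) \<le> exp (L * (rate ^ n * \<bar>x - y\<bar>))"
        using funpow_lipschitz[of n x y] L by simp
      then show ?thesis
        using \<psi>_ratio[of "(G ^^ n) x" "(G ^^ n) y"] \<psi>_pos[of "(G ^^ n) y"]
        by (meson less_imp_le mult_left_mono order_trans)
    qed
    then have "funpow_deriv n x * \<psi> ((G ^^ n) x) \<le>
        (funpow_deriv n y * exp (L * (\<Sum>k<n. rate ^ k) * \<bar>x - y\<bar>)) *
        (\<psi> ((G ^^ n) y) * exp (L * (rate ^ n * \<bar>x - y\<bar>)))"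
      using Suc \<psi>_pos funpow_deriv_pos
      by (intro mult_mono) (auto intro!: mult_nonneg_nonneg simp: less_imp_le)
    also have "\<dots> = (funpow_deriv n y * \<psi> ((G ^^ n) y)) * exp (L * (\<Sum>k<Suc n. rate ^ k) * \<bar>x - y\<bar>)"
      by (simp add: algebra_simps exp_add)
    finally show ?case by (simp add: funpow_deriv_def)
  qed (simp add: funpow_deriv_def)
  also have "\<dots> \<le> funpow_deriv n y * exp (distortion_rate * \<bar>x - y\<bar>)"
  proof -
    have "(\<Sum>k<n. rate ^ k) = (1 - rate ^ n) / (1 - rate)"
      using rate_less_1 by (subst sum_gp_strict) auto
    also have "\<dots> \<le> 1 / (1 - rate)"
      using rate_less_1 rate_pos by (intro divide_right_mono) auto
    finally have "L * (\<Sum>k<n. rate ^ k) \<le> distortion_rate"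
      using L by (simp add: distortion_rate_def mult_left_mono[of _ _ L] divide_inverse)
    then show ?thesis using funpow_deriv_pos[of n y]
      by (intro mult_left_mono) (auto intro: mult_right_mono simp: less_imp_le)
  qed
  finally show ?thesis .
qed

text \<open>By the mean value theorem each quotient is a derivative at some point of its interval;
  \<open>R\<close> bounds the distance between the two points.\<close>

lemma increment_ratio:
  assumes I: "a < b" "a' < b'" and R: "b - a' \<le> R" "b' - a \<le> R"
  shows "((G ^^ n) b - (G ^^ n) a) / (b - a) \<le>
    ((G ^^ n) b' - (G ^^ n) a') / (b' - a') * exp (distortion_rate * R)"
proof -
  obtain x where x: "a < x" "x < b" "(G ^^ n) b - (G ^^ n) a = (b - a) * funpow_deriv n x"
    using MVT2[OF I(1), of "G ^^ n" "funpow_deriv n"] has_derivative_funpow by blast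
  obtain y where y: "a' < y" "y < b'" "(G ^^ n) b' - (G ^^ n) a' = (b' - a') * funpow_deriv n y"
    using MVT2[OF I(2), of "G ^^ n" "funpow_deriv n"] has_derivative_funpow by blast
  have "\<bar>x - y\<bar> \<le> R" using x y R by auto
  then have "exp (distortion_rate * \<bar>x - y\<bar>) \<le> exp (distortion_rate * R)"
    using distortion_rate_pos by simp
  then have "funpow_deriv n x \<le> funpow_deriv n y * exp (distortion_rate * R)"
    using funpow_deriv_ratio[of n x y] funpow_deriv_pos[of n y]
    by (meson less_imp_le mult_left_mono order_trans)
  then show ?thesis using x(3) y(3) I by simp
qed

text \<open>This is \<open>1 + \<epsilon>\<close>. For \<open>t \<le> 1\<close> both intervals lie
  within a length of \<open>2 * t\<close>. For larger \<open>t\<close> the factor 2 is the ratio of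
  the two lengths after the first iterates, and \<open>2 * d\<close> bounds their sum when iterates
  remain.\<close>

definition modulus :: "real \<Rightarrow> real" where
  "modulus t = (if t \<le> 1 then exp (2 * distortion_rate * t) else 2 * exp (2 * distortion_rate * d))"

text \<open>
  For \<open>t \<ge> 1\<close> the first \<open>k\<close> iterates, with \<open>d\<^sup>k\<close> close to \<open>t\<close>, bring both intervals to size at
  most \<open>d\<close> and comparable length, by periodicity.
\<close>

lemma large_scale:
  assumes t: "1 \<le> t"
  obtains k :: nat and u v :: real where "k \<le> n" "1 \<le> u" "u \<le> 2 * v" "v \<le> 2 * u" "1 \<le> v" "k = n \<or> (u \<le> d \<and> v \<le> d)"
    "(G ^^ k) (x + t) = (G ^^ k) x + u" "(G ^^ k) (x - t) = (G ^^ k) x - v"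
proof -
  have "\<exists>k\<le>n. real d ^ k \<le> t \<and> (k = n \<or> t < real d ^ Suc k)"
  proof (induction n)
    case (Suc n)
    then obtain k where k: "k \<le> n" "real d ^ k \<le> t" "k = n \<or> t < real d ^ Suc k" by blast
    show ?case
    proof (cases "t < real d ^ Suc k")
      case True
      then show ?thesis using k by (intro exI[of _ k]) auto
    next
      case False
      then show ?thesis using k by (intro exI[of _ "Suc n"]) auto
    qed
  qed (use t in simp)
  then obtain k where k: "k \<le> n" "real d ^ k \<le> t" "k = n \<or> t < real d ^ Suc k" by blast
  have dk: "0 < real d ^ k" using d by simp
  \<comment> \<open>Both \<open>u\<close> and \<open>v\<close> lie between \<open>q\<close> and
    \<open>q + 1\<close>, by monotonicity and \<open>funpow_shift\<close>; as \<open>q\<close> is at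
    least 1, they differ at most by the factor 2.\<close>
  define q where "q = nat \<lfloor>t / real d ^ k\<rfloor>"
  have "1 \<le> t / real d ^ k" using k dk by simp
  then have q: "1 \<le> q" "real q \<le> t / real d ^ k" "t / real d ^ k < real q + 1"
    by (auto simp: q_def le_nat_iff le_floor_iff)
  then have tq: "real d ^ k * real q \<le> t" "t \<le> real d ^ k * real (Suc q)"
    using dk by (auto simp: field_simps)
  define u where "u = (G ^^ k) (x + t) - (G ^^ k) x"
  define v where "v = (G ^^ k) x - (G ^^ k) (x - t)"
  have "(G ^^ k) (x + real d ^ k * real q) \<le> (G ^^ k) (x + t)"
    "(G ^^ k) (x + t) \<le> (G ^^ k) (x + real d ^ k * real (Suc q))"
    using tq by (auto simp only: funpow_le_iff)
  then have u: "real q \<le> u" "u \<le> real q + 1" unfolding funpow_shift u_def by auto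
  have "(G ^^ k) ((x - t) + real d ^ k * real q) \<le> (G ^^ k) x"
    "(G ^^ k) x \<le> (G ^^ k) ((x - t) + real d ^ k * real (Suc q))"
    unfolding funpow_le_iff using tq by auto
  then have v: "real q \<le> v" "v \<le> real q + 1" unfolding funpow_shift v_def by auto
  have "k = n \<or> (u \<le> d \<and> v \<le> d)"
  proof (cases "k = n")
    case False
    then have "t / real d ^ k < d" using k dk by (simp add: field_simps)
    then have "q < d" using q by linarith
    then show ?thesis using u v by linarith
  qed simp
  moreover have "1 \<le> real q" using q by simp
  ultimately show ?thesis using k u v by (intro that[of k u v]) (auto simp: u_def v_def)
qed

lemma modulus_bounds:
  assumes t: "0 < t"
  shows "(G ^^ n) (x + t) - (G ^^ n) x \<le> modulus t * ((G ^^ n) x - (G ^^ n) (x - t))"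
    and "(G ^^ n) x - (G ^^ n) (x - t) \<le> modulus t * ((G ^^ n) (x + t) - (G ^^ n) x)"
proof -
  define A B where "A = (G ^^ n) (x + t) - (G ^^ n) x" and "B = (G ^^ n) x - (G ^^ n) (x - t)"
  have AB: "0 < A" "0 < B" using t by (auto simp: A_def B_def funpow_less_iff)
  have "A \<le> modulus t * B \<and> B \<le> modulus t * A"
  proof (cases "t \<le> 1")
    case True
    have "A / t \<le> B / t * exp (distortion_rate * (2 * t))" "B / t \<le> A / t * exp (distortion_rate * (2 * t))"
      using increment_ratio[of x "x + t" "x - t" x "2 * t" n] increment_ratio[of "x - t" x x "x + t" "2 * t" n] t
      by (auto simp: A_def B_def)
    then show ?thesis using True t by (simp add: modulus_def field_simps)
  next
    case False
    then obtain k :: nat and u v :: real where k: "k \<le> n" and uv: "1 \<le> u" "u \<le> 2 * v" "v \<le> 2 * u" "1 \<le> v"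
      and kn: "k = n \<or> (u \<le> d \<and> v \<le> d)"
      and G: "(G ^^ k) (x + t) = (G ^^ k) x + u" "(G ^^ k) (x - t) = (G ^^ k) x - v"
      using large_scale[of t n x] by (auto simp: not_le less_imp_le)
    define E where "E = exp (2 * distortion_rate * d)"
    have E: "1 \<le> E" using distortion_rate_pos by (simp add: E_def)
    have mod: "modulus t = 2 * E" using False by (simp add: modulus_def E_def)
    show ?thesis
    proof (cases "k = n")
      case True
      then have eq: "A = u" "B = v" using G by (auto simp: A_def B_def)
      have "2 * 1 * v \<le> 2 * E * v" "2 * 1 * u \<le> 2 * E * u"
        using E uv by (intro mult_right_mono mult_left_mono; simp)+
      then show ?thesis unfolding eq mod using uv by linarith
    next
      case False
      let ?y = "(G ^^ k) x" and ?m = "n - k"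
      have split: "(G ^^ n) z = (G ^^ ?m) ((G ^^ k) z)" for z
        using funpow_add[of ?m k G] k by simp
      have eq: "A = (G ^^ ?m) (?y + u) - (G ^^ ?m) ?y" "B = (G ^^ ?m) ?y - (G ^^ ?m) (?y - v)"
        unfolding A_def B_def split[of "x + t"] split[of x] split[of "x - t"] G by auto
      have le: "u + v \<le> 2 * d" using kn False by simp
      have "A / u \<le> B / v * exp (distortion_rate * (2 * d))" "B / v \<le> A / u * exp (distortion_rate * (2 * d))"
        using increment_ratio[of ?y "?y + u" "?y - v" ?y "2 * d" ?m]
          increment_ratio[of "?y - v" ?y ?y "?y + u" "2 * d" ?m] uv le
        by (auto simp: eq)
      then have "A / u \<le> B / v * E" "B / v \<le> A / u * E" by (auto simp: E_def mult_ac)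
      then have "A \<le> B * E * (u / v)" "B \<le> A * E * (v / u)" using uv by (auto simp: field_simps)
      moreover have "B * E * (u / v) \<le> B * E * 2" "A * E * (v / u) \<le> A * E * 2"
        using AB E uv by (intro mult_left_mono; simp add: field_simps)+
      ultimately show ?thesis unfolding mod by (simp add: mult_ac)
    qed
  qed
  then show "(G ^^ n) (x + t) - (G ^^ n) x \<le> modulus t * ((G ^^ n) x - (G ^^ n) (x - t))"
    "(G ^^ n) x - (G ^^ n) (x - t) \<le> modulus t * ((G ^^ n) (x + t) - (G ^^ n) x)"
    by (auto simp: A_def B_def)
qed

lemma modulus_gt_1: "0 < t \<Longrightarrow> 1 < modulus t"
proof -
  assume "0 < t"
  then have "1 < exp (2 * distortion_rate * t)" "1 < exp (2 * distortion_rate * d)"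
    using distortion_rate_pos d by auto
  then have "1 < exp (2 * distortion_rate * t)" "1 < 2 * exp (2 * distortion_rate * d)"
    by linarith+
  then show ?thesis by (simp add: modulus_def)
qed

lemma modulus_tendsto: "((\<lambda>t. modulus t - 1) \<longlongrightarrow> 0) (at_right 0)"
proof -
  have "((\<lambda>t. exp (2 * distortion_rate * t) - 1) \<longlongrightarrow> exp (2 * distortion_rate * 0) - 1) (at_right 0)"
    by (intro tendsto_intros)
  moreover have "eventually (\<lambda>t. exp (2 * distortion_rate * t) - 1 = modulus t - 1) (at_right 0)"
    by (rule eventually_at_rightI[of 0 1]) (auto simp: modulus_def)
  ultimately show ?thesis by (simp add: filterlim_cong[OF refl refl])
qed

lemma modulus_bounded: "bounded ((\<lambda>t. modulus t - 1) ` {0<..})"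
proof (rule boundedI)
  fix y assume "y \<in> (\<lambda>t. modulus t - 1) ` {0<..}"
  then obtain t where t: "0 < t" "y = modulus t - 1" by auto
  have "exp (2 * distortion_rate * t) \<le> exp (2 * distortion_rate * 1)" if "t \<le> 1"
    using that distortion_rate_pos by simp
  then have "modulus t \<le> exp (2 * distortion_rate) + 2 * exp (2 * distortion_rate * d)"
    by (auto simp: modulus_def add_increasing2)
  then show "norm y \<le> exp (2 * distortion_rate) + 2 * exp (2 * distortion_rate * d)"
    using modulus_gt_1[OF t(1)] t by simp
qed

lemma symmetric: "symmetric_lift_inverse d G (\<lambda>t. modulus t - 1)"
  by unfold_locales (use modulus_gt_1 modulus_tendsto modulus_bounds in auto)

lemma uniformly_symmetric: "uniformly_symmetric d endomorphism"
  by (rule uniformly_symmetric_endomorphism[of "\<lambda>t. modulus t - 1"])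
     (use modulus_gt_1 modulus_tendsto modulus_bounded modulus_bounds in auto)

end

section \<open>A family of Lebesgue-preserving maps\<close>

lemma abs_cos_diff_le: "\<bar>cos x - cos y\<bar> \<le> \<bar>x - y\<bar>" for x y :: real
proof -
  have "norm (cos x - cos y) \<le> 1 * norm (x - y)"
  proof (rule field_differentiable_bound[OF convex_UNIV])
    show "(cos has_field_derivative - sin z) (at z within UNIV)" for z :: real
      by (auto intro!: derivative_eq_intros)
  qed auto
  then show ?thesis by simp
qed

text \<open>
  The weights of the inverse branches are a softmax of \<open>\<beta> cos\<close>: for \<open>\<beta> = 0\<close> they are equal, and
  for large \<open>\<beta>\<close> nearly all the weight is on the branch \<open>0\<close>, centred at \<open>1/2\<close>.
\<close>

definition bump :: "nat \<Rightarrow> real \<Rightarrow> real \<Rightarrow> real" where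
  "bump d \<beta> x = exp (\<beta> * cos (2 * pi * (x - 1/2) / d))"

definition bump_sum :: "nat \<Rightarrow> real \<Rightarrow> real \<Rightarrow> real" where
  "bump_sum d \<beta> x = (\<Sum>j<d. bump d \<beta> (x + real j))"

definition softmax :: "nat \<Rightarrow> real \<Rightarrow> real \<Rightarrow> real" where
  "softmax d \<beta> x = bump d \<beta> x / bump_sum d \<beta> x"

lemma bump_pos: "0 < bump d \<beta> x"
  by (simp add: bump_def)

context
  fixes d :: nat and \<beta> :: real
  assumes d: "2 \<le> d" and \<beta>: "0 \<le> \<beta>"
begin

lemma bump_period: "bump d \<beta> (x + real d) = bump d \<beta> x"
proof -
  have "2 * pi * (x + real d - 1/2) / d = 2 * pi * (x - 1/2) / d + 2 * pi"
    using d by (simp add: field_simps)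
  then show ?thesis by (simp add: bump_def del: times_divide_eq_right)
qed

lemma bump_sum_pos: "0 < bump_sum d \<beta> x"
  unfolding bump_sum_def using d by (intro sum_pos) (auto simp: bump_pos lessThan_empty_iff)

lemma bump_sum_step: "bump_sum d \<beta> (x + 1) = bump_sum d \<beta> x"
proof -
  have "(\<Sum>j<Suc d. bump d \<beta> (x + real j)) = bump d \<beta> x + (\<Sum>j<d. bump d \<beta> (x + real (Suc j)))"
    by (subst sum.lessThan_Suc_shift) simp
  then show ?thesis using bump_period[of x] by (simp add: bump_sum_def add_ac)
qed

lemma bump_sum_shift: "bump_sum d \<beta> (x + real k) = bump_sum d \<beta> x"
proof (induction k)
  case (Suc k)
  then show ?case using bump_sum_step[of "x + k"] by (simp add: add_ac)
qed simp

lemma sum_softmax: "(\<Sum>j<d. softmax d \<beta> (x + real j)) = 1"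
  using bump_sum_pos[of x]
  by (simp add: softmax_def bump_sum_shift bump_sum_def[symmetric] flip: sum_divide_distrib)

lemma softmax_pos: "0 < softmax d \<beta> x"
  by (simp add: softmax_def bump_pos bump_sum_pos)

lemma bump_bounds: "exp (- \<beta>) \<le> bump d \<beta> x" "bump d \<beta> x \<le> exp \<beta>"
proof -
  have "\<beta> * (- 1) \<le> \<beta> * cos (2 * pi * (x - 1/2) / d)" "\<beta> * cos (2 * pi * (x - 1/2) / d) \<le> \<beta> * 1"
    using \<beta> by (intro mult_left_mono; simp)+
  then show "exp (- \<beta>) \<le> bump d \<beta> x" "bump d \<beta> x \<le> exp \<beta>" by (auto simp: bump_def)
qed

lemma bump_sum_ge: "bump d \<beta> x + bump d \<beta> (x + 1) \<le> bump_sum d \<beta> x"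
proof -
  have "(\<Sum>j\<in>{0, 1}. bump d \<beta> (x + real j)) \<le> bump_sum d \<beta> x"
    unfolding bump_sum_def using d bump_pos by (intro sum_mono2) (auto simp: less_imp_le)
  then show ?thesis by simp
qed

text \<open>As \<open>d\<close> is at least 2, another branch contributes at least
  \<open>exp (- \<beta>)\<close>, and \<open>b / (b + exp (- \<beta>))\<close> increases with
  \<open>b \<le> exp \<beta>\<close>. The bound is below 1 and serves as the contraction
  rate.\<close>

lemma softmax_le: "softmax d \<beta> x \<le> exp \<beta> / (exp \<beta> + exp (- \<beta>))"
proof -
  have "bump d \<beta> x + exp (- \<beta>) \<le> bump_sum d \<beta> x"
    using bump_sum_ge[of x] bump_bounds(1)[of "x + 1"] by linarith
  then have "softmax d \<beta> x \<le> bump d \<beta> x / (bump d \<beta> x + exp (- \<beta>))"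
    unfolding softmax_def using bump_pos[of d \<beta> x]
    by (intro divide_left_mono) (auto intro!: mult_pos_pos add_pos_pos bump_sum_pos)
  also have "\<dots> \<le> exp \<beta> / (exp \<beta> + exp (- \<beta>))"
  proof -
    have pos: "0 < bump d \<beta> x + exp (- \<beta>)" "0 < exp \<beta> + exp (- \<beta>)"
      using bump_pos[of d \<beta> x] by (auto intro: add_pos_pos)
    have "bump d \<beta> x * exp (- \<beta>) \<le> exp \<beta> * exp (- \<beta>)"
      using bump_bounds(2) by (intro mult_right_mono) auto
    then show ?thesis unfolding frac_le_eq[OF pos(1)[THEN less_imp_neq, symmetric] pos(2)[THEN less_imp_neq, symmetric]]
      using pos by (intro divide_nonpos_pos mult_pos_pos) (simp_all add: algebra_simps)
  qed
  finally show ?thesis .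
qed

lemma bump_ratio: "bump d \<beta> x \<le> bump d \<beta> y * exp (2 * pi * \<beta> * \<bar>x - y\<bar>)"
proof -
  have "\<bar>cos (2 * pi * (x - 1/2) / d) - cos (2 * pi * (y - 1/2) / d)\<bar> \<le> \<bar>2 * pi * (x - 1/2) / d - 2 * pi * (y - 1/2) / d\<bar>"
    by (rule abs_cos_diff_le)
  also have "2 * pi * (x - 1/2) / d - 2 * pi * (y - 1/2) / d = 2 * pi * (x - y) / d"
    by (simp add: diff_divide_distrib right_diff_distrib)
  also have "\<bar>2 * pi * (x - y) / d\<bar> \<le> 2 * pi * \<bar>x - y\<bar>"
  proof -
    have "2 * pi * \<bar>x - y\<bar> * 1 \<le> 2 * pi * \<bar>x - y\<bar> * d" using d by (intro mult_left_mono) auto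
    then show ?thesis using d by (simp add: abs_mult divide_le_eq)
  qed
  finally have "cos (2 * pi * (x - 1/2) / d) \<le> cos (2 * pi * (y - 1/2) / d) + 2 * pi * \<bar>x - y\<bar>"
    by linarith
  then have "\<beta> * cos (2 * pi * (x - 1/2) / d) \<le> \<beta> * (cos (2 * pi * (y - 1/2) / d) + 2 * pi * \<bar>x - y\<bar>)"
    using \<beta> by (rule mult_left_mono)
  then show ?thesis
    unfolding bump_def exp_add[symmetric] by (simp add: algebra_simps)
qed

lemma bump_sum_ratio: "bump_sum d \<beta> x \<le> bump_sum d \<beta> y * exp (2 * pi * \<beta> * \<bar>x - y\<bar>)"
  unfolding bump_sum_def sum_distrib_right
proof (rule sum_mono)
  fix j
  show "bump d \<beta> (x + real j) \<le> bump d \<beta> (y + real j) * exp (2 * pi * \<beta> * \<bar>x - y\<bar>)"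
    using bump_ratio[of "x + j" "y + j"] by simp
qed

text \<open>Numerator and denominator contribute \<open>2 * pi * \<beta>\<close> each; the added 1
  makes the constant positive also for \<open>\<beta> = 0\<close>.\<close>

lemma softmax_ratio: "softmax d \<beta> x \<le> softmax d \<beta> y * exp ((4 * pi * \<beta> + 1) * \<bar>x - y\<bar>)"
proof -
  let ?e = "exp (2 * pi * \<beta> * \<bar>x - y\<bar>)"
  have "bump_sum d \<beta> y \<le> bump_sum d \<beta> x * ?e" using bump_sum_ratio[of y x] by (simp add: abs_minus_commute)
  then have "bump d \<beta> x * bump_sum d \<beta> y \<le> (bump d \<beta> y * ?e) * (bump_sum d \<beta> x * ?e)"
    using bump_ratio[of x y] bump_pos bump_sum_pos
    by (intro mult_mono) (auto intro!: mult_nonneg_nonneg simp: less_imp_le)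
  then have "softmax d \<beta> x \<le> softmax d \<beta> y * (?e * ?e)"
    using bump_sum_pos[of x] bump_sum_pos[of y] by (simp add: softmax_def field_simps)
  also have "?e * ?e \<le> exp ((4 * pi * \<beta> + 1) * \<bar>x - y\<bar>)"
    unfolding exp_add[symmetric] by (simp add: algebra_simps)
  finally show ?thesis using softmax_pos[of y] by (simp add: mult_left_mono)
qed

lemma isCont_softmax: "isCont (softmax d \<beta>) x"
proof -
  have "continuous_on UNIV (\<lambda>x. bump d \<beta> x / bump_sum d \<beta> x)"
    using bump_sum_pos d unfolding bump_def bump_sum_def
    by (intro continuous_intros) (auto simp: less_imp_neq[symmetric])
  then show ?thesis
    by (simp add: softmax_def[abs_def] continuous_on_eq_continuous_at)
qed

end

text \<open>Derivative and value at 0 determine the function, so the choice is unambiguous.\<close>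

definition softmax_primitive :: "nat \<Rightarrow> real \<Rightarrow> real \<Rightarrow> real" where
  "softmax_primitive d \<beta> = (SOME G. G 0 = 0 \<and> (\<forall>x. (G has_real_derivative softmax d \<beta> x) (at x)))"

lemma softmax_primitive:
  assumes "2 \<le> d" "0 \<le> \<beta>"
  shows "softmax_primitive d \<beta> 0 = 0"
    and "(softmax_primitive d \<beta> has_real_derivative softmax d \<beta> x) (at x)"
proof -
  obtain G where G: "\<And>x. (G has_vector_derivative softmax d \<beta> x) (at x)"
    using einterval_antiderivative[of "-\<infinity>" "\<infinity>" "softmax d \<beta>"] isCont_softmax[OF assms] by auto
  have "((\<lambda>x. G x - G 0) has_real_derivative softmax d \<beta> x) (at x)" for x
    using G[of x] by (auto simp: has_real_derivative_iff_has_vector_derivative intro!: derivative_eq_intros)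
  then have "\<exists>G. G 0 = 0 \<and> (\<forall>x. (G has_real_derivative softmax d \<beta> x) (at x))"
    by (intro exI[of _ "\<lambda>x. G x - G 0"]) simp
  from someI_ex[OF this, folded softmax_primitive_def]
  show "softmax_primitive d \<beta> 0 = 0" "(softmax_primitive d \<beta> has_real_derivative softmax d \<beta> x) (at x)"
    by auto
qed

text \<open>Says that the circle map preserves Lebesgue measure.\<close>

locale measure_preserving_lift_inverse = lift_inverse +
  assumes preserves: "(\<Sum>j<d. G (x + real j) - G (real j)) = x"

text \<open>Both normalisations come from \<open>sum_softmax\<close>. The branches have derivatives
  summing to 1, so their increments from 0 sum to \<open>x\<close>; the increment of this sum from
  \<open>x\<close> to \<open>x + 1\<close> telescopes to \<open>G (x + d) - G x\<close>, which is
  therefore 1.\<close>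

lemma softmax_primitive_locales:
  assumes d: "2 \<le> d" and \<beta>: "0 \<le> \<beta>"
  shows "expanding_lift_inverse d (softmax_primitive d \<beta>) (softmax d \<beta>)
           (exp \<beta> / (exp \<beta> + exp (- \<beta>))) (4 * pi * \<beta> + 1)" (is ?A)
    and "measure_preserving_lift_inverse d (softmax_primitive d \<beta>)" (is ?B)
proof -
  let ?G = "softmax_primitive d \<beta>"
  note deriv = softmax_primitive(2)[OF d \<beta>] and zero = softmax_primitive(1)[OF d \<beta>]
  have pres: "(\<Sum>j<d. ?G (x + real j) - ?G (real j)) = x" for x
  proof -
    define h where "h x = (\<Sum>j<d. ?G (x + real j) - ?G (real j)) - x" for x
    have "(h has_real_derivative (\<Sum>j<d. softmax d \<beta> (x + real j)) - 1) (at x)" for x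
      unfolding h_def by (auto intro!: derivative_eq_intros DERIV_chain'[OF _ deriv, of "\<lambda>x. x + real _", THEN DERIV_cong])
    then have "(h has_real_derivative 0) (at x)" for x using sum_softmax[OF d \<beta>] by simp
    then have "h x = h 0" by (intro DERIV_isconst_all) auto
    then show ?thesis by (simp add: h_def)
  qed
  have tele: "(\<Sum>j<d. ?G (x + 1 + real j) - ?G (x + real j)) = ?G (x + d) - ?G x" for x
    using sum_lessThan_telescope[of "\<lambda>j. ?G (x + real j)" d] by (simp add: add_ac)
  have shift: "?G (x + real d) = ?G x + 1" for x
  proof -
    have "?G (x + d) - ?G x = (\<Sum>j<d. ?G (x + 1 + real j) - ?G (real j)) - (\<Sum>j<d. ?G (x + real j) - ?G (real j))"
      unfolding tele[symmetric] sum_subtractf[symmetric] by simp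
    then show ?thesis using pres[of "x + 1"] pres[of x] by simp
  qed
  interpret lift_inverse d ?G
  proof
    show "continuous_on UNIV ?G" using deriv by (auto intro!: continuous_at_imp_continuous_on DERIV_isCont)
    show "strict_mono ?G"
      by (rule strict_monoI, rule DERIV_pos_imp_increasing) (use deriv softmax_pos[OF d \<beta>] in blast)+
  qed (use d zero shift in auto)
  show ?B by unfold_locales (rule pres)
  show ?A
  proof unfold_locales
    show "exp \<beta> / (exp \<beta> + exp (- \<beta>)) < 1"
      by (subst divide_less_eq_1_pos) (auto intro: add_pos_pos)
    show "0 < 4 * pi * \<beta> + 1" using \<beta> by (simp add: add_nonneg_pos)
  qed (rule deriv softmax_pos[OF d \<beta>] softmax_le[OF d \<beta>] softmax_ratio[OF d \<beta>])+
qed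

lemma softmax_0: "2 \<le> d \<Longrightarrow> softmax d 0 x = 1 / d"
  by (simp add: softmax_def bump_sum_def bump_def)

lemma softmax_primitive_0: "2 \<le> d \<Longrightarrow> softmax_primitive d 0 x = x / d"
proof -
  assume d: "2 \<le> d"
  have "((\<lambda>x. softmax_primitive d 0 x - x / d) has_real_derivative 0) (at x)" for x
    using softmax_primitive(2)[OF d, of 0 x] softmax_0[OF d, of x]
    using d by (auto intro!: derivative_eq_intros)
  then have "softmax_primitive d 0 x - x / d = softmax_primitive d 0 0 - 0 / d"
    by (intro DERIV_isconst_all) auto
  then show ?thesis using softmax_primitive(1)[OF d] by simp
qed

text \<open>The angle of branch 0 is less than \<open>pi / d\<close> in absolute value, while all
  others lie strictly between \<open>pi / d\<close> and \<open>2 * pi - pi / d\<close>. So branch 0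
  has the strictly largest cosine and takes all the weight in the limit.\<close>

lemma tendsto_softmax:
  assumes d: "2 \<le> d" and x: "0 < x" "x < 1"
  shows "(\<lambda>n. softmax d (real n) x) \<longlonglongrightarrow> 1"
proof -
  let ?c = "\<lambda>j. cos (2 * pi * (x + real j - 1/2) / d)"
  have less: "?c j < ?c 0" if j: "j \<in> {1..<d}" for j
  proof -
    have "\<bar>2 * pi * (x - 1/2) / d\<bar> < pi / d"
    proof -
      have "\<bar>2 * (x - 1/2)\<bar> < 1" using x by (auto simp: abs_if)
      then have "pi * \<bar>2 * (x - 1/2)\<bar> / d < pi * 1 / d"
        using d by (intro divide_strict_right_mono mult_strict_left_mono) auto
      then show ?thesis by (simp add: abs_mult mult_ac)
    qed
    moreover have "pi / d \<le> pi" using d by (simp add: divide_le_eq)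
    ultimately have "cos (pi / d) < cos \<bar>2 * pi * (x - 1/2) / d\<bar>"
      by (intro cos_monotone_0_pi) auto
    then have 1: "cos (pi / d) < ?c 0" unfolding cos_abs_real by simp
    have "1 < 2 * (x + real j - 1/2)" "2 * (x + real j - 1/2) < 2 * real d - 1"
      using x j by auto
    then have "pi * 1 / d < pi * (2 * (x + real j - 1/2)) / d" "pi * (2 * (x + real j - 1/2)) / d < pi * (2 * real d - 1) / d"
      using d by (intro divide_strict_right_mono mult_strict_left_mono; simp)+
    moreover have "pi * (2 * real d - 1) / d = 2 * pi - pi / d" using d by (simp add: field_simps)
    ultimately have a: "pi / d < 2 * pi * (x + real j - 1/2) / d" "2 * pi * (x + real j - 1/2) / d < 2 * pi - pi / d"
      by (simp_all add: mult_ac)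
    have "?c j < cos (pi / d)"
    proof (cases "2 * pi * (x + real j - 1/2) / d \<le> pi")
      case True
      then show ?thesis using a d by (intro cos_monotone_0_pi) auto
    next
      case False
      then have "cos (2 * pi - 2 * pi * (x + real j - 1/2) / d) < cos (pi / d)"
        using a d by (intro cos_monotone_0_pi) auto
      then show ?thesis by (simp add: cos_2pi_minus)
    qed
    then show ?thesis using 1 by simp
  qed
  have "(\<lambda>n. 1 + (\<Sum>j\<in>{1..<d}. exp (real n * (?c j - ?c 0)))) \<longlonglongrightarrow> 1 + (\<Sum>j\<in>{1..<d}. 0)"
  proof (intro tendsto_intros)
    fix j assume "j \<in> {1..<d}"
    then have "?c j - ?c 0 < 0" using less[of j] by linarith
    then have "(\<lambda>n. exp (?c j - ?c 0) ^ n) \<longlonglongrightarrow> 0" by (intro LIMSEQ_realpow_zero) auto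
    then show "(\<lambda>n. exp (real n * (?c j - ?c 0))) \<longlonglongrightarrow> 0" by (simp add: exp_of_nat_mult)
  qed
  from tendsto_inverse[OF this]
  have "(\<lambda>n. inverse (1 + (\<Sum>j\<in>{1..<d}. exp (real n * (?c j - ?c 0))))) \<longlonglongrightarrow> 1" by simp
  moreover have "inverse (1 + (\<Sum>j\<in>{1..<d}. exp (real n * (?c j - ?c 0)))) = softmax d (real n) x" for n
  proof -
    have "{..<d} = insert 0 {1..<d}" using d by auto
    then have "bump_sum d (real n) x = bump d (real n) x + (\<Sum>j\<in>{1..<d}. bump d (real n) (x + real j))"
      by (simp add: bump_sum_def)
    also have "\<dots> = bump d (real n) x * (1 + (\<Sum>j\<in>{1..<d}. exp (real n * (?c j - ?c 0))))"
      by (simp add: distrib_left sum_distrib_left bump_def right_diff_distrib flip: exp_add)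
    finally have "softmax d (real n) x =
        bump d (real n) x / (bump d (real n) x * (1 + (\<Sum>j\<in>{1..<d}. exp (real n * (?c j - ?c 0)))))"
      by (simp only: softmax_def)
    then show ?thesis using bump_pos[of d "real n" x]
      by (simp only: divide_inverse inverse_mult_distrib mult.assoc[symmetric] right_inverse less_imp_neq[symmetric]) simp
  qed
  ultimately show ?thesis by simp
qed

text \<open>Dominated convergence for the derivative, with bound 1. The interval is open because at
  0 and at 1 two branches tie.\<close>

lemma tendsto_softmax_primitive_1:
  assumes d: "2 \<le> d"
  shows "(\<lambda>n. softmax_primitive d (real n) 1) \<longlonglongrightarrow> 1"
proof -
  have int: "(softmax d (real n) has_integral softmax_primitive d (real n) 1) {0<..<1}" for n
  proof -
    have "(softmax d (real n) has_integral softmax_primitive d (real n) 1 - softmax_primitive d (real n) 0) {0..1}"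
      using softmax_primitive(2)[OF d, of "real n"]
      by (intro fundamental_theorem_of_calculus)
         (auto simp: has_real_derivative_iff_has_vector_derivative[symmetric] intro: has_field_derivative_at_within)
    then show ?thesis
      using softmax_primitive(1)[OF d, of "real n"] has_integral_open_interval[of "softmax d (real n)" _ 0 1] by simp
  qed
  have "(\<lambda>n. integral {0<..<1} (softmax d (real n))) \<longlonglongrightarrow> integral {0<..<1} (\<lambda>_ :: real. 1 :: real)"
  proof (rule dominated_convergence(2)[where h = "\<lambda>_ :: real. 1"])
    show "softmax d (real n) integrable_on {0<..<1}" for n using int by (auto simp: integrable_on_def)
    show "(\<lambda>_. 1 :: real) integrable_on {0<..<1 :: real}"
      using integrable_on_open_interval[of "\<lambda>_. 1 :: real" 0 "1 :: real"] integrable_const_ivl[of "1 :: real" 0 "1 :: real"] by simp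
    show "norm (softmax d (real n) x) \<le> 1" for n x
    proof -
      have "exp (real n) / (exp (real n) + exp (- real n)) \<le> 1" by (simp add: divide_le_eq add_pos_pos)
      then show ?thesis
        using softmax_le[OF d, of "real n" x] softmax_pos[OF d, of "real n" x] by simp
    qed
    show "(\<lambda>n. softmax d (real n) x) \<longlonglongrightarrow> 1" if "x \<in> {0<..<1}" for x
      using tendsto_softmax[OF d] that by auto
  qed
  moreover have "((\<lambda>_. 1 :: real) has_integral 1) {0<..<1 :: real}"
    using has_integral_open_interval[of "\<lambda>_. 1 :: real" 1 0 "1 :: real"] has_integral_const_real[of "1 :: real" 0 1] by simp
  ultimately show ?thesis by (simp add: integral_unique[OF int] integral_unique)
qed

section \<open>Gibbs measures of Lebesgue-preserving maps\<close>

text \<open>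
  Lebesgue measure on the unit interval is pushed forward by the expansion whose cells are nested
  intervals of length \<open>p\<close>; words are read as in \<^const>\<open>right_word\<close>, so the newest digit comes first.
\<close>

locale word_weights =
  fixes d :: nat and p :: "nat list \<Rightarrow> real"
  assumes nonneg: "\<And>l. 0 \<le> p l" and root: "p [] = 1"
    and children: "\<And>l. set l \<subseteq> {..<d} \<Longrightarrow> p l = (\<Sum>j<d. p (j # l))"
begin

primrec left_end :: "nat list \<Rightarrow> real" where
  "left_end [] = 0"
| "left_end (j # l) = left_end l + (\<Sum>i<j. p (i # l))"

text \<open>Greedy choice: the first sibling whose right end exceeds \<open>x\<close>. With
  half-open cells this skips siblings of weight 0.\<close>

primrec expansion :: "real \<Rightarrow> nat \<Rightarrow> nat list" where
  "expansion x 0 = []"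
| "expansion x (Suc n) =
     (LEAST j. x < left_end (expansion x n) + (\<Sum>i<Suc j. p (i # expansion x n))) # expansion x n"

text \<open>Expansions grow at the head, so a digit once produced never changes.\<close>

definition digits :: "real \<Rightarrow> nat \<Rightarrow> nat" where
  "digits x k = hd (expansion x (Suc k))"

lemma expansion_digits: "expansion x n = right_word (digits x) n"
proof (induction n)
  case (Suc n)
  have "expansion x (Suc n) = digits x n # expansion x n" by (simp add: digits_def)
  also have "\<dots> = right_word (digits x) (Suc n)" by (simp only: Suc) (simp add: right_word_def)
  finally show ?case .
qed (simp add: right_word_def)

lemma expansion_cell:
  assumes "x \<in> {0..<1}"
  shows "set (expansion x n) \<subseteq> {..<d} \<and> left_end (expansion x n) \<le> x \<and>
     x < left_end (expansion x n) + p (expansion x n)"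
proof (induction n)
  case (Suc n)
  let ?l = "expansion x n"
  let ?P = "\<lambda>j. x < left_end ?l + (\<Sum>i<Suc j. p (i # ?l))"
  define j where "j = (LEAST j. ?P j)"
  have d: "x < left_end ?l + (\<Sum>i<d. p (i # ?l))" using Suc children[of ?l] by simp
  have "d \<noteq> 0" using d Suc by (intro notI) simp
  then have "?P (d - 1)" using d by simp
  then have j: "?P j" "j \<le> d - 1" unfolding j_def by (rule LeastI, rule Least_le)
  have "left_end ?l + (\<Sum>i<j. p (i # ?l)) \<le> x"
  proof (cases j)
    case (Suc i)
    then have "\<not> ?P i" using not_less_Least[of i ?P] by (simp add: j_def)
    then show ?thesis using Suc by simp
  qed (use \<open>set ?l \<subseteq> {..<d} \<and> left_end ?l \<le> x \<and> x < left_end ?l + p ?l\<close> in simp)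
  moreover have "expansion x (Suc n) = j # ?l" by (simp only: expansion.simps j_def)
  moreover have "j < d" using j \<open>d \<noteq> 0\<close> by linarith
  ultimately show ?case using j(1) Suc by simp
qed (use assms in \<open>auto simp: root\<close>)

lemma expansion_eq:
  assumes l: "set l \<subseteq> {..<d}"
  shows "{x \<in> {0..<1}. expansion x (length l) = l} = {left_end l..<left_end l + p l}"
  using l
proof (induction l)
  case (Cons j l)
  then have IH: "{x \<in> {0..<1}. expansion x (length l) = l} = {left_end l..<left_end l + p l}"
    and l: "set l \<subseteq> {..<d}" and j: "j < d" by auto
  have mono: "(\<Sum>i<a. p (i # l)) \<le> (\<Sum>i<b. p (i # l))" if "a \<le> b" for a b
    using that by (intro sum_mono2) (auto simp: nonneg)
  show ?case
  proof (intro equalityI subsetI)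
    fix x assume "x \<in> {x \<in> {0..<1}. expansion x (length (j # l)) = j # l}"
    then show "x \<in> {left_end (j # l)..<left_end (j # l) + p (j # l)}"
      using expansion_cell[of x "length (j # l)"] by auto
  next
    fix x assume x: "x \<in> {left_end (j # l)..<left_end (j # l) + p (j # l)}"
    have "(\<Sum>i<Suc j. p (i # l)) \<le> p l" using mono[of "Suc j" d] j children[OF l] by simp
    moreover have "0 \<le> (\<Sum>i<j. p (i # l))" using mono[of 0 j] by simp
    ultimately have "x \<in> {left_end l..<left_end l + p l}" using x by auto
    then have "x \<in> {x \<in> {0..<1}. expansion x (length l) = l}" unfolding IH .
    then have e: "x \<in> {0..<1}" "expansion x (length l) = l" by auto
    have "(LEAST k. x < left_end l + (\<Sum>i<Suc k. p (i # l))) = j"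
    proof (rule Least_equality)
      show "x < left_end l + (\<Sum>i<Suc j. p (i # l))" using x by simp
      fix k assume k: "x < left_end l + (\<Sum>i<Suc k. p (i # l))"
      show "j \<le> k"
      proof (rule ccontr)
        assume "\<not> j \<le> k"
        then have "(\<Sum>i<Suc k. p (i # l)) \<le> (\<Sum>i<j. p (i # l))" by (intro mono) simp
        then show False using k x by simp
      qed
    qed
    then show "x \<in> {x \<in> {0..<1}. expansion x (length (j # l)) = j # l}" using e by simp
  qed
qed (auto simp: root)

lemma digits_in_dual_space:
  assumes "x \<in> {0..<1}"
  shows "digits x \<in> dual_space d"
proof -
  have "digits x k < d" for k
    using expansion_cell[OF assms, of "Suc k"] by (auto simp: digits_def)
  then show ?thesis by (simp add: dual_space_def)
qed

definition unit_interval :: "real measure" where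
  "unit_interval = restrict_space lborel {0..<1}"

lemma space_unit_interval: "space unit_interval = {0..<1}"
  by (simp add: unit_interval_def space_restrict_space)

lemma expansion_sets:
  "{x \<in> {0..<1}. expansion x n \<in> S} \<in> sets unit_interval"
proof -
  let ?L = "{l. set l \<subseteq> {..<d} \<and> length l = n}"
  have "{x \<in> {0..<1}. expansion x n \<in> S} = (\<Union>l\<in>?L \<inter> S. {x \<in> {0..<1}. expansion x (length l) = l})"
  proof -
    have "length (expansion x n) = n" for x by (induction n) auto
    then show ?thesis using expansion_cell by auto
  qed
  also have "\<dots> = (\<Union>l\<in>?L \<inter> S. {left_end l..<left_end l + p l} \<inter> {0..<1})"
    using expansion_eq by (intro SUP_cong refl) blast
  also have "\<dots> \<in> sets unit_interval"
    using finite_lists_length_eq[of "{..<d}" n]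
    by (intro sets.finite_UN) (auto simp: unit_interval_def sets_restrict_space)
  finally show ?thesis .
qed

definition sequence_measure :: "(nat \<Rightarrow> nat) measure" where
  "sequence_measure = distr unit_interval (restrict_space borel (dual_space d)) digits"

lemma measurable_digits: "digits \<in> unit_interval \<rightarrow>\<^sub>M restrict_space borel (dual_space d)"
proof (rule measurable_restrict_space2)
  show "digits \<in> space unit_interval \<rightarrow> dual_space d"
    using digits_in_dual_space by (auto simp: space_unit_interval)
  show "digits \<in> unit_interval \<rightarrow>\<^sub>M borel"
  proof (rule measurable_sigma_sets[OF sets_borel_sequences])
    fix A assume "A \<in> {{w :: nat \<Rightarrow> nat. w i \<in> A} | i A. True}"
    then obtain i B where A: "A = {w. w i \<in> B}" by blast
    have "digits -` A \<inter> space unit_interval = {x \<in> {0..<1}. expansion x (Suc i) \<in> {l. hd l \<in> B}}"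
      by (auto simp: A digits_def space_unit_interval)
    then show "digits -` A \<inter> space unit_interval \<in> sets unit_interval"
      by (simp only: expansion_sets)
  qed auto
qed

lemma seq_measure: "seq_measure sequence_measure d"
proof -
  have "prob_space unit_interval"
    by (rule prob_spaceI) (simp add: unit_interval_def space_restrict_space emeasure_restrict_space)
  then interpret prob_space sequence_measure
    unfolding sequence_measure_def by (rule prob_space.prob_space_distr[OF _ measurable_digits])
  show ?thesis by unfold_locales (simp add: sequence_measure_def)
qed

lemma measure_cylinder:
  assumes w: "w \<in> dual_space d"
  shows "measure sequence_measure (cylinder d w n) = p (right_word w n)"
proof -
  interpret seq_measure sequence_measure d by (rule seq_measure)
  let ?l = "right_word w n"
  have l: "set ?l \<subseteq> {..<d}" using w by (auto simp: right_word_def dual_space_def)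
  have "cylinder d w n \<in> sets (restrict_space borel (dual_space d))"
    using cylinder_sets by (simp add: sequence_measure_def)
  then have "measure sequence_measure (cylinder d w n) = measure unit_interval (digits -` cylinder d w n \<inter> space unit_interval)"
    unfolding sequence_measure_def by (intro measure_distr measurable_digits)
  also have "digits -` cylinder d w n \<inter> space unit_interval = {x \<in> {0..<1}. expansion x (length ?l) = ?l}"
    using digits_in_dual_space
    by (auto simp: space_unit_interval cylinder_def expansion_digits right_word_eq_iff)
  also have "measure unit_interval \<dots> = measure lborel \<dots>"
    unfolding unit_interval_def by (intro measure_restrict_space) auto
  also have "\<dots> = p ?l"
    unfolding expansion_eq[OF l] using nonneg by simp
  finally show ?thesis .
qed

end

text \<open>Some cylinder smaller than a supposed atom meets it in positive measure. The atom then
  lies in that cylinder up to a null set, so its measure is at most that of the cylinder, which is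
  less.\<close>

lemma non_atomicI:
  assumes "seq_measure M d"
    and small: "\<And>e. 0 < e \<Longrightarrow> \<exists>n. \<forall>w\<in>dual_space d. measure M (cylinder d w n) < e"
  shows "non_atomic M"
  unfolding non_atomic_def
proof
  interpret seq_measure M d by (rule assms(1))
  assume "\<exists>A\<in>sets M. 0 < emeasure M A \<and>
    (\<forall>B\<in>sets M. B \<subseteq> A \<longrightarrow> emeasure M B = 0 \<or> emeasure M (A - B) = 0)"
  then obtain A where A: "A \<in> sets M" "0 < emeasure M A"
    and atom: "\<And>B. B \<in> sets M \<Longrightarrow> B \<subseteq> A \<Longrightarrow> emeasure M B = 0 \<or> emeasure M (A - B) = 0" by blast
  have "0 < measure M A" using A by (simp add: emeasure_eq_measure)
  then obtain n where n: "\<And>w. w \<in> dual_space d \<Longrightarrow> measure M (cylinder d w n) < measure M A"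
    using small by blast
  let ?L = "prefix n ` space M"
  have "\<exists>l\<in>?L. measure M (prefix n -` {l} \<inter> A) \<noteq> 0"
  proof (rule ccontr)
    assume none: "\<not> (\<exists>l\<in>?L. measure M (prefix n -` {l} \<inter> A) \<noteq> 0)"
    have S: "prefix n -` {l} \<inter> A \<in> sets M" for l
    proof -
      have "prefix n -` {l} \<inter> A = (prefix n -` {l} \<inter> space M) \<inter> A"
        using sets.sets_into_space[OF A(1)] by auto
      then show ?thesis using prefix_sets A by simp
    qed
    have "A = (\<Union>l\<in>?L. prefix n -` {l} \<inter> A)" using sets.sets_into_space[OF A(1)] by auto
    then have "measure M A \<le> (\<Sum>l\<in>?L. measure M (prefix n -` {l} \<inter> A))"
      using measure_UNION_le[of ?L "\<lambda>l. prefix n -` {l} \<inter> A" M] S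
        simple_functionD(1)[OF simple_function_prefix] by simp
    also have "\<dots> = 0" by (intro sum.neutral) (use none in blast)
    finally show False using \<open>0 < measure M A\<close> by simp
  qed
  then obtain w where w: "w \<in> space M" "measure M (prefix n -` {prefix n w} \<inter> A) \<noteq> 0" by blast
  have eq: "prefix n -` {prefix n w} \<inter> A = cylinder d w n \<inter> A"
    using sets.sets_into_space[OF A(1)] by (auto simp: cylinder_eq_prefix)
  have "emeasure M (cylinder d w n \<inter> A) = 0 \<or> emeasure M (A - cylinder d w n \<inter> A) = 0"
    using A by (intro atom) auto
  then have "measure M (A - cylinder d w n) = 0"
    using w(2) by (auto simp: eq measure_def Diff_Int_distrib2 Diff_Int)
  moreover have "measure M A \<le> measure M ((A - cylinder d w n) \<union> cylinder d w n)"
    using A by (intro finite_measure_mono) auto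
  moreover have "\<dots> \<le> measure M (A - cylinder d w n) + measure M (cylinder d w n)"
    using A by (intro measure_Un_le) auto
  ultimately show False using n[of w] w(1) by (simp add: space_M)
qed

text \<open>A basic open set of the product topology restricts finitely many coordinates, so it
  contains a cylinder around each of its points in the dual space.\<close>

lemma measure_support_eq_dual_space:
  assumes "seq_measure M d" and pos: "\<And>w n. w \<in> dual_space d \<Longrightarrow> 0 < measure M (cylinder d w n)"
  shows "measure_support M = dual_space d"
proof -
  interpret seq_measure M d by (rule assms(1))
  have "0 < emeasure M U" if U: "openin (top_of_set (space M)) U" "w \<in> U" and w: "w \<in> dual_space d" for U w
  proof -
    obtain T where T: "open T" "U = space M \<inter> T" using U by (auto simp: openin_open)
    then have "w \<in> T" using U by simp
    have "openin (product_topology (\<lambda>_. euclidean) UNIV) T" using T(1) by (simp add: open_fun_def)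
    from product_topology_open_contains_basis[OF this \<open>w \<in> T\<close>]
    obtain X where X: "w \<in> Pi\<^sub>E UNIV X" "finite {i. X i \<noteq> UNIV}" "Pi\<^sub>E UNIV X \<subseteq> T"
      by auto
    obtain n where n: "\<And>i. X i \<noteq> UNIV \<Longrightarrow> i < n"
      using finite_nat_set_iff_bounded[THEN iffD1, OF X(2)] by blast
    have "cylinder d w n \<subseteq> U"
    proof
      fix u assume u: "u \<in> cylinder d w n"
      have "u i \<in> X i" for i
        using u n[of i] X(1) by (cases "X i = UNIV") (auto simp: cylinder_def PiE_def)
      then have "u \<in> T" using X(3) by (auto simp: PiE_def)
      then show "u \<in> U" using u T by (simp add: cylinder_def space_M)
    qed
    moreover have "U \<in> sets M"
      using T coordinate_sets[OF borel_open[OF T(1)]] by (simp add: Int_commute)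
    ultimately have "measure M (cylinder d w n) \<le> measure M U" by (intro finite_measure_mono)
    then show ?thesis using pos[OF w, of n] by (simp add: emeasure_eq_measure)
  qed
  then show ?thesis by (auto simp: measure_support_def space_M)
qed

lemma word_value_Cons: "word_value d (j # l) = j * d ^ length l + word_value d l"
  unfolding word_value_def by (simp add: sum.lessThan_Suc_shift del: sum.lessThan_Suc)

section \<open>Interval lengths as measures of cylinders\<close>

context measure_preserving_lift_inverse
begin

text \<open>Consistency for cylinders that are refined at the left. A letter \<open>j\<close> in
  front of a word of length \<open>n\<close> becomes a translation by \<open>j\<close> after
  \<open>n\<close> iterates, and \<open>preserves\<close> at the two end points sums the images
  under the last \<open>G\<close>. Unlike \<open>sum_cell_length_children\<close>, this uses
  preservation of Lebesgue measure.\<close>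

lemma sum_cell_length_prepend:
  "(\<Sum>j<d. cell_length (Suc n) (real (j * d ^ n + m))) = cell_length n (real m)"
proof -
  have "(G ^^ Suc n) (x + real d ^ n * real j) = G ((G ^^ n) x + real j)" for x j
    by (simp add: funpow_shift)
  from this[of "real m"] this[of "real m + 1"]
  have "(\<Sum>j<d. cell_length (Suc n) (real (j * d ^ n + m))) =
      (\<Sum>j<d. G ((G ^^ n) (real m + 1) + real j) - G ((G ^^ n) (real m) + real j))"
    unfolding cell_length_def by (intro sum.cong refl) (simp add: algebra_simps)
  also have "\<dots> = (\<Sum>j<d. (G ((G ^^ n) (real m + 1) + real j) - G (real j)) - (G ((G ^^ n) (real m) + real j) - G (real j)))"
    by simp
  also have "\<dots> = cell_length n (real m)"
    unfolding sum_subtractf preserves cell_length_def by (simp add: preserves[unfolded sum_subtractf])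
  finally show ?thesis .
qed

definition weight :: "nat list \<Rightarrow> real" where
  "weight l = cell_length (length l) (real (word_value d l))"

lemma word_weights: "word_weights d weight"
proof
  show "0 \<le> weight l" for l by (simp add: weight_def cell_length_pos less_imp_le)
  show "weight [] = 1" by (simp add: weight_def word_value_def cell_length_def)
  show "weight l = (\<Sum>j<d. weight (j # l))" for l
    by (simp only: weight_def word_value_Cons list.size sum_cell_length_prepend add_0_right add_Suc_right)
qed

definition gibbs_measure :: "(nat \<Rightarrow> nat) measure" where
  "gibbs_measure = word_weights.sequence_measure d weight"

lemma seq_measure_gibbs_measure: "seq_measure gibbs_measure d"
  unfolding gibbs_measure_def by (rule word_weights.seq_measure[OF word_weights])

lemma measure_gibbs_cylinder:
  "w \<in> dual_space d \<Longrightarrow> measure gibbs_measure (cylinder d w n) = cell_length n (real (digits_value d w n))"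
  unfolding gibbs_measure_def
  by (simp add: word_weights.measure_cylinder[OF word_weights] weight_def word_value_right_word)

text \<open>Measures of cylinders are lengths of word intervals, so from length 1 on the Gibbs
  quotient equals the quotient in the dual derivative. Geometric shrinking of the lengths excludes
  atoms, and their positivity gives full support.\<close>

lemma dual_gibbs_gibbs_measure:
  assumes "symmetric_lift_inverse d G \<epsilon>"
  shows "dual_gibbs d (dual_derivative d endomorphism) gibbs_measure"
proof -
  interpret symmetric_lift_inverse d G \<epsilon> by (rule assms)
  interpret M: seq_measure gibbs_measure d by (rule seq_measure_gibbs_measure)
  have "non_atomic gibbs_measure"
  proof (rule non_atomicI[OF seq_measure_gibbs_measure])
    fix e :: real assume "0 < e"
    then obtain n where n: "contraction ^ n < e" using real_arch_pow_inv contraction by blast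
    show "\<exists>n. \<forall>w\<in>dual_space d. measure gibbs_measure (cylinder d w n) < e"
      using cell_length_le[of _ n] n
      by (intro exI[of _ n] ballI) (auto simp: measure_gibbs_cylinder intro: le_less_trans)
  qed
  moreover have "measure_support gibbs_measure = dual_space d"
    by (rule measure_support_eq_dual_space[OF seq_measure_gibbs_measure])
       (simp add: measure_gibbs_cylinder cell_length_pos)
  moreover have "(\<lambda>n. measure gibbs_measure (dual_shift ` right_cylinder d (right_word w n)) /
      measure gibbs_measure (right_cylinder d (right_word w n))) \<longlonglongrightarrow> dual_derivative d endomorphism w"
    if w: "w \<in> dual_space d" for w
  proof (rule LIMSEQ_imp_Suc)
    note F = circle_lift_eq[OF is_circle_lift_lift] inv_lift
    show "(\<lambda>n. measure gibbs_measure (dual_shift ` right_cylinder d (right_word w (Suc n))) /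
        measure gibbs_measure (right_cylinder d (right_word w (Suc n)))) \<longlonglongrightarrow> dual_derivative d endomorphism w"
      using LIMSEQ_Suc[OF dual_derivative_limit(1)[OF F w]]
      unfolding right_cylinder_right_word dual_shift_image_cylinder[OF w] butlast_right_word
        measure_word_interval[OF F] measure_gibbs_cylinder[OF w]
        measure_gibbs_cylinder[OF dual_shift_in_dual_space[OF w]] .
  qed
  ultimately show ?thesis
    using M.sets_M M.prob_space_axioms by (simp add: dual_gibbs_def)
qed

end

context
  fixes d :: nat and \<beta> :: real
  assumes d: "2 \<le> d" and \<beta>: "0 \<le> \<beta>"
begin

interpretation E: expanding_lift_inverse d "softmax_primitive d \<beta>" "softmax d \<beta>"
  "exp \<beta> / (exp \<beta> + exp (- \<beta>))" "4 * pi * \<beta> + 1"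
  by (rule softmax_primitive_locales(1)[OF d \<beta>])

interpretation P: measure_preserving_lift_inverse d "softmax_primitive d \<beta>"
  by (rule softmax_primitive_locales(2)[OF d \<beta>])

definition softmax_measure :: "(nat \<Rightarrow> nat) measure" where
  "softmax_measure = P.gibbs_measure"

lemma softmax_measure_entropy: "metric_entropy softmax_measure dual_shift \<in> gibbs_entropies d"
  unfolding gibbs_entropies_def TUS_def softmax_measure_def
  using E.uniformly_symmetric P.dual_gibbs_gibbs_measure[OF E.symmetric] by blast

lemma shift_preserving_softmax_measure: "shift_preserving softmax_measure d"
  unfolding softmax_measure_def
  by (rule dual_gibbs_shift_preserving[OF E.uniformly_symmetric P.dual_gibbs_gibbs_measure[OF E.symmetric]])

lemma measure_softmax_cylinder:
  "w \<in> dual_space d \<Longrightarrow> measure softmax_measure (cylinder d w n) =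
     (softmax_primitive d \<beta> ^^ n) (real (digits_value d w n) + 1) - (softmax_primitive d \<beta> ^^ n) (real (digits_value d w n))"
  unfolding softmax_measure_def by (simp add: P.measure_gibbs_cylinder E.cell_length_def)

end

section \<open>The two ends of the family: uniform and concentrated\<close>

lemma shift_preserving_coordinate_measure:
  assumes "shift_preserving M d" "w \<in> dual_space d"
  shows "(\<lambda>u. u 0) -` {w 0} \<inter> space M = cylinder d w 1"
proof -
  interpret shift_preserving M d by (rule assms(1))
  show ?thesis by (auto simp: cylinder_def space_M)
qed

text \<open>At \<open>\<beta> = 0\<close> the inverse lift is \<open>x / d\<close>, the circle map
  is the \<open>d\<close>-th power, and all cylinders of one length have equal measure.\<close>

lemma ln_in_gibbs_entropies:
  assumes d: "2 \<le> d"
  shows "ereal (ln d) \<in> gibbs_entropies d"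
proof -
  let ?M = "softmax_measure d 0"
  interpret shift_preserving ?M d by (rule shift_preserving_softmax_measure[OF d]) simp
  have mem: "metric_entropy ?M dual_shift \<in> gibbs_entropies d"
    by (rule softmax_measure_entropy[OF d]) simp
  have G: "(softmax_primitive d 0 ^^ n) x = x / d ^ n" for n x
    by (induction n) (simp_all add: softmax_primitive_0[OF d])
  have "measure ?M (prefix n -` {prefix n w} \<inter> space ?M) = 1 / d ^ n" if "w \<in> space ?M" for w n
    using that measure_softmax_cylinder[OF d, of 0 w n]
    unfolding cylinder_eq_prefix[symmetric] by (simp add: space_M G add_divide_distrib)
  then have "ereal (ln d) \<le> metric_entropy ?M dual_shift"
    using d by (intro metric_entropy_ge_uniform) auto
  then have "metric_entropy ?M dual_shift = ereal (ln d)"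
    using gibbs_entropies_bounds(2)[OF mem] by (rule antisym[rotated])
  then show ?thesis using mem by simp
qed

text \<open>The cylinder of the letter 0 is measured by the increment of the inverse lift from 0 to
  1, which tends to 1 as \<open>\<beta>\<close> runs through the natural numbers.\<close>

lemma coordinate_entropy_softmax_tendsto:
  assumes d: "2 \<le> d"
  shows "(\<lambda>n. shannon (softmax_measure d (real n)) (\<lambda>w. w 0)) \<longlonglongrightarrow> 0"
proof -
  let ?M = "\<lambda>n. softmax_measure d (real n)"
  have sp: "shift_preserving (?M n) d" for n by (rule shift_preserving_softmax_measure[OF d]) simp
  define p where "p j n = measure (?M n) ((\<lambda>w. w 0) -` {j} \<inter> space (?M n))" for j n
  have "(\<lambda>n. - (\<Sum>j\<in>{..<d}. p j n * ln (p j n))) \<longlonglongrightarrow> 0"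
  proof (rule tendsto_entropy_concentrated)
    show "finite {..<d}" "0 \<in> {..<d}" using d by auto
    show "0 \<le> p j n" for j n by (simp add: p_def)
    show "(\<Sum>j<d. p j n) = 1" for n
    proof -
      interpret shift_preserving "?M n" d by (rule sp)
      have "(\<Sum>j<d. p j n) = measure (?M n) (\<Union>j<d. (\<lambda>w. w 0) -` {j} \<inter> space (?M n))"
        unfolding p_def using simple_functionD(2)[OF simple_function_coordinate]
        by (intro finite_measure_finite_Union[symmetric]) (auto simp: disjoint_family_on_def)
      also have "(\<Union>j<d. (\<lambda>w. w 0) -` {j} \<inter> space (?M n)) = space (?M n)"
        by (auto simp: space_M dual_space_def)
      finally show ?thesis by (simp add: prob_space)
    qed
    have "p 0 n = softmax_primitive d (real n) 1" for n
    proof -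
      have w: "(\<lambda>_. 0) \<in> dual_space d" using d by (simp add: dual_space_def)
      show ?thesis
        using shift_preserving_coordinate_measure[OF sp w, of n]
          measure_softmax_cylinder[OF d _ w, of "real n" 1] softmax_primitive(1)[OF d, of "real n"]
        by (simp add: p_def digits_value_def)
    qed
    then show "p 0 \<longlonglongrightarrow> 1" using tendsto_softmax_primitive_1[OF d] by presburger
  qed
  moreover have "shannon (?M n) (\<lambda>w. w 0) = - (\<Sum>j\<in>{..<d}. p j n * ln (p j n))" for n
  proof -
    interpret shift_preserving "?M n" d by (rule sp)
    show ?thesis
      unfolding p_def by (rule shannon_superset) (auto simp: space_M dual_space_def)
  qed
  ultimately show ?thesis by simp
qed

theorem theorem23:
  fixes d :: nat
  assumes "2 \<le> d"
  shows "ereal (ln (real d)) \<in> gibbs_entropies d \<and>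
         (\<forall>h \<in> gibbs_entropies d. h \<le> ereal (ln (real d))) \<and>
         Inf (gibbs_entropies d) = 0"
proof (intro conjI ballI)
  show "ereal (ln (real d)) \<in> gibbs_entropies d" by (rule ln_in_gibbs_entropies[OF assms])
  show "h \<le> ereal (ln (real d))" if "h \<in> gibbs_entropies d" for h
    by (rule gibbs_entropies_bounds(2)[OF that])
  show "Inf (gibbs_entropies d) = 0"
  proof (rule antisym)
    show "0 \<le> Inf (gibbs_entropies d)" by (intro Inf_greatest gibbs_entropies_bounds(1))
    have le: "Inf (gibbs_entropies d) \<le> ereal (shannon (softmax_measure d (real n)) (\<lambda>w. w 0))" for n
    proof -
      interpret shift_preserving "softmax_measure d (real n)" d
        by (rule shift_preserving_softmax_measure[OF assms]) simp
      have "Inf (gibbs_entropies d) \<le> metric_entropy (softmax_measure d (real n)) dual_shift"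
        by (intro Inf_lower softmax_measure_entropy[OF assms]) simp
      then show ?thesis using metric_entropy_le by (rule order_trans)
    qed
    have lim: "(\<lambda>n. ereal (shannon (softmax_measure d (real n)) (\<lambda>w. w 0))) \<longlonglongrightarrow> ereal 0"
      by (intro tendsto_ereal coordinate_entropy_softmax_tendsto[OF assms])
    show "Inf (gibbs_entropies d) \<le> 0"
      unfolding zero_ereal_def by (rule LIMSEQ_le_const[OF lim]) (use le in blast)
  qed
qed

end
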